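(* For integers $k,m\ge1$ and $n\ge 2mk$, and for every prime power $q$, we have $$\mathrm{Poly}_q(n,m;k)=c(m,k)\,(1+O_k(1/q))\asymp_k 1+m^{2^{2k-1}-2k-1}.$$
   Context: $\mathbb F_q$ is the finite field with $q$ elements. The Möbius function $\mu$ on monic polynomials of $\mathbb F_q[t]$ is the multiplicative function with $\mu(P)=-1$ and $\mu(P^j)=0$ for $j\ge2$, for every monic irreducible $P$. Define $$\mathrm{Poly}_q(n,m;k):=\frac1{q^n}\sum_{\substack{N\in\mathbb F_q[t]\ \text{monic}\\ \deg N=n}}\Bigl|\sum_{\substack{M\mid N,\ M\ \text{monic}\\ \deg M=m}}\mu(M)\Bigr|^{2k}.$$ The quantity $c(m,k)$ is the number of $(2^{2k}-1)$-tuples $(r_I)_{\emptyset\ne I\subset\{1,\dots,2k\}}$ of non-negative integers such that $r_I\in\{0,1\}$ whenever $\#I$ is odd and $\sum_{I:\ i\in I}r_I=m$ for each $i\in\{1,\dots,2k\}$. The constants implied in $O_k$ and $\asymp_k$ depend only on $k$; $X\asymp_k Y$ means $C_1Y\le X\le C_2Y$ for positive constants $C_1,C_2$ depending only on $k$. *)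

theory Defs
  imports Complex_Main "HOL-Library.FuncSet" "HOL-Algebra.Polynomial_Divisibility" "HOL-Algebra.Weak_Morphisms"
begin

text \<open>
  A finite field is a locale-style field \<open>F\<close> with finite carrier, so that one pair of constants can
  serve all finite fields at once (with polynomials over a type of class \<open>field\<close>, a constant could
  depend on the type, hence on \<open>q\<close>). Polynomials are coefficient lists, leading coefficient first;
  the zero polynomial is \<open>[]\<close>.
\<close>

definition monic_polys :: "('a, 'b) ring_scheme \<Rightarrow> 'a list set" where
  "monic_polys F = {M \<in> carrier (poly_ring F). M \<noteq> [] \<and> lead_coeff M = \<one>\<^bsub>F\<^esub>}"

definition coprime_polys :: "('a, 'b) ring_scheme \<Rightarrow> 'a list \<Rightarrow> 'a list \<Rightarrow> bool" where
  "coprime_polys F A B \<longleftrightarrow>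
     (\<forall>D \<in> carrier (poly_ring F).
        D pdivides\<^bsub>F\<^esub> A \<and> D pdivides\<^bsub>F\<^esub> B \<longrightarrow> D \<in> Units (poly_ring F))"

text \<open>
  The conditions on monic polynomials determine the values there; the value \<open>0\<close> elsewhere is a
  convention that makes the function unique (lemma \<open>ex1_moebius\<close> below).
\<close>

definition is_moebius :: "('a, 'b) ring_scheme \<Rightarrow> ('a list \<Rightarrow> int) \<Rightarrow> bool" where
  "is_moebius F \<mu> \<longleftrightarrow>
     \<mu> \<one>\<^bsub>poly_ring F\<^esub> = 1 \<and>
     (\<forall>A \<in> monic_polys F. \<forall>B \<in> monic_polys F.
        coprime_polys F A B \<longrightarrow> \<mu> (A \<otimes>\<^bsub>poly_ring F\<^esub> B) = \<mu> A * \<mu> B) \<and>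
     (\<forall>P \<in> monic_polys F. pirreducible\<^bsub>F\<^esub> (carrier F) P \<longrightarrow>
        \<mu> P = - 1 \<and> (\<forall>j::nat. j \<ge> 2 \<longrightarrow> \<mu> (P [^]\<^bsub>poly_ring F\<^esub> j) = 0)) \<and>
     (\<forall>M. M \<notin> monic_polys F \<longrightarrow> \<mu> M = 0)"

definition moebius :: "('a, 'b) ring_scheme \<Rightarrow> 'a list \<Rightarrow> int" where
  "moebius F = (THE \<mu>. is_moebius F \<mu>)"

text \<open>Here \<open>q\<close> is the number of elements of \<open>F\<close>.\<close>

definition Poly_moment :: "('a, 'b) ring_scheme \<Rightarrow> nat \<Rightarrow> nat \<Rightarrow> nat \<Rightarrow> real" where
  "Poly_moment F n m k =
     1 / real (card (carrier F)) ^ n *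
     (\<Sum>N | N \<in> monic_polys F \<and> degree N = n.
        \<bar>\<Sum>M | M \<in> monic_polys F \<and> degree M = m \<and> M pdivides\<^bsub>F\<^esub> N. real_of_int (moebius F M)\<bar> ^ (2 * k))"

definition c_tuples :: "nat \<Rightarrow> nat \<Rightarrow> (nat set \<Rightarrow> nat) set" where
  "c_tuples m k =
     {r \<in> (Pow {1..2 * k} - {{}}) \<rightarrow>\<^sub>E UNIV.
        (\<forall>I \<in> Pow {1..2 * k} - {{}}. odd (card I) \<longrightarrow> r I \<in> {0, 1}) \<and>
        (\<forall>i \<in> {1..2 * k}. (\<Sum>I | I \<subseteq> {1..2 * k} \<and> i \<in> I. r I) = m)}"

definition tuple_count :: "nat \<Rightarrow> nat \<Rightarrow> nat" where
  "tuple_count m k = card (c_tuples m k)"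


text \<open>
  Every finite field has an isomorphic copy with carrier in \<open>nat\<close>, so quantifying over
  \<open>F :: nat ring\<close> covers all finite fields.
\<close>

lemma finite_field_nat_copy:
  assumes "field R" "finite (carrier R)"
  shows "\<exists>S :: nat ring. field S \<and> R \<simeq> S"
proof -
  interpret R: field R by fact
  obtain f :: "'a \<Rightarrow> nat" where "inj_on f (carrier R)"
    using finite_imp_inj_to_nat_seg[OF assms(2)] by blast
  from R.inj_imp_image_ring_is_field[OF this] inj_imp_image_ring_iso[OF this]
  show ?thesis by (auto simp: is_ring_iso_def)
qed

context field
begin

lemma poly_principal: "principal_domain (poly_ring R)"
  using univ_poly_is_principal[OF carrier_is_subfield] .

lemma monic_closed: "A \<in> monic_polys R \<Longrightarrow> A \<in> carrier (poly_ring R)"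
  and monic_nonzero: "A \<in> monic_polys R \<Longrightarrow> A \<noteq> []"
  by (auto simp: monic_polys_def)

lemma monic_one: "\<one>\<^bsub>poly_ring R\<^esub> \<in> monic_polys R"
  by (auto simp: monic_polys_def univ_poly_one univ_poly_carrier[symmetric] polynomial_def)

lemma poly_mult_props:
  assumes "A \<in> carrier (poly_ring R)" "B \<in> carrier (poly_ring R)" "A \<noteq> []" "B \<noteq> []"
  shows "A \<otimes>\<^bsub>poly_ring R\<^esub> B \<noteq> []"
    and "lead_coeff (A \<otimes>\<^bsub>poly_ring R\<^esub> B) = lead_coeff A \<otimes> lead_coeff B"
    and "degree (A \<otimes>\<^bsub>poly_ring R\<^esub> B) = degree A + degree B"
proof -
  interpret UP: principal_domain "poly_ring R" by (rule poly_principal)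
  show "A \<otimes>\<^bsub>poly_ring R\<^esub> B \<noteq> []"
    using UP.integral_iff[OF assms(1,2)] assms(3,4) by (simp add: univ_poly_zero)
  show "lead_coeff (A \<otimes>\<^bsub>poly_ring R\<^esub> B) = lead_coeff A \<otimes> lead_coeff B"
    using poly_mult_lead_coeff[OF carrier_is_subring] assms
    by (simp add: univ_poly_mult univ_poly_carrier)
  show "degree (A \<otimes>\<^bsub>poly_ring R\<^esub> B) = degree A + degree B"
    using poly_mult_degree_eq[OF carrier_is_subring, of A B] assms
    by (simp add: univ_poly_mult univ_poly_carrier)
qed

lemma monic_mult:
  "A \<in> monic_polys R \<Longrightarrow> B \<in> monic_polys R \<Longrightarrow> A \<otimes>\<^bsub>poly_ring R\<^esub> B \<in> monic_polys R"
proof -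
  assume A: "A \<in> monic_polys R" and B: "B \<in> monic_polys R"
  interpret UP: principal_domain "poly_ring R" by (rule poly_principal)
  show ?thesis
    using A B poly_mult_props(1,2)[of A B] by (simp add: monic_polys_def)
qed

lemma monic_pow: "A \<in> monic_polys R \<Longrightarrow> A [^]\<^bsub>poly_ring R\<^esub> (j::nat) \<in> monic_polys R"
proof (induction j)
  case 0 thus ?case by (simp add: monic_one)
next
  case (Suc j) thus ?case by (simp add: monic_mult)
qed

lemma monic_cofactor:
  assumes "A \<in> monic_polys R" "M \<in> monic_polys R" "B \<in> carrier (poly_ring R)"
    "M = A \<otimes>\<^bsub>poly_ring R\<^esub> B"
  shows "B \<in> monic_polys R"
proof -
  interpret UP: principal_domain "poly_ring R" by (rule poly_principal)
  have ne: "B \<noteq> []"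
    using assms UP.r_null[OF monic_closed[OF assms(1)]] monic_nonzero[OF assms(2)]
    by (auto simp: univ_poly_zero)
  have "lead_coeff B \<in> carrier R"
    using assms(3) ne lead_coeff_in_carrier[OF carrier_is_subring, of "hd B" "tl B"]
    by (simp add: univ_poly_carrier)
  thus ?thesis
    using assms ne poly_mult_props(2)[of A B] by (simp add: monic_polys_def)
qed

lemma monic_assoc_eq:
  assumes "A \<in> monic_polys R" "B \<in> monic_polys R" "A \<sim>\<^bsub>poly_ring R\<^esub> B"
  shows "A = B"
proof -
  interpret UP: principal_domain "poly_ring R" by (rule poly_principal)
  obtain k where k: "k \<in> carrier R - {\<zero>}" "A = [k] \<otimes>\<^bsub>poly_ring R\<^esub> B"
    using associated_polynomials_iff[OF carrier_is_subfield, of A B] assms monic_closed by auto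
  have "[k] \<in> carrier (poly_ring R)"
    using k(1) by (auto simp: univ_poly_carrier[symmetric] polynomial_def)
  hence "\<one> = k"
    using poly_mult_props(2)[of "[k]" B] k assms(1,2) by (simp add: monic_polys_def)
  hence "A = \<one>\<^bsub>poly_ring R\<^esub> \<otimes>\<^bsub>poly_ring R\<^esub> B" using k by (simp add: univ_poly_one)
  thus ?thesis using assms monic_closed by simp
qed

lemma monic_unit_eq:
  assumes "A \<in> monic_polys R" "A \<in> Units (poly_ring R)"
  shows "A = \<one>\<^bsub>poly_ring R\<^esub>"
proof -
  obtain k where "A = [k]" using assms(2) unfolding univ_poly_carrier_units by blast
  thus ?thesis using assms(1) by (simp add: monic_polys_def univ_poly_one)
qed

text \<open>Auxiliary to \<open>ex1_moebius\<close>: monic irreducibles, and a closed form witnessing existence.\<close>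

definition mirr :: "'a list set" where
  "mirr = {P \<in> monic_polys R. pirreducible (carrier R) P}"

lemma mirr_monic: "P \<in> mirr \<Longrightarrow> P \<in> monic_polys R"
  and mirr_irr: "P \<in> mirr \<Longrightarrow> pirreducible (carrier R) P"
  and mirr_closed: "P \<in> mirr \<Longrightarrow> P \<in> carrier (poly_ring R)"
  by (auto simp: mirr_def monic_closed)

lemma mirr_degree: "P \<in> mirr \<Longrightarrow> degree P \<ge> 1"
  using pirreducible_degree[OF carrier_is_subfield mirr_closed mirr_irr] .

lemma mirr_not_unit: "P \<in> mirr \<Longrightarrow> P \<notin> Units (poly_ring R)"
  using pirreducibleE(2)[OF carrier_is_subring mirr_closed mirr_irr] .

lemma mirr_dvd_mult:
  assumes "P \<in> mirr" "A \<in> carrier (poly_ring R)" "B \<in> carrier (poly_ring R)"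
  shows "P pdivides (A \<otimes>\<^bsub>poly_ring R\<^esub> B) \<longleftrightarrow> P pdivides A \<or> P pdivides B"
proof
  interpret UP: principal_domain "poly_ring R" by (rule poly_principal)
  have "pprime (carrier R) P"
    using pprime_iff_pirreducible[OF carrier_is_subfield mirr_closed] mirr_irr assms by blast
  thus "P pdivides (A \<otimes>\<^bsub>poly_ring R\<^esub> B) \<Longrightarrow> P pdivides A \<or> P pdivides B"
    using pprimeE(3)[OF carrier_is_subfield mirr_closed[OF assms(1)]] assms by blast
  show "P pdivides A \<or> P pdivides B \<Longrightarrow> P pdivides (A \<otimes>\<^bsub>poly_ring R\<^esub> B)"
    using assms UP.divides_prod_r UP.divides_prod_l UP.m_comm mirr_closed
    unfolding pdivides_def by metis
qed

lemma ex_mirr_dvd: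
  assumes "A \<in> carrier (poly_ring R)" "A \<noteq> []" "A \<notin> Units (poly_ring R)"
  shows "\<exists>P \<in> mirr. P pdivides A"
proof -
  interpret UP: principal_domain "poly_ring R" by (rule poly_principal)
  obtain Q where Q: "Q \<in> carrier (poly_ring R)" "pirreducible (carrier R) Q" "Q pdivides A"
    using UP.exists_irreducible_divisor[of A] assms unfolding pdivides_def univ_poly_zero by auto
  have Q0: "Q \<noteq> []" using pirreducibleE(1)[OF carrier_is_subring Q(1,2)] .
  define a where "a = lead_coeff Q"
  have a: "a \<in> carrier R - {\<zero>}"
    using Q(1) Q0 lead_coeff_in_carrier[OF carrier_is_subring, of "hd Q" "tl Q"]
    by (simp add: univ_poly_carrier a_def)
  hence ia: "inv a \<in> carrier R - {\<zero>}" "inv a \<otimes> a = \<one>"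
    using field_Units Units_inv_closed[of a] Units_inv_Units[of a] Units_l_inv[of a] by auto
  have c: "[inv a] \<in> carrier (poly_ring R)"
    using ia by (auto simp: univ_poly_carrier[symmetric] polynomial_def)
  define P where "P = [inv a] \<otimes>\<^bsub>poly_ring R\<^esub> Q"
  have Pc: "P \<in> carrier (poly_ring R)" using c Q(1) by (simp add: P_def)
  have Pm: "P \<in> monic_polys R"
    using poly_mult_props(1,2)[of "[inv a]" Q] c Q(1) Q0 ia Pc by (simp add: monic_polys_def P_def a_def)
  have as: "P \<sim>\<^bsub>poly_ring R\<^esub> Q"
    using associated_polynomials_iff[OF carrier_is_subfield Pc Q(1)] ia P_def by auto
  have "pirreducible (carrier R) P"
  proof -
    have "[inv a] \<in> Units (poly_ring R)" using ia univ_poly_carrier_units by auto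
    hence "irreducible (poly_ring R) (Q \<otimes>\<^bsub>poly_ring R\<^esub> [inv a])"
      using UP.irreducible_prod_rI[OF _ _ Q(1) c] Q(2) unfolding ring_irreducible_def by blast
    thus ?thesis
      using UP.m_comm[OF Q(1) c] monic_nonzero[OF Pm]
      by (simp add: ring_irreducible_def P_def univ_poly_zero)
  qed
  moreover have "P pdivides A"
    using as Q(3) Pc Q(1) assms(1) unfolding pdivides_def
    by (meson UP.divides_trans associatedD)
  ultimately show ?thesis using Pm by (auto simp: mirr_def)
qed

lemma mirr_dvd_mirr:
  assumes "P \<in> mirr" "Q \<in> mirr" "P pdivides Q"
  shows "P = Q"
proof -
  have "P \<in> Units (poly_ring R) \<or> P \<sim>\<^bsub>poly_ring R\<^esub> Q"
    using divides_pirreducible_condition[OF mirr_irr[OF assms(2)] mirr_closed[OF assms(1)]] assms(3)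
    unfolding pdivides_def by blast
  thus ?thesis using monic_assoc_eq mirr_monic mirr_not_unit assms by blast
qed

lemma mirr_dvd_pow:
  assumes "P \<in> mirr" "A \<in> carrier (poly_ring R)" "P pdivides (A [^]\<^bsub>poly_ring R\<^esub> (j::nat))"
  shows "P pdivides A"
  using assms(3)
proof (induction j)
  interpret UP: principal_domain "poly_ring R" by (rule poly_principal)
  case 0
  hence "P \<in> Units (poly_ring R)"
    using UP.divides_unit[of P "\<one>\<^bsub>poly_ring R\<^esub>"] mirr_closed[OF assms(1)]
    by (simp add: pdivides_def)
  thus ?case using mirr_not_unit assms by blast
next
  interpret UP: principal_domain "poly_ring R" by (rule poly_principal)
  case (Suc j)
  thus ?case using mirr_dvd_mult[OF assms(1), of "A [^]\<^bsub>poly_ring R\<^esub> j" A] assms(2) by auto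
qed

lemma coprime_polys_iff:
  assumes "A \<in> monic_polys R" "B \<in> monic_polys R"
  shows "coprime_polys R A B \<longleftrightarrow> \<not> (\<exists>P \<in> mirr. P pdivides A \<and> P pdivides B)"
proof
  assume "coprime_polys R A B"
  thus "\<not> (\<exists>P \<in> mirr. P pdivides A \<and> P pdivides B)"
    using mirr_closed mirr_not_unit by (auto simp: coprime_polys_def)
next
  interpret UP: principal_domain "poly_ring R" by (rule poly_principal)
  assume *: "\<not> (\<exists>P \<in> mirr. P pdivides A \<and> P pdivides B)"
  show "coprime_polys R A B"
    unfolding coprime_polys_def
  proof (intro ballI impI, elim conjE)
    fix D assume D: "D \<in> carrier (poly_ring R)" "D pdivides A" "D pdivides B"
    show "D \<in> Units (poly_ring R)"
    proof (rule ccontr)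
      assume nu: "D \<notin> Units (poly_ring R)"
      have "D \<noteq> []" using D(2) zero_pdivides monic_nonzero[OF assms(1)] by auto
      then obtain P where P: "P \<in> mirr" "P pdivides D" using ex_mirr_dvd D(1) nu by blast
      hence "P pdivides A" "P pdivides B"
        using D UP.divides_trans mirr_closed unfolding pdivides_def by blast+
      thus False using * P by blast
    qed
  qed
qed

lemma mirr_decomp:
  assumes "M \<in> monic_polys R" "M \<noteq> \<one>\<^bsub>poly_ring R\<^esub>"
  obtains P j B where "P \<in> mirr" "(j::nat) \<ge> 1" "B \<in> monic_polys R"
    "M = P [^]\<^bsub>poly_ring R\<^esub> j \<otimes>\<^bsub>poly_ring R\<^esub> B" "degree B < degree M"
    "coprime_polys R (P [^]\<^bsub>poly_ring R\<^esub> j) B"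
proof -
  interpret UP: principal_domain "poly_ring R" by (rule poly_principal)
  obtain P where P: "P \<in> mirr" "P pdivides M"
    using ex_mirr_dvd[of M] assms monic_unit_eq monic_closed monic_nonzero by metis
  note Pc = mirr_closed[OF P(1)]
  have ex: "\<exists>j B. B \<in> monic_polys R \<and> M = P [^]\<^bsub>poly_ring R\<^esub> (j::nat) \<otimes>\<^bsub>poly_ring R\<^esub> B \<and>
      \<not> P pdivides B" if "M \<in> monic_polys R" for M
    using that
  proof (induction "degree M" arbitrary: M rule: less_induct)
    case less
    show ?case
    proof (cases "P pdivides M")
      case False
      thus ?thesis using less.prems monic_closed by (intro exI[of _ "0::nat"] exI[of _ M]) auto
    next
      case True
      then obtain C where C: "C \<in> carrier (poly_ring R)" "M = P \<otimes>\<^bsub>poly_ring R\<^esub> C"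
        unfolding pdivides_def factor_def by blast
      have Cm: "C \<in> monic_polys R" using monic_cofactor[OF mirr_monic[OF P(1)] less.prems C] .
      have "degree C < degree M"
        using poly_mult_props(3)[of P C] Pc C Cm mirr_degree[OF P(1)]
          monic_nonzero[OF mirr_monic[OF P(1)]] monic_nonzero[OF Cm] by simp
      from less.hyps[OF this Cm] obtain j B where jB: "B \<in> monic_polys R"
        "C = P [^]\<^bsub>poly_ring R\<^esub> (j::nat) \<otimes>\<^bsub>poly_ring R\<^esub> B" "\<not> P pdivides B" by blast
      have "M = P [^]\<^bsub>poly_ring R\<^esub> Suc j \<otimes>\<^bsub>poly_ring R\<^esub> B"
        using C(2) jB Pc monic_closed[OF jB(1)] by (simp add: UP.m_ac)
      thus ?thesis using jB by blast
    qed
  qed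
  obtain j B where jB: "B \<in> monic_polys R" "M = P [^]\<^bsub>poly_ring R\<^esub> (j::nat) \<otimes>\<^bsub>poly_ring R\<^esub> B"
    "\<not> P pdivides B" using ex[OF assms(1)] by blast
  note Bc = monic_closed[OF jB(1)]
  have j: "j \<ge> 1"
  proof (rule ccontr)
    assume "\<not> j \<ge> 1"
    hence "j = 0" by simp
    hence "M = B" using jB(2) Bc by simp
    thus False using P jB(3) by simp
  qed
  have Pj: "P [^]\<^bsub>poly_ring R\<^esub> j \<in> monic_polys R" using monic_pow mirr_monic P by blast
  have "degree M = j * degree P + degree B"
    using poly_mult_props(3)[OF monic_closed[OF Pj] Bc] monic_nonzero[OF Pj] monic_nonzero[OF jB(1)]
      jB(2) polynomial_pow_degree[OF Pc] by simp
  moreover have "j * degree P > 0" using j mirr_degree[OF P(1)] by simp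
  ultimately have "degree B < degree M" by linarith
  moreover have "coprime_polys R (P [^]\<^bsub>poly_ring R\<^esub> j) B"
    unfolding coprime_polys_iff[OF Pj jB(1)]
    using mirr_dvd_pow[OF _ Pc] mirr_dvd_mirr[OF _ P(1)] jB(3) by blast
  ultimately show thesis using that P(1) j jB by blast
qed

lemma is_moebius_unique:
  assumes "is_moebius R f" "is_moebius R g"
  shows "f = g"
proof
  fix M
  show "f M = g M"
  proof (induction "degree M" arbitrary: M rule: less_induct)
    case less
    consider "M \<notin> monic_polys R" | "M = \<one>\<^bsub>poly_ring R\<^esub>"
      | "M \<in> monic_polys R" "M \<noteq> \<one>\<^bsub>poly_ring R\<^esub>" by blast
    thus ?case
    proof cases
      case 1 thus ?thesis using assms unfolding is_moebius_def by metis
    next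
      case 2 thus ?thesis using assms unfolding is_moebius_def by metis
    next
      case 3
      then obtain P j B where PB: "P \<in> mirr" "(j::nat) \<ge> 1" "B \<in> monic_polys R"
        "M = P [^]\<^bsub>poly_ring R\<^esub> j \<otimes>\<^bsub>poly_ring R\<^esub> B" "degree B < degree M"
        "coprime_polys R (P [^]\<^bsub>poly_ring R\<^esub> j) B" by (rule mirr_decomp)
      interpret UP: principal_domain "poly_ring R" by (rule poly_principal)
      have Pj: "P [^]\<^bsub>poly_ring R\<^esub> j \<in> monic_polys R" using monic_pow mirr_monic PB by blast
      have *: "h M = (if j = 1 then - 1 else 0) * h B" if "is_moebius R h" for h
      proof -
        have "h M = h (P [^]\<^bsub>poly_ring R\<^esub> j) * h B"
          using that PB Pj unfolding is_moebius_def by blast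
        moreover have "h (P [^]\<^bsub>poly_ring R\<^esub> j) = (if j = 1 then - 1 else 0)"
          using that PB(1,2) mirr_closed[OF PB(1)] unfolding is_moebius_def mirr_def by auto
        ultimately show ?thesis by simp
      qed
      show ?thesis using *[OF assms(1)] *[OF assms(2)] less.hyps[OF PB(5)] by simp
    qed
  qed
qed

definition moebius_expl :: "'a list \<Rightarrow> int" where
  "moebius_expl M = (if M \<notin> monic_polys R \<or> (\<exists>P \<in> mirr. (P [^]\<^bsub>poly_ring R\<^esub> (2::nat)) pdivides M)
     then 0 else (- 1) ^ card {P \<in> mirr. P pdivides M})"

lemma finite_mirr_dvd:
  assumes "finite (carrier R)" "M \<in> monic_polys R"
  shows "finite {P \<in> mirr. P pdivides M}"
proof (rule finite_subset)
  show "{P \<in> mirr. P pdivides M} \<subseteq> {xs. set xs \<subseteq> carrier R \<and> length xs \<le> Suc (degree M)}"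
  proof safe
    fix P x assume P: "P \<in> mirr" "P pdivides M"
    show "length P \<le> Suc (degree M)"
      using pdivides_imp_degree_le[OF carrier_is_subring mirr_closed[OF P(1)] monic_closed[OF assms(2)]
          monic_nonzero[OF assms(2)] P(2)] by linarith
    show "x \<in> set P \<Longrightarrow> x \<in> carrier R"
      using mirr_closed[OF P(1)] by (auto simp: univ_poly_carrier[symmetric] polynomial_def)
  qed
  show "finite {xs. set xs \<subseteq> carrier R \<and> length xs \<le> Suc (degree M)}"
    using finite_lists_length_le[OF assms(1)] .
qed

lemma moebius_expl_mult:
  assumes "finite (carrier R)" "A \<in> monic_polys R" "B \<in> monic_polys R" "coprime_polys R A B"
  shows "moebius_expl (A \<otimes>\<^bsub>poly_ring R\<^esub> B) = moebius_expl A * moebius_expl B"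
proof -
  interpret UP: principal_domain "poly_ring R" by (rule poly_principal)
  note Ac = monic_closed[OF assms(2)] and Bc = monic_closed[OF assms(3)]
  have cop: "\<not> (P pdivides A \<and> P pdivides B)" if "P \<in> mirr" for P
    using coprime_polys_iff[OF assms(2,3)] assms(4) that by blast
  let ?sq = "\<lambda>P. P [^]\<^bsub>poly_ring R\<^esub> (2::nat)"
  have sq: "(?sq P) pdivides (A \<otimes>\<^bsub>poly_ring R\<^esub> B) \<longleftrightarrow> (?sq P) pdivides A \<or> (?sq P) pdivides B"
    if P: "P \<in> mirr" for P
  proof
    assume *: "(?sq P) pdivides (A \<otimes>\<^bsub>poly_ring R\<^esub> B)"
    show "(?sq P) pdivides A \<or> (?sq P) pdivides B"
    proof (cases "P pdivides A")
      case False
      thus ?thesis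
        using pirreducible_pow_pdivides_iff[OF carrier_is_subfield mirr_closed[OF P] Ac Bc mirr_irr[OF P]] *
        by blast
    next
      case True
      hence "\<not> P pdivides B" using cop P by blast
      moreover have "(?sq P) pdivides (B \<otimes>\<^bsub>poly_ring R\<^esub> A)" using * UP.m_comm[OF Ac Bc] by simp
      ultimately show ?thesis
        using pirreducible_pow_pdivides_iff[OF carrier_is_subfield mirr_closed[OF P] Bc Ac mirr_irr[OF P]]
        by blast
    qed
  next
    have "?sq P \<in> carrier (poly_ring R)" using mirr_closed[OF P] by simp
    thus "(?sq P) pdivides A \<or> (?sq P) pdivides B \<Longrightarrow> (?sq P) pdivides (A \<otimes>\<^bsub>poly_ring R\<^esub> B)"
      using Ac Bc UP.divides_prod_r UP.divides_prod_l UP.m_comm unfolding pdivides_def by metis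
  qed
  have "{P \<in> mirr. P pdivides (A \<otimes>\<^bsub>poly_ring R\<^esub> B)} = {P \<in> mirr. P pdivides A} \<union> {P \<in> mirr. P pdivides B}"
    using mirr_dvd_mult[OF _ Ac Bc] by blast
  moreover have "{P \<in> mirr. P pdivides A} \<inter> {P \<in> mirr. P pdivides B} = {}" using cop by blast
  ultimately have "card {P \<in> mirr. P pdivides (A \<otimes>\<^bsub>poly_ring R\<^esub> B)} =
      card {P \<in> mirr. P pdivides A} + card {P \<in> mirr. P pdivides B}"
    using card_Un_disjoint[OF finite_mirr_dvd[OF assms(1,2)] finite_mirr_dvd[OF assms(1,3)]] by simp
  moreover have "(\<exists>P \<in> mirr. (?sq P) pdivides (A \<otimes>\<^bsub>poly_ring R\<^esub> B)) \<longleftrightarrow>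
      (\<exists>P \<in> mirr. (?sq P) pdivides A) \<or> (\<exists>P \<in> mirr. (?sq P) pdivides B)"
    using sq by blast
  ultimately show ?thesis
    using monic_mult[OF assms(2,3)] assms(2,3) by (simp add: moebius_expl_def power_add)
qed

lemma is_moebius_expl:
  assumes "finite (carrier R)"
  shows "is_moebius R moebius_expl"
proof -
  interpret UP: principal_domain "poly_ring R" by (rule poly_principal)
  have ndvd1: "\<not> P pdivides \<one>\<^bsub>poly_ring R\<^esub>" if P: "P \<in> mirr" for P
    using UP.divides_unit[OF _ mirr_closed[OF P] UP.Units_one_closed] mirr_not_unit[OF P]
    unfolding pdivides_def by blast
  have sqd: "P pdivides M" if "P \<in> mirr" "(P [^]\<^bsub>poly_ring R\<^esub> (2::nat)) pdivides M"
     "M \<in> carrier (poly_ring R)" for P M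
  proof -
    have "P pdivides (P [^]\<^bsub>poly_ring R\<^esub> (2::nat))"
      using polynomial_pow_division[OF mirr_closed[OF that(1)], of 1 2] mirr_closed[OF that(1)] by simp
    thus ?thesis using that(2,3) mirr_closed[OF that(1)] UP.divides_trans
      unfolding pdivides_def by blast
  qed
  have one: "moebius_expl \<one>\<^bsub>poly_ring R\<^esub> = 1"
  proof -
    have e: "{P \<in> mirr. P pdivides \<one>\<^bsub>poly_ring R\<^esub>} = {}" using ndvd1 by blast
    have "\<not> (\<exists>P \<in> mirr. (P [^]\<^bsub>poly_ring R\<^esub> (2::nat)) pdivides \<one>\<^bsub>poly_ring R\<^esub>)"
      using ndvd1 sqd UP.one_closed by blast
    thus ?thesis using monic_one unfolding moebius_expl_def e by simp
  qed
  have irr: "moebius_expl P = - 1" if P: "P \<in> mirr" for P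
  proof -
    have "{Q \<in> mirr. Q pdivides P} = {P}"
    proof -
      have "P pdivides P" using UP.divides_refl[OF mirr_closed[OF P]] by (simp add: pdivides_def)
      thus ?thesis using mirr_dvd_mirr[OF _ P] P by blast
    qed
    moreover have "\<not> (Q [^]\<^bsub>poly_ring R\<^esub> (2::nat)) pdivides P" if Q: "Q \<in> mirr" for Q
    proof
      assume *: "(Q [^]\<^bsub>poly_ring R\<^esub> (2::nat)) pdivides P"
      have "Q = P" using mirr_dvd_mirr[OF Q P] sqd[OF Q * mirr_closed[OF P]] by blast
      moreover have "degree (Q [^]\<^bsub>poly_ring R\<^esub> (2::nat)) \<le> degree P"
        using pdivides_imp_degree_le[OF carrier_is_subring _ mirr_closed[OF P] _ *]
          mirr_closed[OF Q] monic_nonzero[OF mirr_monic[OF P]] by simp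
      ultimately show False
        using polynomial_pow_degree[OF mirr_closed[OF P], of 2] mirr_degree[OF P] by simp
    qed
    ultimately show ?thesis using mirr_monic[OF P] by (simp add: moebius_expl_def)
  qed
  have pow: "moebius_expl (P [^]\<^bsub>poly_ring R\<^esub> j) = 0" if P: "P \<in> mirr" and j: "(j::nat) \<ge> 2" for P j
  proof -
    have "\<exists>Q \<in> mirr. (Q [^]\<^bsub>poly_ring R\<^esub> (2::nat)) pdivides (P [^]\<^bsub>poly_ring R\<^esub> j)"
      using P polynomial_pow_division[OF mirr_closed[OF P] j] by blast
    thus ?thesis by (simp add: moebius_expl_def)
  qed
  have out: "M \<notin> monic_polys R \<Longrightarrow> moebius_expl M = 0" for M by (simp add: moebius_expl_def)
  show ?thesis
    unfolding is_moebius_def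
  proof (intro conjI ballI allI impI)
    fix P assume "P \<in> monic_polys R" "pirreducible (carrier R) P"
    hence P: "P \<in> mirr" by (simp add: mirr_def)
    show "moebius_expl P = - 1" by (rule irr[OF P])
    show "moebius_expl (P [^]\<^bsub>poly_ring R\<^esub> j) = 0" if "j \<ge> 2" for j :: nat by (rule pow[OF P that])
  qed (rule one out moebius_expl_mult[OF assms]; assumption?)+
qed

lemma ex1_moebius: "finite (carrier R) \<Longrightarrow> \<exists>!\<mu>. is_moebius R \<mu>"
  using is_moebius_expl is_moebius_unique by blast

lemma is_moebius_moebius: "finite (carrier R) \<Longrightarrow> is_moebius R (moebius R)"
  unfolding moebius_def by (rule theI'[OF ex1_moebius])

end

end

theory Submission
  imports Defs "HOL-Library.Poly_Mapping" "HOL-Library.Function_Algebras"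
begin

text \<open>
  Write \<open>J = {1..2 * k}\<close>. Expanding the \<open>2 k\<close>-th power and averaging over \<open>N\<close> turns the moment into a sum
  over \<open>2 k\<close>-tuples \<open>(M\<^sub>i)\<close> of squarefree monic polynomials of degree \<open>m\<close>, each weighted by
  \<open>\<Prod> \<mu>(M\<^sub>i)\<close> and by the density \<open>1 / q ^ deg (lcm (M\<^sub>i))\<close> of the common multiples; the condition
  \<open>n \<ge> 2 * m * k\<close> makes these densities exact. Such a tuple assigns to every prime \<open>P\<close> the set of those
  \<open>i\<close> with \<open>P dvd M\<^sub>i\<close>, so the sum is the coefficient of \<open>\<Prod> x\<^sub>i ^ m\<close> in an Euler product whose factor at
  \<open>P\<close> is \<open>1 + q ^ (- deg P) * (\<Sum>I. \<plusminus> x\<^sub>I ^ deg P)\<close>, where \<open>x\<^sub>I = (\<Prod>i\<in>I. x\<^sub>i)\<close> and \<open>I\<close> runs over the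
  nonempty subsets of \<open>J\<close>. All this needs of polynomials is collected in the locale \<open>prime_system\<close>.

  Because \<open>\<Prod>P (1 - (u / q) ^ deg P) = 1 - u\<close>, the first-order part of every factor can be split off: the
  Euler product is \<open>H * G\<close>, where \<open>G\<close> is the product of \<open>1 + x\<^sub>I\<close> over odd sets and of \<open>1 / (1 - x\<^sub>I)\<close>
  over even sets, and the factors of \<open>H\<close> differ from \<open>1\<close> only in second order (lemma
  \<open>pnorm_local_factor\<close>). The coefficients of \<open>G\<close> count the systems \<open>(r\<^sub>I)\<close>; the one of
  \<open>\<Prod> x\<^sub>i ^ m\<close> is \<open>c(m,k)\<close>. Three facts about these counts are used. For \<open>k \<ge> 2\<close> put
  \<open>E = 2 ^ (2 * k - 1) - 1 - 2 * k\<close>, the number of even sets minus the number of equations.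
  \<^item> All counts with right-hand sides at most \<open>m\<close> are \<open>O((m + 1) ^ E)\<close>, as \<open>2 k\<close> of the unknowns are
    determined by the others (\<open>card_sols_le\<close>).
  \<^item> \<open>c(m,k)\<close> is at least a constant times \<open>(m + 1) ^ E\<close> (\<open>card_sols_ge\<close>).
  \<^item> Changing one right-hand side by \<open>1\<close> changes the count by \<open>O((m + 1) ^ (E - 1))\<close>
    (\<open>card_sols_diff_step\<close>).

  The sum of the absolute values of the coefficients of \<open>H - 1\<close> is \<open>O(1 / q)\<close>, so the first fact and the
  second one give the asymptotic formula with relative error \<open>O(1 / q)\<close>, and the upper bound. For the
  lower bound this is not enough when \<open>q\<close> is small. For large \<open>m\<close> the third fact shows that the moment
  is \<open>H(1,\<dots>,1) * c(m,k) + O((m + 1) ^ (E - 1))\<close>, and \<open>H(1,\<dots>,1)\<close> is bounded below by a positive constant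
  because all its factors are positive and \<open>1 + O(q ^ (- 2 * deg P))\<close>. For the remaining \<open>m\<close>, and for
  \<open>k = 1\<close>, the divisor sum is an integer, so its \<open>2 k\<close>-th power is at least its square, and the mean
  square is diagonalized as in Selberg's sieve into a sum of nonnegative terms that is bounded below
  uniformly in \<open>q\<close> and \<open>m\<close> (\<open>second_moment_ge\<close>).
\<close>

section \<open>Polynomials in several variables\<close>

text \<open>
  A polynomial in the variables \<open>x\<^sub>i\<close>, where \<open>i :: 'i\<close>, is a finitely supported map on exponent vectors
  \<open>'i \<Rightarrow> nat\<close>. As the exponents are functions and not themselves finitely supported maps, they carry the
  pointwise order that is used for truncation.
\<close>

abbreviation mcoeff :: "('e \<Rightarrow>\<^sub>0 real) \<Rightarrow> 'e \<Rightarrow> real" where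
  "mcoeff \<equiv> Poly_Mapping.lookup"

abbreviation mkeys :: "('e \<Rightarrow>\<^sub>0 real) \<Rightarrow> 'e set" where
  "mkeys \<equiv> Poly_Mapping.keys"

abbreviation mterm :: "'e \<Rightarrow> real \<Rightarrow> 'e \<Rightarrow>\<^sub>0 real" where
  "mterm \<equiv> Poly_Mapping.single"

lemma poly_sum_monomials:
  "(\<Sum>a\<in>mkeys p. mterm a (mcoeff p a)) = p"
  by (rule poly_mapping_eqI)
    (auto simp: lookup_sum lookup_single when_def in_keys_iff if_distrib cong: if_cong)

definition ev :: "('e::comm_monoid_add \<Rightarrow> real) \<Rightarrow> ('e \<Rightarrow>\<^sub>0 real) \<Rightarrow> real" where
  "ev \<phi> p = (\<Sum>a\<in>mkeys p. mcoeff p a * \<phi> a)"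

definition pnorm :: "('e::comm_monoid_add \<Rightarrow> real) \<Rightarrow> ('e \<Rightarrow>\<^sub>0 real) \<Rightarrow> real" where
  "pnorm \<phi> p = (\<Sum>a\<in>mkeys p. \<bar>mcoeff p a\<bar> * \<phi> a)"

lemma ev_eq_sum:
  "finite A \<Longrightarrow> mkeys p \<subseteq> A \<Longrightarrow> ev \<phi> p = (\<Sum>a\<in>A. mcoeff p a * \<phi> a)"
  unfolding ev_def by (rule sum.mono_neutral_left) (auto simp: in_keys_iff)

lemma pnorm_eq_sum:
  "finite A \<Longrightarrow> mkeys p \<subseteq> A \<Longrightarrow> pnorm \<phi> p = (\<Sum>a\<in>A. \<bar>mcoeff p a\<bar> * \<phi> a)"
  unfolding pnorm_def by (rule sum.mono_neutral_left) (auto simp: in_keys_iff)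

lemma ev_add: "ev \<phi> (p + q) = ev \<phi> p + ev \<phi> q"
proof -
  let ?A = "mkeys p \<union> mkeys q"
  have "mkeys (p + q) \<subseteq> ?A" by (rule keys_add)
  thus ?thesis
    by (subst (1 2 3) ev_eq_sum[of ?A]) (auto simp: lookup_add distrib_right sum.distrib)
qed

lemma ev_diff: "ev \<phi> (p - q) = ev \<phi> p - ev \<phi> q"
  using ev_add[of \<phi> "p - q" q] by simp

lemma ev_zero [simp]: "ev \<phi> 0 = 0"
  by (simp add: ev_def)

lemma ev_single: "ev \<phi> (mterm a c) = c * \<phi> a"
  by (simp add: ev_def)

lemma ev_sum: "ev \<phi> (\<Sum>i\<in>A. p i) = (\<Sum>i\<in>A. ev \<phi> (p i))"
  by (induction A rule: infinite_finite_induct) (auto simp: ev_add)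

lemma pnorm_zero [simp]: "pnorm \<phi> 0 = 0"
  by (simp add: pnorm_def)

lemma pnorm_single: "pnorm \<phi> (mterm a c) = \<bar>c\<bar> * \<phi> a"
  by (simp add: pnorm_def)

lemma pnorm_uminus: "pnorm \<phi> (- p) = pnorm \<phi> p"
  unfolding pnorm_def by (rule sum.cong) (auto simp: in_keys_iff)

lemma mult_eq_sum_singles:
  "p * q = (\<Sum>a\<in>mkeys p. \<Sum>b\<in>mkeys q.
     mterm (a + b) (mcoeff p a * mcoeff q b :: real))"
proof -
  have "p * q = (\<Sum>a\<in>mkeys p. mterm a (mcoeff p a)) *
      (\<Sum>b\<in>mkeys q. mterm b (mcoeff q b))"
    by (simp only: poly_sum_monomials)
  thus ?thesis by (simp add: sum_product mult_single)
qed

text \<open>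
  Two weights are used below. For \<open>\<phi> a = R ^ deg a\<close> with \<open>R > 1\<close> the weighted sum of absolute values
  \<open>pnorm \<phi>\<close> also controls the sum of \<open>deg a * \<bar>coefficient\<bar>\<close>; for \<open>\<phi> = 1\<close> the map \<open>ev \<phi>\<close> is
  evaluation at \<open>(1,\<dots>,1)\<close>. Multiplicativity of \<open>\<phi>\<close> makes \<open>ev \<phi>\<close> a ring homomorphism and
  \<open>pnorm \<phi>\<close> submultiplicative.
\<close>

locale weight =
  fixes \<phi> :: "'e::comm_monoid_add \<Rightarrow> real"
  assumes weight_zero: "\<phi> 0 = 1" and weight_add: "\<phi> (a + b) = \<phi> a * \<phi> b"
    and weight_nonneg: "\<phi> a \<ge> 0"
begin

lemma ev_mult: "ev \<phi> (p * q) = ev \<phi> p * ev \<phi> q"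
proof -
  have "ev \<phi> (p * q) = (\<Sum>a\<in>mkeys p. \<Sum>b\<in>mkeys q.
      (mcoeff p a * mcoeff q b) * \<phi> (a + b))"
    by (subst mult_eq_sum_singles) (simp add: ev_sum ev_single)
  also have "\<dots> = ev \<phi> p * ev \<phi> q"
    unfolding ev_def sum_product by (simp add: weight_add algebra_simps)
  finally show ?thesis .
qed

lemma ev_one: "ev \<phi> 1 = 1"
  by (simp add: weight_zero ev_single flip: single_one)

lemma ev_prod: "ev \<phi> (\<Prod>i\<in>A. p i) = (\<Prod>i\<in>A. ev \<phi> (p i))"
  by (induction A rule: infinite_finite_induct) (auto simp: ev_mult ev_one)

lemma pnorm_nonneg: "pnorm \<phi> p \<ge> 0"
  unfolding pnorm_def by (intro sum_nonneg mult_nonneg_nonneg weight_nonneg) auto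

lemma pnorm_triangle: "pnorm \<phi> (p + q) \<le> pnorm \<phi> p + pnorm \<phi> q"
proof -
  let ?A = "mkeys p \<union> mkeys q"
  have "mkeys (p + q) \<subseteq> ?A" by (rule keys_add)
  thus ?thesis
    by (subst (1 2 3) pnorm_eq_sum[of ?A])
      (auto simp: lookup_add sum.distrib[symmetric] distrib_right[symmetric]
        intro!: sum_mono mult_right_mono weight_nonneg)
qed

lemma pnorm_sum: "pnorm \<phi> (\<Sum>i\<in>A. p i) \<le> (\<Sum>i\<in>A. pnorm \<phi> (p i))"
proof (induction A rule: infinite_finite_induct)
  case (insert i A)
  thus ?case using pnorm_triangle[of "p i" "\<Sum>i\<in>A. p i"] by simp
qed auto

lemma pnorm_mult: "pnorm \<phi> (p * q) \<le> pnorm \<phi> p * pnorm \<phi> q"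
proof -
  have "pnorm \<phi> (p * q) \<le> (\<Sum>a\<in>mkeys p. \<Sum>b\<in>mkeys q.
      pnorm \<phi> (mterm (a + b) (mcoeff p a * mcoeff q b)))"
    by (subst mult_eq_sum_singles) (intro order_trans[OF pnorm_sum] sum_mono pnorm_sum)
  also have "\<dots> = pnorm \<phi> p * pnorm \<phi> q"
    unfolding pnorm_def[of _ p] pnorm_def[of _ q] sum_product
    by (simp add: pnorm_single weight_add abs_mult algebra_simps)
  finally show ?thesis .
qed

lemma pnorm_one: "pnorm \<phi> 1 = 1"
  by (simp add: weight_zero pnorm_single flip: single_one)

lemma abs_ev_le_pnorm: "\<bar>ev \<phi> p\<bar> \<le> pnorm \<phi> p"
  unfolding ev_def pnorm_def
  by (rule order_trans[OF sum_abs]) (simp add: abs_mult weight_nonneg)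

text \<open>
  If \<open>p i = 1 + e i\<close>, then expanding the product bounds the norm of \<open>(\<Prod>i. 1 + e i) - 1\<close> by
  \<open>(\<Prod>i. 1 + pnorm (e i)) - 1\<close>.
\<close>

lemma pnorm_prod_minus_one:
  assumes "finite A"
  shows "pnorm \<phi> ((\<Prod>i\<in>A. p i) - 1) \<le> exp (\<Sum>i\<in>A. pnorm \<phi> (p i - 1)) - 1"
  using assms
proof (induction A)
  case (insert i A)
  let ?Q = "\<Prod>i\<in>A. p i"
  have "p i * ?Q - 1 = (p i - 1) * (?Q - 1) + (p i - 1) + (?Q - 1)"
    by (simp add: algebra_simps)
  hence "pnorm \<phi> (p i * ?Q - 1) \<le>
      pnorm \<phi> (p i - 1) * pnorm \<phi> (?Q - 1) + pnorm \<phi> (p i - 1) + pnorm \<phi> (?Q - 1)"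
    by (simp only:) (intro order_trans[OF pnorm_triangle] add_right_mono order_trans[OF pnorm_mult] order_refl)
  also have "\<dots> = (1 + pnorm \<phi> (p i - 1)) * (1 + pnorm \<phi> (?Q - 1)) - 1"
    by (simp add: algebra_simps)
  also have "\<dots> \<le> exp (pnorm \<phi> (p i - 1)) * exp (\<Sum>i\<in>A. pnorm \<phi> (p i - 1)) - 1"
    using insert.IH pnorm_nonneg
    by (intro diff_right_mono mult_mono exp_ge_add_one_self) (auto intro: add_nonneg_nonneg)
  finally show ?case using insert.hyps by (simp add: exp_add)
qed auto

end

subsection \<open>Polynomials modulo high monomials\<close>

lemma lookup_single_mult:
  fixes a b :: "'i \<Rightarrow> nat"
  shows "mcoeff (mterm a c * G) b = (if a \<le> b then c * mcoeff G (b - a) else (0::real))"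
proof -
  have "mcoeff (mterm a c * G) b =
      (\<Sum>d\<in>mkeys G. if a + d = b then c * mcoeff G d else 0)"
  proof (cases "c = 0")
    case True
    thus ?thesis by (intro sum.neutral[symmetric] trans[OF _ sum.neutral[symmetric]]) auto
  next
    case False
    thus ?thesis
      by (subst mult_eq_sum_singles) (simp add: lookup_sum lookup_single when_def)
  qed
  also have "\<dots> = (if a \<le> b then c * mcoeff G (b - a) else 0)"
  proof (cases "a \<le> b")
    case True
    have eq: "a + d = b \<longleftrightarrow> d = b - a" for d
      using True by (auto simp: fun_eq_iff le_fun_def plus_fun_def) (metis add_diff_cancel_left' le_add_diff_inverse)+
    show ?thesis using True by (simp add: eq in_keys_iff)
  next
    case False
    hence "a + d \<noteq> b" for d by (auto simp: le_fun_def)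
    thus ?thesis using False by simp
  qed
  finally show ?thesis .
qed

lemma lookup_mult_eq:
  fixes b :: "'i \<Rightarrow> nat"
  shows "mcoeff (p * G) b =
    (\<Sum>a\<in>mkeys p. if a \<le> b then mcoeff p a * mcoeff G (b - a) else (0::real))"
proof -
  have "p * G = (\<Sum>a\<in>mkeys p. mterm a (mcoeff p a) * G)"
    unfolding sum_distrib_right[symmetric] by (simp only: poly_sum_monomials)
  thus ?thesis by (simp add: lookup_sum lookup_single_mult)
qed

text \<open>
  Only the coefficients at exponent vectors \<open>a \<le> D\<close> matter, so power series can be replaced by polynomials
  modulo the ideal spanned by all other monomials.
\<close>

definition cong_upto :: "('i \<Rightarrow> nat) \<Rightarrow> (('i \<Rightarrow> nat) \<Rightarrow>\<^sub>0 real) \<Rightarrow> (('i \<Rightarrow> nat) \<Rightarrow>\<^sub>0 real) \<Rightarrow> bool" where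
  "cong_upto D p r \<longleftrightarrow> (\<forall>a\<le>D. mcoeff p a = mcoeff r a)"

lemma cong_upto_refl [simp]: "cong_upto D p p"
  by (simp add: cong_upto_def)

lemma cong_upto_sym: "cong_upto D p r \<Longrightarrow> cong_upto D r p"
  by (simp add: cong_upto_def)

lemma cong_upto_trans [trans]: "cong_upto D p r \<Longrightarrow> cong_upto D r s \<Longrightarrow> cong_upto D p s"
  by (simp add: cong_upto_def)

lemma cong_upto_mult:
  assumes "cong_upto D p p'" "cong_upto D r r'"
  shows "cong_upto D (p * r) (p' * r')"
proof -
  have right: "cong_upto D (p * r) (p' * r)" if "cong_upto D p p'" for p p' r
    unfolding cong_upto_def
  proof (intro allI impI)
    fix a assume "a \<le> D"
    hence "mcoeff ((p - p') * r) a = 0"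
      unfolding lookup_mult_eq using that
      by (intro sum.neutral) (auto simp: cong_upto_def lookup_minus intro: order_trans)
    thus "mcoeff (p * r) a = mcoeff (p' * r) a" by (simp add: left_diff_distrib lookup_minus)
  qed
  show ?thesis
    using cong_upto_trans[OF right[OF assms(1)] right[OF assms(2), of p', unfolded mult.commute[of _ p']]] .
qed

lemma cong_upto_prod:
  "(\<And>i. i \<in> A \<Longrightarrow> cong_upto D (p i) (r i)) \<Longrightarrow> cong_upto D (\<Prod>i\<in>A. p i) (\<Prod>i\<in>A. r i)"
  by (induction A rule: infinite_finite_induct) (auto intro: cong_upto_mult)

lemma prod_single:
  "(\<Prod>i\<in>A. mterm (a i) (c i)) = mterm (\<Sum>i\<in>A. a i) (\<Prod>i\<in>A. c i :: real)"
  by (induction A rule: infinite_finite_induct) (auto simp: mult_single)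

section \<open>Counting systems with prescribed sums\<close>

text \<open>
  The exponent vector of \<open>x\<^sub>I ^ j\<close>, where \<open>x\<^sub>I\<close> is the product of the \<open>x\<^sub>i\<close> with \<open>i \<in> I\<close>.
\<close>

definition spread :: "'i set \<Rightarrow> nat \<Rightarrow> 'i \<Rightarrow> nat" where
  "spread I j = (\<lambda>i. if i \<in> I then j else 0)"

lemma spread_add: "spread I j + spread I l = spread I (j + l)"
  by (auto simp: spread_def)

lemma spread_zero [simp]: "spread I 0 = 0"
  by (auto simp: spread_def)

lemma sum_fun_apply: "(\<Sum>i\<in>A. f i) x = (\<Sum>i\<in>A. f i x :: nat)"
  by (induction A rule: infinite_finite_induct) auto

text \<open>
  Stated for exponent vectors, the equations say that the sum of the \<open>r I\<close> with \<open>i \<in> I\<close> is \<open>v i\<close>, for every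
  \<open>i\<close>. The caps keep the generating function a polynomial.
\<close>

definition sols :: "'i set set \<Rightarrow> ('i set \<Rightarrow> nat) \<Rightarrow> ('i \<Rightarrow> nat) \<Rightarrow> ('i set \<Rightarrow> nat) set" where
  "sols \<F> cap v = {r \<in> (\<Pi>\<^sub>E I\<in>\<F>. {..cap I}). (\<Sum>I\<in>\<F>. spread I (r I)) = v}"

definition sol_series :: "'i set set \<Rightarrow> ('i set \<Rightarrow> nat) \<Rightarrow> (('i \<Rightarrow> nat) \<Rightarrow>\<^sub>0 real)" where
  "sol_series \<F> cap = (\<Prod>I\<in>\<F>. \<Sum>j\<le>cap I. mterm (spread I j) 1)"

lemma sols_apply:
  "finite \<F> \<Longrightarrow> r \<in> sols \<F> cap v \<Longrightarrow> (\<Sum>I | I \<in> \<F> \<and> i \<in> I. r I) = v i"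
  by (auto simp: sols_def sum_fun_apply spread_def sum.If_cases Int_def)

lemma solsI:
  "r \<in> (\<Pi>\<^sub>E I\<in>\<F>. {..cap I}) \<Longrightarrow> finite \<F> \<Longrightarrow> (\<And>i. (\<Sum>I | I \<in> \<F> \<and> i \<in> I. r I) = v i) \<Longrightarrow> r \<in> sols \<F> cap v"
  by (auto simp: sols_def sum_fun_apply spread_def sum.If_cases Int_def fun_eq_iff)

lemma finite_sols: "finite \<F> \<Longrightarrow> finite (sols \<F> cap v)"
  unfolding sols_def by (rule finite_subset[OF _ finite_PiE[of \<F> "\<lambda>I. {..cap I}"]]) auto

lemma mcoeff_sol_series:
  assumes "finite \<F>"
  shows "mcoeff (sol_series \<F> cap) v = real (card (sols \<F> cap v))"
proof -
  have "sol_series \<F> cap = (\<Sum>r\<in>(\<Pi>\<^sub>E I\<in>\<F>. {..cap I}). mterm (\<Sum>I\<in>\<F>. spread I (r I)) 1)"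
    unfolding sol_series_def using assms by (simp add: prod_sum_PiE prod_single)
  thus ?thesis
    using assms by (simp add: lookup_sum lookup_single when_def sols_def sum.If_cases finite_PiE Int_def)
qed

lemma card_even_subsets:
  assumes "finite S" "S \<noteq> {}"
  shows "card {I. I \<subseteq> S \<and> even (card I)} = 2 ^ (card S - 1)"
    and "card {I. I \<subseteq> S \<and> odd (card I)} = 2 ^ (card S - 1)"
proof -
  obtain s where s: "s \<in> S" using assms by auto
  let ?E = "{I. I \<subseteq> S \<and> even (card I)}" and ?O = "{I. I \<subseteq> S \<and> odd (card I)}"
  define f where "f I = (if s \<in> I then I - {s} else insert s I)" for I
  have inv: "f (f I) = I" for I by (auto simp: f_def)
  have fin: "finite I" if "I \<subseteq> S" for I using that assms finite_subset by blast
  have cd: "even (card (f I)) \<longleftrightarrow> odd (card I)" if "I \<subseteq> S" for I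
  proof (cases "s \<in> I")
    case True
    have "card I = Suc (card (I - {s}))" using True fin[OF that] by (metis card.remove)
    thus ?thesis using True by (simp add: f_def)
  qed (use fin[OF that] in \<open>simp add: f_def\<close>)
  have sub: "f I \<subseteq> S \<longleftrightarrow> I \<subseteq> S" for I using s by (auto simp: f_def)
  have "bij_betw f ?E ?O"
  proof (rule bij_betwI[where g = f])
    show "f \<in> ?E \<rightarrow> ?O" "f \<in> ?O \<rightarrow> ?E" by (simp_all add: cd sub)
  qed (simp_all add: inv)
  hence eq: "card ?E = card ?O" by (rule bij_betw_same_card)
  have "?E \<union> ?O = Pow S" "?E \<inter> ?O = {}" by blast+
  moreover have "finite ?E" "finite ?O" using assms(1) by (auto intro: finite_subset[of _ "Pow S"])
  ultimately have "card ?E + card ?O = 2 ^ card S"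
    using card_Un_disjoint[of ?E ?O] card_Pow[OF assms(1)] by simp
  moreover have "card S = Suc (card S - 1)" using assms by (simp add: card_gt_0_iff)
  hence "(2::nat) ^ card S = 2 * 2 ^ (card S - 1)" by (metis power_Suc)
  ultimately show "card ?E = 2 ^ (card S - 1)" "card ?O = 2 ^ (card S - 1)"
    using eq by linarith+
qed

definition evens :: "'i set \<Rightarrow> 'i set set" where
  "evens J = {I. I \<subseteq> J \<and> I \<noteq> {} \<and> even (card I)}"

definition odds :: "'i set \<Rightarrow> 'i set set" where
  "odds J = {I. I \<subseteq> J \<and> odd (card I)}"

abbreviation index_sets :: "'i set \<Rightarrow> 'i set set" where
  "index_sets J \<equiv> odds J \<union> evens J"

lemma finite_evens [simp]: "finite J \<Longrightarrow> finite (evens J)"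
  and finite_odds [simp]: "finite J \<Longrightarrow> finite (odds J)"
  by (auto simp: evens_def odds_def intro: finite_subset[of _ "Pow J"])

lemma card_odds: "finite J \<Longrightarrow> J \<noteq> {} \<Longrightarrow> card (odds J) = 2 ^ (card J - 1)"
  unfolding odds_def by (rule card_even_subsets)

lemma card_evens: assumes "finite J" "J \<noteq> {}" shows "card (evens J) = 2 ^ (card J - 1) - 1"
proof -
  have "evens J = {I. I \<subseteq> J \<and> even (card I)} - {{}}" by (auto simp: evens_def)
  thus ?thesis using card_even_subsets(1)[OF assms] by simp
qed

lemma odds_evens_disjoint: "odds J \<inter> evens J = {}"
  by (auto simp: odds_def evens_def)

subsection \<open>Upper bound\<close>

text \<open>
  The pairs \<open>{a, x}\<close> form a star, and \<open>{b, c}\<close> closes a triangle. A connected graph with as many edges as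
  vertices and an odd cycle has an invertible incidence matrix, so the \<open>card J\<close> unknowns at these pairs
  are determined by all others.
\<close>

definition pivots :: "'i \<Rightarrow> 'i \<Rightarrow> 'i \<Rightarrow> 'i set \<Rightarrow> 'i set set" where
  "pivots a b c J = insert {b, c} ((\<lambda>x. {a, x}) ` (J - {a}))"

lemma card_pivots:
  assumes "finite J" "a \<in> J" "b \<noteq> a" "c \<noteq> a" 
  shows "card (pivots a b c J) = card J"
proof -
  have "inj_on (\<lambda>x. {a, x}) (J - {a})" by (auto simp: inj_on_def doubleton_eq_iff)
  moreover have "{b, c} \<notin> (\<lambda>x. {a, x}) ` (J - {a})"
  proof
    assume "{b, c} \<in> (\<lambda>x. {a, x}) ` (J - {a})"
    then obtain x where "{b, c} = {a, x}" by blast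
    thus False using assms(3,4) by (simp add: doubleton_eq_iff)
  qed
  moreover have "card J > 0" using assms by (auto simp: card_gt_0_iff)
  ultimately show ?thesis using assms by (simp add: pivots_def card_image)
qed

text \<open>
  The leaves of the star give \<open>d {a, x} = 0\<close> for \<open>x\<close> outside the triangle; the three equations left at
  \<open>a\<close>, \<open>b\<close>, \<open>c\<close> say that the pairwise sums of the three values on the triangle vanish.
\<close>

lemma pivots_determined:
  fixes d :: "'i set \<Rightarrow> int"
  assumes J: "finite J" "a \<in> J" "b \<in> J" "c \<in> J" "a \<noteq> b" "a \<noteq> c" "b \<noteq> c"
    and z: "\<And>i. i \<in> J \<Longrightarrow> (\<Sum>I | I \<in> pivots a b c J \<and> i \<in> I. d I) = 0"
    and P: "P \<in> pivots a b c J"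
  shows "d P = 0"
proof -
  have star: "d {a, x} = 0" if "x \<in> J - {a, b, c}" for x
  proof -
    have "{I. I \<in> pivots a b c J \<and> x \<in> I} = {{a, x}}" using that J by (auto simp: pivots_def)
    thus ?thesis using z[of x] that by simp
  qed
  have "{I. I \<in> pivots a b c J \<and> b \<in> I} = {{a, b}, {b, c}}" using J by (auto simp: pivots_def)
  hence b: "d {a, b} + d {b, c} = 0" using z[of b] J by (simp add: doubleton_eq_iff)
  have "{I. I \<in> pivots a b c J \<and> c \<in> I} = {{a, c}, {b, c}}" using J by (auto simp: pivots_def)
  hence c: "d {a, c} + d {b, c} = 0" using z[of c] J by (simp add: doubleton_eq_iff)
  have "{I. I \<in> pivots a b c J \<and> a \<in> I} = (\<lambda>x. {a, x}) ` (J - {a})" using J by (auto simp: pivots_def)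
  moreover have "inj_on (\<lambda>x. {a, x}) (J - {a})" by (auto simp: inj_on_def doubleton_eq_iff)
  ultimately have "(\<Sum>x\<in>J - {a}. d {a, x}) = 0" using z[of a] J by (simp add: sum.reindex)
  moreover have "(\<Sum>x\<in>J - {a}. d {a, x}) = (\<Sum>x\<in>{b, c}. d {a, x})"
    using J star by (intro sum.mono_neutral_right) auto
  ultimately have a: "d {a, b} + d {a, c} = 0" using J by simp
  have "d {a, b} = 0" "d {a, c} = 0" "d {b, c} = 0" using a b c by linarith+
  thus ?thesis using P star by (auto simp: pivots_def)
qed

text \<open>
  If the homogeneous equations have no nonzero solution on \<open>\<P>\<close>, then a solution is determined by its
  values outside \<open>\<P>\<close>, and every value is at most \<open>M\<close>.
\<close>

lemma card_sols_le:
  assumes J: "finite J" and F: "\<F> \<subseteq> Pow J - {{}}" "\<P> \<subseteq> \<F>"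
    and determined: "\<And>d I. (\<And>i. i \<in> J \<Longrightarrow> (\<Sum>I | I \<in> \<P> \<and> i \<in> I. d I) = (0::int)) \<Longrightarrow> I \<in> \<P> \<Longrightarrow> d I = 0"
    and v: "\<And>i. i \<in> J \<Longrightarrow> v i \<le> M"
  shows "card (sols \<F> cap v) \<le> (\<Prod>I\<in>\<F> - \<P>. min (cap I) M + 1)"
proof -
  have finF: "finite \<F>" using F(1) J by (auto intro: finite_subset[of _ "Pow J"])
  define B where "B = (\<Pi>\<^sub>E I\<in>\<F> - \<P>. {..min (cap I) M})"
  have finB: "finite B" unfolding B_def using finF by (intro finite_PiE) auto
  have le: "r I \<le> M" if r: "r \<in> sols \<F> cap v" and I: "I \<in> \<F>" for r I
  proof -
    obtain i where i: "i \<in> I" "i \<in> J" using I F(1) by blast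
    have "r I \<le> (\<Sum>I | I \<in> \<F> \<and> i \<in> I. r I)" using I i finF by (intro member_le_sum) auto
    thus ?thesis using sols_apply[OF finF r] v[OF i(2)] by simp
  qed
  have "inj_on (\<lambda>r. restrict r (\<F> - \<P>)) (sols \<F> cap v)"
  proof (rule inj_onI)
    fix r s assume r: "r \<in> sols \<F> cap v" and s: "s \<in> sols \<F> cap v"
      and eq: "restrict r (\<F> - \<P>) = restrict s (\<F> - \<P>)"
    define d where "d I = int (r I) - int (s I)" for I
    have out: "d I = 0" if "I \<in> \<F> - \<P>" for I using fun_cong[OF eq, of I] that by (simp add: d_def)
    have "(\<Sum>I | I \<in> \<P> \<and> i \<in> I. d I) = 0" for i
    proof -
      have "(\<Sum>I | I \<in> \<P> \<and> i \<in> I. d I) = (\<Sum>I | I \<in> \<F> \<and> i \<in> I. d I)"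
        using F(2) finF out by (intro sum.mono_neutral_left) auto
      also have "\<dots> = int (\<Sum>I | I \<in> \<F> \<and> i \<in> I. r I) - int (\<Sum>I | I \<in> \<F> \<and> i \<in> I. s I)"
        by (simp add: d_def sum_subtractf)
      finally show ?thesis using sols_apply[OF finF r] sols_apply[OF finF s] by simp
    qed
    note piv = determined[OF this]
    have agree: "r I = s I" if "I \<in> \<F>" for I
      using piv[of I] out[of I] that by (cases "I \<in> \<P>") (auto simp: d_def)
    have "r \<in> extensional \<F>" "s \<in> extensional \<F>" using r s by (simp_all add: sols_def PiE_def)
    from extensionalityI[OF this agree] show "r = s" .
  qed
  moreover have "(\<lambda>r. restrict r (\<F> - \<P>)) ` sols \<F> cap v \<subseteq> B"
  proof (intro image_subsetI)
    fix r assume r: "r \<in> sols \<F> cap v"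
    hence "r I \<le> cap I" if "I \<in> \<F>" for I using that by (auto simp: sols_def)
    thus "restrict r (\<F> - \<P>) \<in> B" using le[OF r] by (simp add: B_def)
  qed
  ultimately have "card (sols \<F> cap v) \<le> card B" using finB card_inj_on_le by blast
  also have "card B = (\<Prod>I\<in>\<F> - \<P>. min (cap I) M + 1)"
    unfolding B_def using finF by (subst card_PiE) auto
  finally show ?thesis .
qed

text \<open>
  The condition \<open>r\<^sub>I \<in> {0, 1}\<close> for odd sets; on even sets \<open>L\<close> is meant to be so large that it is no
  restriction.
\<close>

definition odd_cap :: "nat \<Rightarrow> 'i set \<Rightarrow> nat" where
  "odd_cap L I = (if odd (card I) then 1 else L)"

lemma card_sols_le_power:
  assumes J: "finite J" "a \<in> J" "b \<in> J" "c \<in> J" "a \<noteq> b" "a \<noteq> c" "b \<noteq> c"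
    and O: "\<O> \<subseteq> odds J" and E: "\<E> \<subseteq> evens J" "pivots a b c J \<subseteq> \<E>" and v: "\<And>i. i \<in> J \<Longrightarrow> v i \<le> M"
  shows "real (card (sols (\<O> \<union> \<E>) (odd_cap L) v)) \<le> 2 ^ card (odds J) * real (M + 1) ^ (card \<E> - card J)"
proof -
  let ?P = "pivots a b c J"
  have fin: "finite \<O>" "finite \<E>" using finite_subset[OF O] finite_subset[OF E(1)] J by auto
  have disj: "\<O> \<inter> \<E> = {}" "\<O> \<inter> ?P = {}" using odds_evens_disjoint[of J] O E by auto
  have "card (sols (\<O> \<union> \<E>) (odd_cap L) v) \<le> (\<Prod>I\<in>(\<O> \<union> \<E>) - ?P. min (odd_cap L I) M + 1)"
  proof (rule card_sols_le[where J = J and v = v and M = M])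
    show "d I = 0" if "\<And>i. i \<in> J \<Longrightarrow> (\<Sum>I | I \<in> ?P \<and> i \<in> I. d I) = (0::int)" "I \<in> ?P" for d I
      by (rule pivots_determined[OF J that])
    show "\<O> \<union> \<E> \<subseteq> Pow J - {{}}" using O E by (auto simp: odds_def evens_def)
  qed (use J(1) E(2) v in auto)
  also have "(\<O> \<union> \<E>) - ?P = \<O> \<union> (\<E> - ?P)" using disj(2) by auto
  also have "(\<Prod>I\<in>\<O> \<union> (\<E> - ?P). min (odd_cap L I) M + 1) =
      (\<Prod>I\<in>\<O>. min (odd_cap L I) M + 1) * (\<Prod>I\<in>\<E> - ?P. min (odd_cap L I) M + 1)"
    using fin disj by (intro prod.union_disjoint) auto
  also have "\<dots> \<le> (\<Prod>I\<in>\<O>. 2) * (\<Prod>I\<in>\<E> - ?P. M + 1)"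
    using O by (intro mult_mono prod_mono) (auto simp: odd_cap_def odds_def)
  also have "\<dots> \<le> 2 ^ card (odds J) * (M + 1) ^ (card \<E> - card J)"
  proof -
    have "card (\<E> - ?P) = card \<E> - card J"
      using card_pivots[OF J(1,2)] J E fin finite_subset[OF E(2)] by (subst card_Diff_subset) auto
    moreover have "card \<O> \<le> card (odds J)" using O J by (intro card_mono) auto
    ultimately show ?thesis by simp
  qed
  finally have "real (card (sols (\<O> \<union> \<E>) (odd_cap L) v)) \<le> real (2 ^ card (odds J) * (M + 1) ^ (card \<E> - card J))"
    by (rule of_nat_mono)
  thus ?thesis by simp
qed

subsection \<open>Lower bound\<close>

text \<open>
  Let \<open>B\<close> be the number of even sets and \<open>t = m div B\<close>. The \<open>(t + 1) ^ B\<close> systems on even sets with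
  values at most \<open>t\<close> have at most \<open>(m + 1) ^ card J\<close> different vectors of sums. Systems with the same
  vector \<open>w\<close> are moved to the constant vector \<open>m\<close> by one common translation: take a fixed system
  \<open>r0\<close> with vector \<open>w\<close>. As \<open>card J\<close> is even, the complement of an even set is even, so \<open>I \<mapsto> r0 (J - I)\<close>
  is a system on even sets, with sums \<open>(\<Sum>I. r0 I) - w i\<close>. Adding it produces the constant vector
  \<open>\<Sum>I. r0 I \<le> m\<close>, and the value at \<open>J\<close> itself absorbs the rest.
\<close>

lemma card_sols_ge:
  assumes J: "finite J" "J \<noteq> {}" "even (card J)" and L: "L \<ge> m"
  shows "(m + 1) ^ card (evens J) \<le> card (evens J) ^ card (evens J) * ((m + 1) ^ card J *
           card (sols (index_sets J) (odd_cap L) (spread J m)))"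
proof -
  define B where "B = card (evens J)"
  have JE: "J \<in> evens J" using J by (simp add: evens_def)
  have finE: "finite (evens J)" and finO: "finite (odds J)" using J by auto
  have B: "B > 0" using JE finE by (auto simp: B_def card_gt_0_iff)
  define t where "t = m div B"
  have t: "B * t \<le> m" "m + 1 \<le> B * (t + 1)"
    using B by (simp_all add: t_def) (metis Suc_leI dividend_less_times_div add_mult_distrib2 mult.right_neutral mult_Suc_right)
  define small where "small = (\<Pi>\<^sub>E I\<in>evens J. {..t})"
  define f where "f r = (\<lambda>i\<in>J. \<Sum>I | I \<in> evens J \<and> i \<in> I. r I)" for r :: "'a set \<Rightarrow> nat"
  have total: "(\<Sum>I\<in>evens J. r I) \<le> m" if "r \<in> small" for r
  proof -
    have "(\<Sum>I\<in>evens J. r I) \<le> (\<Sum>I\<in>evens J. t)"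
      using that by (intro sum_mono) (auto simp: small_def)
    thus ?thesis using t(1) by (simp add: B_def)
  qed
  have image: "f r \<in> (\<Pi>\<^sub>E i\<in>J. {..m})" if "r \<in> small" for r
  proof -
    have "(\<Sum>I | I \<in> evens J \<and> i \<in> I. r I) \<le> (\<Sum>I\<in>evens J. r I)" for i
      using finE by (intro sum_mono2) auto
    thus ?thesis using total[OF that] order_trans by (auto simp: f_def)
  qed
  have fiber: "card {r \<in> small. f r = w} \<le> card (sols (index_sets J) (odd_cap L) (spread J m))" for w
  proof (cases "{r \<in> small. f r = w} = {}")
    case False
    then obtain r0 where r0: "r0 \<in> small" "f r0 = w" by auto
    define c where "c I = (if I = J then m - (\<Sum>I\<in>evens J. r0 I) else r0 (J - I))" for I
    define g where "g r = (\<lambda>I\<in>index_sets J. if I \<in> odds J then 0 else r I + c I)"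
      for r :: "'a set \<Rightarrow> nat"
    have sum_g: "(\<Sum>I | I \<in> index_sets J \<and> i \<in> I. g r I) = spread J m i" if r: "r \<in> small" "f r = w" for r i
    proof (cases "i \<in> J")
      case False
      hence none: "{I. I \<in> index_sets J \<and> i \<in> I} = {}" by (auto simp: odds_def evens_def)
      show ?thesis unfolding none using False by (simp add: spread_def)
    next
      case True
      have "(\<Sum>I | I \<in> index_sets J \<and> i \<in> I. g r I) = (\<Sum>I | I \<in> evens J \<and> i \<in> I. g r I)"
        using finE finO by (intro sum.mono_neutral_right) (auto simp: g_def)
      also have "\<dots> = (\<Sum>I | I \<in> evens J \<and> i \<in> I. r I + c I)"
        using odds_evens_disjoint[of J] by (intro sum.cong) (auto simp: g_def)
      also have "\<dots> = w i + (\<Sum>I | I \<in> evens J \<and> i \<in> I. c I)"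
        using r(2) True by (auto simp: sum.distrib f_def)
      also have "{I. I \<in> evens J \<and> i \<in> I} = insert J {I. I \<in> evens J \<and> i \<in> I \<and> I \<noteq> J}"
        using JE True by auto
      also have "(\<Sum>I\<in>\<dots>. c I) = c J + (\<Sum>I | I \<in> evens J \<and> i \<in> I \<and> I \<noteq> J. c I)"
        using finE by (subst sum.insert) auto
      also have "(\<Sum>I | I \<in> evens J \<and> i \<in> I \<and> I \<noteq> J. c I) = (\<Sum>I | I \<in> evens J \<and> i \<notin> I. r0 I)"
      proof (rule sum.reindex_bij_witness[of _ "\<lambda>I. J - I" "\<lambda>I. J - I"])
        fix I assume I: "I \<in> {I. I \<in> evens J \<and> i \<in> I \<and> I \<noteq> J}"
        hence IJ: "I \<subseteq> J" "even (card I)" "finite I" using J by (auto simp: evens_def finite_subset)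
        hence "even (card (J - I))" using J by (simp add: card_Diff_subset card_mono)
        thus "J - I \<in> {I. I \<in> evens J \<and> i \<notin> I}" using I by (auto simp: evens_def)
        show "J - (J - I) = I" using IJ by blast
        show "r0 (J - I) = c I" using I by (simp add: c_def)
      next
        fix I assume I: "I \<in> {I. I \<in> evens J \<and> i \<notin> I}"
        hence IJ: "I \<subseteq> J" "even (card I)" "finite I" using J by (auto simp: evens_def finite_subset)
        hence "even (card (J - I))" using J by (simp add: card_Diff_subset card_mono)
        thus "J - I \<in> {I. I \<in> evens J \<and> i \<in> I \<and> I \<noteq> J}" using I True by (auto simp: evens_def)
        show "J - (J - I) = I" using IJ by blast
      qed
      also have "w i = (\<Sum>I | I \<in> evens J \<and> i \<in> I. r0 I)"
        using r0(2) True by (auto simp: f_def)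
      also have "(\<Sum>I | I \<in> evens J \<and> i \<in> I. r0 I) + (c J + (\<Sum>I | I \<in> evens J \<and> i \<notin> I. r0 I)) =
          c J + (\<Sum>I\<in>evens J. r0 I)"
        using sum.If_cases[OF finE, of "\<lambda>I. i \<in> I" r0 r0] by (simp add: Int_def)
      finally show ?thesis using total[OF r0(1)] True by (simp add: c_def spread_def)
    qed
    have "g r \<in> sols (index_sets J) (odd_cap L) (spread J m)" if r: "r \<in> small" "f r = w" for r
    proof (rule solsI)
      show "(\<Sum>I | I \<in> index_sets J \<and> i \<in> I. g r I) = spread J m i" for i by (rule sum_g[OF r])
      show "finite (index_sets J)" using finE finO by simp
      show "g r \<in> (\<Pi>\<^sub>E I\<in>index_sets J. {..odd_cap L I})"
      proof (rule PiE_I)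
        fix I assume I: "I \<in> index_sets J"
        show "g r I \<in> {..odd_cap L I}"
        proof (cases "I \<in> odds J")
          case False
          then obtain i where i: "i \<in> I" "i \<in> J" and even: "even (card I)" using I by (auto simp: evens_def)
          have "g r I \<le> (\<Sum>I | I \<in> index_sets J \<and> i \<in> I. g r I)"
            using I i finE finO by (intro member_le_sum) auto
          hence "g r I \<le> m" using i sum_g[OF r, of i] by (simp add: spread_def)
          thus ?thesis using even L by (simp add: odd_cap_def)
        qed (simp add: g_def)
      qed (auto simp: g_def)
    qed
    moreover have "inj_on g {r \<in> small. f r = w}"
    proof (rule inj_onI)
      fix r s assume rs: "r \<in> {r \<in> small. f r = w}" "s \<in> {r \<in> small. f r = w}" "g r = g s"
      have agree: "r I = s I" if "I \<in> evens J" for I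
        using fun_cong[OF rs(3), of I] that odds_evens_disjoint[of J] by (auto simp: g_def split: if_splits)
      have "r \<in> extensional (evens J)" "s \<in> extensional (evens J)" using rs by (simp_all add: small_def PiE_def)
      from extensionalityI[OF this agree] show "r = s" .
    qed
    ultimately show ?thesis
      using finite_sols[of "index_sets J"] finE finO by (intro card_inj_on_le[of g]) auto
  qed (metis card.empty le0)
  let ?Y = "\<Pi>\<^sub>E i\<in>J. {..m}"
  have "(t + 1) ^ B = card small" using finE by (simp add: small_def card_PiE B_def)
  also have "small = (\<Union>w\<in>?Y. {r \<in> small. f r = w})" using image by auto
  also have "card \<dots> \<le> (\<Sum>w\<in>?Y. card {r \<in> small. f r = w})"
    using J by (intro card_UN_le finite_PiE) auto
  also have "\<dots> \<le> (\<Sum>w\<in>?Y. card (sols (index_sets J) (odd_cap L) (spread J m)))"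
    by (intro sum_mono fiber)
  also have "\<dots> = (m + 1) ^ card J * card (sols (index_sets J) (odd_cap L) (spread J m))"
    using J by (simp add: card_PiE)
  finally have "B ^ B * (t + 1) ^ B \<le>
      B ^ B * ((m + 1) ^ card J * card (sols (index_sets J) (odd_cap L) (spread J m)))" by simp
  moreover have "(m + 1) ^ B \<le> B ^ B * (t + 1) ^ B"
    using power_mono[OF t(2), of B] by (simp only: power_mult_distrib)
  ultimately show ?thesis unfolding B_def by linarith
qed

text \<open>
  With two indices the only even set is \<open>J\<close>, and its value is determined by those on the odd sets.
\<close>

lemma card_sols_le_two:
  assumes J: "card J = 2" and v: "\<And>i. i \<in> J \<Longrightarrow> v i \<le> M"
  shows "card (sols (index_sets J) (odd_cap L) v) \<le> 4"
proof -
  have fin: "finite J" and ne: "J \<noteq> {}" using J card.infinite by fastforce+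
  have "J \<in> evens J" using J ne by (simp add: evens_def)
  moreover have "card (evens J) = 1" using card_evens[OF fin ne] J by simp
  ultimately have evens: "evens J = {J}" by (metis card_1_singletonE singletonD)
  have "J \<notin> odds J" using J by (simp add: odds_def)
  hence rest: "index_sets J - {J} = odds J" by (auto simp: evens)
  have "card (sols (index_sets J) (odd_cap L) v) \<le> (\<Prod>I\<in>index_sets J - {J}. min (odd_cap L I) M + 1)"
  proof (rule card_sols_le[OF fin _ _ _ v])
    show "index_sets J \<subseteq> Pow J - {{}}" by (auto simp: odds_def evens_def)
    show "d I = 0" if d: "\<And>i. i \<in> J \<Longrightarrow> (\<Sum>I | I \<in> {J} \<and> i \<in> I. d I) = (0::int)" and I: "I \<in> {J}" for d I
    proof -
      obtain i where i: "i \<in> J" using ne by blast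
      have "{I. I \<in> {J} \<and> i \<in> I} = {J}" using i by blast
      thus ?thesis using d[OF i] I by simp
    qed
  qed (simp add: evens)
  also have "\<dots> \<le> (\<Prod>I\<in>odds J. 2)"
    unfolding rest by (intro prod_mono) (auto simp: odd_cap_def odds_def)
  finally show ?thesis using card_odds[OF fin ne] J by simp
qed

subsection \<open>Slow variation\<close>

lemma sol_series_insert:
  "finite \<F> \<Longrightarrow> I \<notin> \<F> \<Longrightarrow>
     sol_series (insert I \<F>) cap = (\<Sum>j\<le>cap I. mterm (spread I j) 1) * sol_series \<F> cap"
  by (simp add: sol_series_def)

lemma geometric_spread:
  "(1 - mterm (spread I 1) 1) * (\<Sum>j\<le>L. mterm (spread I j) 1) = 1 - mterm (spread I (Suc L)) (1::real)"
proof (induction L)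
  case (Suc L)
  have "mterm (spread I 1) 1 * mterm (spread I (Suc L)) 1 = mterm (spread I (Suc (Suc L))) (1::real)"
    by (simp add: mult_single spread_add)
  thus ?case using Suc by (simp add: distrib_left left_diff_distrib)
qed (simp flip: zero_fun_def)

text \<open>
  Multiplication by \<open>1 - x\<^sub>I\<close> cancels the geometric series of \<open>I\<close> up to a monomial of high degree, which
  means that the unknown \<open>r\<^sub>I\<close> disappears from the system.
\<close>

lemma mcoeff_remove_factor:
  assumes "finite \<F>" "I \<in> \<F>" "i \<in> I" "u i \<le> cap I"
  shows "mcoeff ((1 - mterm (spread I 1) 1) * sol_series \<F> cap) u =
    real (card (sols (\<F> - {I}) cap u))"
proof -
  have "sol_series \<F> cap = (\<Sum>j\<le>cap I. mterm (spread I j) 1) * sol_series (\<F> - {I}) cap"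
    using sol_series_insert[of "\<F> - {I}" I cap] assms by (simp add: insert_absorb)
  hence "(1 - mterm (spread I 1) 1) * sol_series \<F> cap =
      (1 - mterm (spread I (Suc (cap I))) 1) * sol_series (\<F> - {I}) cap"
    using geometric_spread[of I "cap I"] by (simp add: mult.assoc[symmetric])
  also have "mcoeff \<dots> u = mcoeff (sol_series (\<F> - {I}) cap) u"
  proof -
    have "\<not> spread I (Suc (cap I)) \<le> u"
    proof
      assume "spread I (Suc (cap I)) \<le> u"
      hence "spread I (Suc (cap I)) i \<le> u i" by (rule le_funD)
      thus False using assms by (simp add: spread_def)
    qed
    thus ?thesis by (simp add: left_diff_distrib lookup_minus lookup_single_mult)
  qed
  finally show ?thesis using assms by (simp add: mcoeff_sol_series)
qed

lemma two_elements:
  assumes "card S \<ge> 2"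
  obtains a c where "a \<in> S" "c \<in> S" "a \<noteq> c"
proof -
  obtain T where "T \<subseteq> S" "card T = 2" using assms obtain_subset_with_card_n by metis
  thus thesis using that by (auto simp: card_2_iff)
qed

text \<open>
  A star centred outside \<open>{x, y}\<close>, closed by a pair different from \<open>{x, y}\<close>, still determines \<open>card J\<close>
  unknowns. Hence omitting one pair costs one power of \<open>M\<close>.
\<close>

lemma card_sols_without_pair:
  assumes J: "finite J" "card J \<ge> 4" and I: "x \<in> J" "y \<in> J" "x \<noteq> y"
    and O: "\<O> \<subseteq> odds J" and v: "\<And>i. i \<in> J \<Longrightarrow> v i \<le> M"
  shows "real (card (sols (\<O> \<union> (evens J - {{x, y}})) (odd_cap L) v)) \<le>
    2 ^ card (odds J) * real (M + 1) ^ (card (evens J) - 1 - card J)"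
proof -
  have "card (J - {x, y}) \<ge> 2" using J I by (simp add: card_Diff_subset)
  then obtain a c where ac: "a \<in> J - {x, y}" "c \<in> J - {x, y}" "a \<noteq> c"
    by (rule two_elements)
  have "pivots a x c J \<subseteq> evens J - {{x, y}}"
    using ac I by (auto simp: pivots_def evens_def doubleton_eq_iff)
  moreover have "{x, y} \<in> evens J" using I by (simp add: evens_def)
  ultimately show ?thesis
    using card_sols_le_power[of J a x c \<O> "evens J - {{x, y}}" v M L] J I O v ac by auto
qed

text \<open>
  The difference is the coefficient of \<open>x ^ v\<close> in \<open>(1 - x\<^sub>i) * G\<close>. The factor \<open>1 + x\<^sub>i\<close> of \<open>G\<close> turns
  \<open>1 - x\<^sub>i\<close> into \<open>1 - x\<^sub>i\<^sup>2\<close>, which is essential: the unknowns at odd sets balance the parity condition that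
  the even sets impose. For further indices \<open>j\<close> and \<open>l\<close>,
  \<open>x\<^sub>j x\<^sub>l (1 - x\<^sub>i\<^sup>2) = (1 - x\<^sub>i x\<^sub>j) + x\<^sub>i x\<^sub>j (1 - x\<^sub>i x\<^sub>l) - (1 - x\<^sub>j x\<^sub>l)\<close>, and each bracket removes the
  unknown of a pair, so that \<open>card_sols_without_pair\<close> applies.
\<close>

lemma card_sols_diff_step:
  assumes J: "finite J" "card J \<ge> 4" and i: "i \<in> J" and v: "v \<le> spread J M" "v i \<ge> 1" and L: "L \<ge> M + 1"
  shows "\<bar>real (card (sols (index_sets J) (odd_cap L) v)) -
      real (card (sols (index_sets J) (odd_cap L) (v - spread {i} 1)))\<bar>
    \<le> 2 * (2 ^ card (odds J) * real (M + 2) ^ (card (evens J) - 1 - card J))"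
proof -
  have "card (J - {i}) \<ge> 2" using J i by simp
  then obtain j l where "j \<in> J - {i}" "l \<in> J - {i}" and jl': "j \<noteq> l" by (rule two_elements)
  hence jl: "j \<in> J" "l \<in> J" "j \<noteq> i" "l \<noteq> i" "j \<noteq> l" by auto
  let ?F = "index_sets J" and ?O = "odds J - {{i}}"
  define mon where "mon I n = mterm (spread I n) 1" for I :: "'a set" and n
  define G where "G = sol_series ?F (odd_cap L)"
  define G0 where "G0 = sol_series (?O \<union> evens J) (odd_cap L)"
  define K where "K = 2 ^ card (odds J) * real (M + 2) ^ (card (evens J) - 1 - card J)"
  have fin: "finite ?F" "finite (?O \<union> evens J)" using J by auto
  have "?F = insert {i} (?O \<union> evens J)" "{i} \<notin> ?O \<union> evens J"
    using i by (auto simp: odds_def evens_def)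
  hence "G = (\<Sum>j\<le>odd_cap L {i}. mon {i} j) * G0"
    unfolding G_def G0_def mon_def using sol_series_insert[OF fin(2)] by metis
  also have "(\<Sum>j\<le>odd_cap L {i}. mon {i} j) = 1 + mon {i} 1" by (simp add: odd_cap_def mon_def)
  finally have G: "G = (1 + mon {i} 1) * G0" .
  have "mon {i} 1 * mon {i} 1 = mon {i} 2" by (simp add: mon_def mult_single spread_add numeral_2_eq_2)
  hence "(1 - mon {i} 1) * G = (1 - mon {i} 2) * G0"
    unfolding G mult.assoc[symmetric] by (simp add: algebra_simps)
  moreover have "mcoeff ((1 - mon {i} 1) * G) v = mcoeff G v - mcoeff G (v - spread {i} 1)"
    using v(2) by (simp add: left_diff_distrib lookup_minus mon_def lookup_single_mult le_fun_def spread_def)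
  ultimately have diff: "mcoeff G v - mcoeff G (v - spread {i} 1) = mcoeff ((1 - mon {i} 2) * G0) v"
    by simp
  \<comment> \<open>Multiplication by \<open>x\<^sub>j x\<^sub>l\<close> shifts the exponent at which the coefficient is read.\<close>
  define v' where "v' = v + spread {j, l} 1"
  have v'i: "v' i \<le> odd_cap L {i, j}" "v' i \<le> odd_cap L {i, l}" "v' j \<le> odd_cap L {j, l}"
    and v'J: "\<And>x. x \<in> J \<Longrightarrow> v' x \<le> M + 1"
  proof -
    have vM: "v x \<le> M" if "x \<in> J" for x using le_funD[OF v(1), of x] that by (simp add: spread_def)
    show "v' i \<le> odd_cap L {i, j}" "v' i \<le> odd_cap L {i, l}" "v' j \<le> odd_cap L {j, l}"
      using vM[OF i] vM[OF jl(1)] L i jl by (simp_all add: v'_def spread_def odd_cap_def)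
    show "v' x \<le> M + 1" if "x \<in> J" for x
      using vM[OF that] by (simp add: v'_def spread_def)
  qed
  have v'': "(v' - spread {i, j} 1) x \<le> M + 1" if "x \<in> J" for x
    using v'J[OF that] by simp
  have "mcoeff ((1 - mon {i} 2) * G0) v = mcoeff (mon {j, l} 1 * ((1 - mon {i} 2) * G0)) v'"
  proof -
    have "spread {j, l} 1 \<le> v'" "v' - spread {j, l} 1 = v" by (auto simp: v'_def le_fun_def fun_eq_iff)
    thus ?thesis by (simp add: mon_def lookup_single_mult)
  qed
  also have "mon {j, l} 1 * ((1 - mon {i} 2) * G0) =
      (1 - mon {i, j} 1) * G0 + mon {i, j} 1 * ((1 - mon {i, l} 1) * G0) - (1 - mon {j, l} 1) * G0"
  proof -
    have "spread {j, l} 1 + spread {i} 2 = spread {i, j} 1 + spread {i, l} 1"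
      using jl by (auto simp: spread_def fun_eq_iff)
    hence "mon {j, l} 1 * mon {i} 2 = mon {i, j} 1 * mon {i, l} 1" by (simp add: mon_def mult_single)
    thus ?thesis by (simp add: algebra_simps)
  qed
  finally have "mcoeff ((1 - mon {i} 2) * G0) v = mcoeff ((1 - mon {i, j} 1) * G0) v' +
      mcoeff (mon {i, j} 1 * ((1 - mon {i, l} 1) * G0)) v' - mcoeff ((1 - mon {j, l} 1) * G0) v'"
    by (simp add: lookup_add lookup_minus)
  moreover have pair: "mcoeff ((1 - mon {x, y} 1) * G0) u \<in> {0..K}"
    if "x \<in> J" "y \<in> J" "x \<noteq> y" "u x \<le> odd_cap L {x, y}" "\<And>i. i \<in> J \<Longrightarrow> u i \<le> M + 1" for x y u
  proof -
    have xy: "{x, y} \<in> ?O \<union> evens J" "{x, y} \<notin> ?O" using that by (auto simp: evens_def odds_def)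
    have "mcoeff ((1 - mon {x, y} 1) * G0) u = real (card (sols (?O \<union> evens J - {{x, y}}) (odd_cap L) u))"
      unfolding G0_def mon_def by (rule mcoeff_remove_factor[OF fin(2) xy(1), of x]) (use that in auto)
    also have "?O \<union> evens J - {{x, y}} = ?O \<union> (evens J - {{x, y}})"
      by (simp only: Un_Diff Diff_insert0[OF xy(2)] Diff_empty)
    finally have eq: "mcoeff ((1 - mon {x, y} 1) * G0) u = real (card (sols (?O \<union> (evens J - {{x, y}})) (odd_cap L) u))" .
    have "real (card (sols (?O \<union> (evens J - {{x, y}})) (odd_cap L) u)) \<le>
        2 ^ card (odds J) * real (M + 1 + 1) ^ (card (evens J) - 1 - card J)"
      by (rule card_sols_without_pair[OF J that(1-3) Diff_subset that(5)])
    also have "\<dots> = K" by (simp add: K_def)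
    finally show ?thesis unfolding eq by simp
  qed
  moreover have "mcoeff (mon {i, j} 1 * ((1 - mon {i, l} 1) * G0)) v' \<in> {0..K}"
  proof (cases "spread {i, j} 1 \<le> v'")
    case True
    have "(v' - spread {i, j} 1) i \<le> odd_cap L {i, l}" using v'i(2) by simp
    hence "mcoeff ((1 - mon {i, l} 1) * G0) (v' - spread {i, j} 1) \<in> {0..K}"
      using i jl v'' by (intro pair) auto
    thus ?thesis using True by (simp add: mon_def lookup_single_mult)
  next
    case False
    hence "mcoeff (mon {i, j} 1 * ((1 - mon {i, l} 1) * G0)) v' = 0"
      by (simp add: mon_def lookup_single_mult)
    moreover have "K \<ge> 0" by (simp add: K_def)
    ultimately show ?thesis by simp
  qed
  moreover have "mcoeff ((1 - mon {i, j} 1) * G0) v' \<in> {0..K}" using i jl v'i v'J by (intro pair) auto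
  moreover have "mcoeff ((1 - mon {j, l} 1) * G0) v' \<in> {0..K}" using jl v'i v'J by (intro pair) auto
  ultimately have "\<bar>mcoeff G v - mcoeff G (v - spread {i} 1)\<bar> \<le> 2 * K"
    unfolding diff by (auto simp only: atLeastAtMost_iff abs_le_iff)
  thus ?thesis by (simp only: G_def mcoeff_sol_series[OF fin(1)] K_def)
qed

lemma card_sols_diff:
  assumes J: "finite J" "card J \<ge> 4" and b: "b \<le> spread J m" and L: "L \<ge> m + 1"
  shows "\<bar>real (card (sols (index_sets J) (odd_cap L) (spread J m))) -
      real (card (sols (index_sets J) (odd_cap L) (spread J m - b)))\<bar>
    \<le> real (\<Sum>i\<in>J. b i) * (2 * (2 ^ card (odds J) * real (m + 2) ^ (card (evens J) - 1 - card J)))"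
  (is "\<bar>?c (spread J m) - _\<bar> \<le> _ * ?K")
  using b
proof (induction "\<Sum>i\<in>J. b i" arbitrary: b)
  case 0
  have "b = 0"
  proof
    fix i
    show "b i = 0 i" using 0(1) le_funD[OF 0(2), of i] J(1) by (cases "i \<in> J") (auto simp: spread_def)
  qed
  thus ?case by simp
next
  case (Suc n)
  have "(\<Sum>i\<in>J. b i) \<noteq> 0" using Suc(2) by simp
  then obtain i where i: "i \<in> J" "b i \<noteq> 0" by (metis sum.neutral)
  define b' where "b' = b - spread {i} 1"
  have bb: "b = b' + spread {i} 1" using i by (auto simp: b'_def fun_eq_iff spread_def)
  have b': "b' \<le> spread J m" using Suc(3) by (auto simp: b'_def le_fun_def intro: order_trans[OF diff_le_self])
  have "(\<Sum>x\<in>J. spread {i} 1 x) = (1::nat)" using i J by (simp add: spread_def)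
  hence n: "n = (\<Sum>i\<in>J. b' i)" using Suc(2) by (simp add: bb sum.distrib)
  have eq: "spread J m - b = (spread J m - b') - spread {i} 1" by (simp add: bb fun_eq_iff)
  have "spread J m - b' \<le> spread J m" by (simp add: le_fun_def)
  moreover have "(spread J m - b') i \<ge> 1"
    using i le_funD[OF Suc(3), of i] by (simp add: spread_def b'_def)
  ultimately have "\<bar>?c (spread J m - b') - ?c (spread J m - b)\<bar> \<le> ?K"
    unfolding eq by (rule card_sols_diff_step[OF J i(1) _ _ L])
  moreover have "\<bar>?c (spread J m) - ?c (spread J m - b')\<bar> \<le> real n * ?K"
    using Suc(1)[OF n b'] by (simp only: n)
  ultimately have "\<bar>?c (spread J m) - ?c (spread J m - b)\<bar> \<le> real n * ?K + ?K" by linarith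
  thus ?case unfolding Suc(2)[symmetric] by (simp only: of_nat_Suc distrib_right mult_1)
qed

section \<open>Local factors of the Euler product\<close>

context weight
begin

text \<open>
  The relation \<open>p = 1 + l + O(z\<^sup>2)\<close> with \<open>l = O(z)\<close>, with explicit constants. The linear terms \<open>l\<close> add up
  under multiplication; this is how their cancellation in the local factors becomes visible.
\<close>

definition first_order :: "real \<Rightarrow> real \<Rightarrow> ('e \<Rightarrow>\<^sub>0 real) \<Rightarrow> ('e \<Rightarrow>\<^sub>0 real) \<Rightarrow> bool" where
  "first_order z K l p \<longleftrightarrow> pnorm \<phi> l \<le> K * z \<and> pnorm \<phi> (p - 1 - l) \<le> K * z\<^sup>2"

lemma first_order_mult:
  assumes z: "0 \<le> z" "z \<le> 1" and K: "K1 \<ge> 0" "K2 \<ge> 0"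
    and n: "first_order z K1 l1 p1" "first_order z K2 l2 p2"
  shows "first_order z (K1 + K2 + 4 * K1 * K2) (l1 + l2) (p1 * p2)"
proof -
  define r1 where "r1 = p1 - 1 - l1"
  define r2 where "r2 = p2 - 1 - l2"
  have p: "p1 = 1 + l1 + r1" "p2 = 1 + l2 + r2" by (simp_all add: r1_def r2_def)
  have l: "pnorm \<phi> l1 \<le> K1 * z" "pnorm \<phi> l2 \<le> K2 * z"
    and r: "pnorm \<phi> r1 \<le> K1 * z\<^sup>2" "pnorm \<phi> r2 \<le> K2 * z\<^sup>2"
    using n by (auto simp: first_order_def r1_def r2_def)
  have z2: "z\<^sup>2 \<le> 1" "z\<^sup>2 \<le> z" "0 \<le> z\<^sup>2"
    using z by (auto simp: power2_eq_square mult_le_one mult_left_le)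
  have "pnorm \<phi> (l1 + l2) \<le> K1 * z + K2 * z" using pnorm_triangle[of l1 l2] l by linarith
  also have "\<dots> \<le> (K1 + K2 + 4 * K1 * K2) * z" using z K by (simp add: distrib_right)
  finally have 1: "pnorm \<phi> (l1 + l2) \<le> (K1 + K2 + 4 * K1 * K2) * z" .
  have b2: "pnorm \<phi> (l2 + r2) \<le> 2 * K2"
  proof -
    have "pnorm \<phi> (l2 + r2) \<le> K2 * z + K2 * z\<^sup>2" using pnorm_triangle[of l2 r2] l r by linarith
    also have "\<dots> \<le> K2 * 1 + K2 * 1" using z z2 K by (intro add_mono mult_left_mono) auto
    finally show ?thesis by simp
  qed
  have "p1 * p2 - 1 - (l1 + l2) = (l1 * l2 + l1 * r2) + (r1 + (r1 * (l2 + r2) + r2))"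
    by (simp add: p algebra_simps)
  hence "pnorm \<phi> (p1 * p2 - 1 - (l1 + l2)) \<le>
      pnorm \<phi> l1 * pnorm \<phi> l2 + pnorm \<phi> l1 * pnorm \<phi> r2 +
      (pnorm \<phi> r1 + (pnorm \<phi> r1 * pnorm \<phi> (l2 + r2) + pnorm \<phi> r2))"
    by (simp only:) (intro order_trans[OF pnorm_triangle] add_mono pnorm_mult order_refl)
  also have "\<dots> \<le> (K1 * z) * (K2 * z) + (K1 * z) * (K2 * z) +
      (K1 * z\<^sup>2 + (K1 * z\<^sup>2 * (2 * K2) + K2 * z\<^sup>2))"
  proof (intro add_mono mult_mono l r b2 pnorm_nonneg)
    show "pnorm \<phi> r2 \<le> K2 * z" using r(2) z2(2) K(2) mult_left_mono order_trans by blast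
  qed (use z K in auto)
  also have "\<dots> = (K1 + K2 + 4 * K1 * K2) * z\<^sup>2" by (simp add: algebra_simps power2_eq_square)
  finally show ?thesis using 1 by (simp add: first_order_def)
qed

end

fun first_order_const :: "real \<Rightarrow> nat \<Rightarrow> real" where
  "first_order_const K 0 = 0"
| "first_order_const K (Suc n) = K + first_order_const K n + 4 * K * first_order_const K n"

lemma first_order_const_nonneg: "K \<ge> 0 \<Longrightarrow> first_order_const K n \<ge> 0"
  by (induction n) auto

lemma (in weight) first_order_prod:
  assumes "finite A" "0 \<le> z" "z \<le> 1" "K \<ge> 0" "\<And>i. i \<in> A \<Longrightarrow> first_order z K (l i) (p i)"
  shows "first_order z (first_order_const K (card A)) (\<Sum>i\<in>A. l i) (\<Prod>i\<in>A. p i)"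
  using assms(1,5)
proof (induction A)
  case empty
  thus ?case by (simp add: first_order_def)
next
  case (insert i A)
  thus ?case using first_order_mult[of z K "first_order_const K (card A)"] assms(2-4) first_order_const_nonneg by simp
qed

definition wt :: "'i set \<Rightarrow> real \<Rightarrow> ('i \<Rightarrow> nat) \<Rightarrow> real" where
  "wt J R a = R ^ (\<Sum>i\<in>J. a i)"

lemma weight_wt: "R \<ge> 0 \<Longrightarrow> weight (wt J R)"
  by standard (auto simp: wt_def sum.distrib power_add)

lemma wt_one: "wt J 1 = (\<lambda>_. 1)"
  by (simp add: wt_def fun_eq_iff)

lemma wt_spread_le:
  assumes "finite J" "I \<subseteq> J" "R \<ge> 1"
  shows "wt J R (spread I n) \<le> (R ^ card J) ^ n"
proof -
  have "(\<Sum>i\<in>J. spread I n i) \<le> (\<Sum>i\<in>J. n)" by (intro sum_mono) (simp add: spread_def)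
  hence "wt J R (spread I n) \<le> R ^ (card J * n)"
    unfolding wt_def using assms(3) by (intro power_increasing) auto
  thus ?thesis by (simp add: power_mult)
qed

abbreviation at_one :: "(('i \<Rightarrow> nat) \<Rightarrow>\<^sub>0 real) \<Rightarrow> real" where
  "at_one \<equiv> ev (\<lambda>_. 1)"

text \<open>
  With \<open>y\<close> in place of \<open>1 / q ^ deg P\<close> and \<open>d\<close> in place of \<open>deg P\<close>, \<open>local_num\<close> is the factor at \<open>P\<close> of the
  generating function of the moments, with every \<open>x\<^sub>i\<close> replaced by \<open>- x\<^sub>i\<close>. This substitution does not
  affect the coefficient of \<open>\<Prod> x\<^sub>i ^ m\<close> when \<open>card J\<close> is even, and turns the comparison factors
  \<open>1 - x\<^sub>I\<close> of odd sets into \<open>1 + x\<^sub>I\<close>.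
\<close>

definition sgn_card :: "'i set \<Rightarrow> real" where
  "sgn_card I = (-1) ^ card I"

definition local_num :: "'i set \<Rightarrow> real \<Rightarrow> nat \<Rightarrow> (('i \<Rightarrow> nat) \<Rightarrow>\<^sub>0 real)" where
  "local_num J y d = 1 + (\<Sum>I\<in>index_sets J. mterm (spread I d) (y * sgn_card I ^ (1 + d)))"

definition local_geo :: "nat \<Rightarrow> real \<Rightarrow> nat \<Rightarrow> 'i set \<Rightarrow> (('i \<Rightarrow> nat) \<Rightarrow>\<^sub>0 real)" where
  "local_geo L y d I = (\<Sum>j\<le>L. mterm (spread I (d * j)) (((-1) ^ d * y) ^ j))"

text \<open>
  Dividing by the factors at \<open>P\<close> of \<open>1 / (1 - x\<^sub>I)\<close> for even \<open>I\<close> and of \<open>1 + x\<^sub>I\<close> for odd \<open>I\<close>, the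
  latter with the geometric series cut off at \<open>L\<close>.
\<close>

definition local_factor :: "'i set \<Rightarrow> nat \<Rightarrow> real \<Rightarrow> nat \<Rightarrow> (('i \<Rightarrow> nat) \<Rightarrow>\<^sub>0 real)" where
  "local_factor J L y d = local_num J y d *
     ((\<Prod>I\<in>evens J. 1 - mterm (spread I d) y) * (\<Prod>I\<in>odds J. local_geo L y d I))"

lemma sum_local_signs:
  assumes "finite J"
  shows "(\<Sum>I\<in>index_sets J. f I (y * sgn_card I ^ (1 + d))) =
    (\<Sum>I\<in>odds J. f I (- ((-1) ^ d * y))) + (\<Sum>I\<in>evens J. f I y :: 'b::comm_monoid_add)"
  using assms odds_evens_disjoint
  by (subst sum.union_disjoint) (auto simp: sgn_card_def mult.commute[of y] odds_def evens_def intro!: sum.cong arg_cong2[where f = "(+)"])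

text \<open>
  The constant is uniform in the radius \<open>R\<close>, in the truncation \<open>L\<close> and in the prime.
\<close>

definition norm_bound :: "'i set \<Rightarrow> real \<Rightarrow> bool" where
  "norm_bound J K \<longleftrightarrow> (\<forall>R L y d. R \<ge> 1 \<and> L \<ge> 1 \<and> y \<ge> 0 \<and> y * (R ^ card J) ^ d \<le> 3 / 4 \<longrightarrow>
    pnorm (wt J R) (local_factor J L y d - 1) \<le> K * (y * (R ^ card J) ^ d)\<^sup>2)"

text \<open>
  The linear terms of the three groups of factors cancel, so only second-order terms are left.
\<close>

lemma pnorm_local_factor:
  assumes J: "finite J"
  shows "\<exists>K>0. norm_bound J K"
proof -
  define n where "n = real (card (index_sets J))"
  define Ke where "Ke = first_order_const 1 (card (evens J))"
  define Ko where "Ko = first_order_const 4 (card (odds J))"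
  define K' where "K' = Ke + Ko + 4 * Ke * Ko"
  define K where "K = n + K' + 4 * n * K'"
  have nonneg: "n \<ge> 0" "Ke \<ge> 0" "Ko \<ge> 0" "K' \<ge> 0" "K \<ge> 0"
    by (simp_all add: n_def Ke_def Ko_def K'_def K_def first_order_const_nonneg)
  have "pnorm (wt J R) (local_factor J L y d - 1) \<le> K * (y * (R ^ card J) ^ d)\<^sup>2"
    if R: "R \<ge> 1" and L: "L \<ge> 1" and y: "y \<ge> 0" and z': "y * (R ^ card J) ^ d \<le> 3 / 4" for R L y d
  proof -
    interpret weight "wt J R" using R by (intro weight_wt) auto
    define z where "z = y * (R ^ card J) ^ d"
    have z: "0 \<le> z" "z \<le> 3 / 4" "z \<le> 1" using R y z' by (auto simp: z_def)
    have mono: "pnorm (wt J R) (mterm (spread I (d * j)) (c ^ j)) \<le> z ^ j"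
      if "I \<in> index_sets J" "\<bar>c\<bar> = y" for I j c
    proof -
      have "I \<subseteq> J" using that by (auto simp: odds_def evens_def)
      hence "wt J R (spread I (d * j)) \<le> ((R ^ card J) ^ d) ^ j"
        using wt_spread_le[OF J _ R, of I "d * j"] by (simp add: power_mult)
      thus ?thesis using that y by (simp add: pnorm_single power_abs z_def power_mult_distrib mult_left_mono)
    qed
    have mono1: "pnorm (wt J R) (mterm (spread I d) c) \<le> z"
      if "I \<in> index_sets J" "\<bar>c\<bar> = y" for I c using mono[OF that, of 1] by simp
    let ?l = "\<Sum>I\<in>index_sets J. mterm (spread I d) (y * sgn_card I ^ (1 + d))"
    have num: "first_order z n ?l (local_num J y d)"
    proof -
      have "pnorm (wt J R) ?l \<le> (\<Sum>I\<in>index_sets J. z)"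
        using y by (intro order_trans[OF pnorm_sum] sum_mono mono1)
          (auto simp: abs_mult sgn_card_def simp flip: power_mult)
      thus ?thesis using nonneg by (simp add: first_order_def local_num_def n_def)
    qed
    have ev: "first_order z Ke (\<Sum>I\<in>evens J. - mterm (spread I d) y) (\<Prod>I\<in>evens J. 1 - mterm (spread I d) y)"
      unfolding Ke_def using J z y
      by (intro first_order_prod) (auto simp: first_order_def pnorm_uminus mono1)
    have od: "first_order z Ko (\<Sum>I\<in>odds J. mterm (spread I d) ((-1) ^ d * y)) (\<Prod>I\<in>odds J. local_geo L y d I)"
      unfolding Ko_def
    proof (intro first_order_prod)
      fix I assume I: "I \<in> odds J"
      define c where "c = (-1) ^ d * y"
      have c: "\<bar>c\<bar> = y" using y by (simp add: c_def abs_mult power_abs)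
      have "{..L} = insert 0 (insert 1 {2..L})" using L by auto
      hence "local_geo L y d I - 1 - mterm (spread I d) c = (\<Sum>j=2..L. mterm (spread I (d * j)) (c ^ j))"
        by (simp add: local_geo_def c_def)
      also have "pnorm (wt J R) \<dots> \<le> (\<Sum>j=2..L. z ^ j)"
        using I c by (intro order_trans[OF pnorm_sum] sum_mono mono) auto
      also have "\<dots> \<le> 4 * z\<^sup>2"
      proof -
        have "(1 - z) * (\<Sum>j=2..L. z ^ j) \<le> z\<^sup>2" using z
          by (cases "2 \<le> L") (simp_all add: sum_gp_multiplied)
        moreover have "1 / 4 * (\<Sum>j=2..L. z ^ j) \<le> (1 - z) * (\<Sum>j=2..L. z ^ j)"
          using z by (intro mult_right_mono sum_nonneg) auto
        ultimately show ?thesis by simp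
      qed
      finally show "first_order z 4 (mterm (spread I d) ((-1) ^ d * y)) (local_geo L y d I)"
        using mono1[of I c] I c z by (simp add: first_order_def c_def)
    qed (use z J in auto)
    have "first_order z K (?l + ((\<Sum>I\<in>evens J. - mterm (spread I d) y) + (\<Sum>I\<in>odds J. mterm (spread I d) ((-1) ^ d * y))))
        (local_factor J L y d)"
      unfolding local_factor_def K_def K'_def
      by (intro first_order_mult num ev od) (use z nonneg in auto)
    moreover have "?l + ((\<Sum>I\<in>evens J. - mterm (spread I d) y) + (\<Sum>I\<in>odds J. mterm (spread I d) ((-1) ^ d * y))) = 0"
      by (subst sum_local_signs[OF J]) (simp add: sum_negf single_uminus)
    ultimately show ?thesis by (simp add: first_order_def z_def)
  qed
  hence "norm_bound J (K + 1)"
    unfolding norm_bound_def by (auto simp: distrib_right intro: add_increasing2)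
  thus ?thesis using nonneg by (intro exI[of _ "K + 1"]) auto
qed

text \<open>
  At \<open>(1,\<dots>,1)\<close> the numerator is \<open>1 - y\<close> for even \<open>d\<close>, and at least \<open>1\<close> for odd \<open>d\<close>; each of the other
  factors is at least \<open>1 - y\<close>, the truncated geometric series because \<open>L \<ge> 1\<close>.
\<close>

lemma ev_local_factor_ge_const:
  assumes J: "finite J" "J \<noteq> {}" and y: "0 \<le> y" "y \<le> 1 / 2" and L: "L \<ge> 1"
  shows "at_one (local_factor J L y d) \<ge> (1 / 2) ^ (2 * card (odds J))"
proof -
  interpret weight "\<lambda>_::'a \<Rightarrow> nat. 1::real" by standard auto
  define s :: real where "s = (-1) ^ d"
  have s: "s = 1 \<or> s = -1" by (simp add: s_def minus_one_power_iff)
  have od: "card (odds J) = card (evens J) + 1" using J by (simp add: card_odds card_evens)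
  have num: "at_one (local_num J y d) \<ge> 1 / 2"
  proof -
    have "at_one (local_num J y d) = 1 + (\<Sum>I\<in>index_sets J. y * sgn_card I ^ (1 + d))"
      by (simp add: local_num_def ev_add ev_one ev_sum ev_single)
    also have "\<dots> = 1 + y * (real (card (evens J)) - s * real (card (odds J)))"
      by (subst sum_local_signs[OF J(1), of "\<lambda>_ c. c"]) (simp add: s_def algebra_simps)
    finally show ?thesis using s od y by (auto simp: algebra_simps)
  qed
  have fac: "at_one (1 - mterm (spread I d) y) = 1 - y" for I :: "'a set"
    by (simp add: ev_diff ev_one ev_single)
  have geo: "at_one (local_geo L y d I) \<ge> 1 / 2" for I :: "'a set"
  proof -
    have eq: "at_one (local_geo L y d I) = (\<Sum>j\<le>L. (s * y) ^ j)"
      by (simp add: local_geo_def ev_sum ev_single s_def)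
    have gp: "(1 - s * y) * (\<Sum>j\<le>L. (s * y) ^ j) = 1 - (s * y) ^ Suc L"
      by (simp add: sum_gp_basic)
    have "(s * y) ^ Suc L \<le> \<bar>s * y\<bar> ^ Suc L" by (metis abs_ge_self power_abs)
    also have "\<dots> \<le> \<bar>s * y\<bar> ^ 2" using s y L by (intro power_decreasing) auto
    finally have low: "(1 - s * y) * (\<Sum>j\<le>L. (s * y) ^ j) \<ge> 1 - y\<^sup>2" 
      unfolding gp using s by auto
    show ?thesis
    proof (cases "s = 1")
      case True
      have "(\<Sum>j\<le>L. (s * y) ^ j) \<ge> (\<Sum>j\<in>{0}. (s * y) ^ j)"
        using True y by (intro sum_mono2) auto
      thus ?thesis by (simp add: eq)
    next
      case False
      hence e: "1 - s * y = 1 + y" using s by auto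
      have e': "1 - y\<^sup>2 = (1 + y) * (1 - y)" by (simp add: algebra_simps power2_eq_square)
      have "(1 + y) * (\<Sum>j\<le>L. (s * y) ^ j) \<ge> (1 + y) * (1 - y)"
        using low unfolding e e' .
      hence "(\<Sum>j\<le>L. (s * y) ^ j) \<ge> 1 - y" using y by (simp add: mult_le_cancel_left_pos)
      thus ?thesis using y by (simp add: eq)
    qed
  qed
  have "(1 / 2) ^ (2 * card (odds J)) = (1 / 2 :: real) * ((1 / 2) ^ card (evens J) * (1 / 2) ^ card (odds J))"
    by (simp add: od mult_2 flip: power_Suc power_add)
  also have "\<dots> \<le> at_one (local_num J y d) *
      ((\<Prod>I\<in>evens J. at_one (1 - mterm (spread I d) y)) * (\<Prod>I\<in>odds J. at_one (local_geo L y d I)))"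
  proof (intro mult_mono num)
    have "(\<Prod>I\<in>evens J. 1 / 2) \<le> (\<Prod>I\<in>evens J. at_one (1 - mterm (spread I d) y))"
      using y by (intro prod_mono) (simp add: fac)
    thus "(1 / 2) ^ card (evens J) \<le> (\<Prod>I\<in>evens J. at_one (1 - mterm (spread I d) y))" by simp
    have "(\<Prod>I\<in>odds J. 1 / 2) \<le> (\<Prod>I\<in>odds J. at_one (local_geo L y d I))"
      using geo by (intro prod_mono) auto
    thus "(1 / 2) ^ card (odds J) \<le> (\<Prod>I\<in>odds J. at_one (local_geo L y d I))" by simp
  qed (use num y in \<open>auto simp: fac intro!: prod_nonneg order_trans[OF _ geo] order_trans[OF _ num]\<close>)
  also have "\<dots> = at_one (local_factor J L y d)"
    unfolding local_factor_def by (simp only: ev_mult ev_prod)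
  finally show ?thesis .
qed

lemma exp_le_one_minus:
  assumes "0 \<le> x" "x \<le> (1 / 2 :: real)"
  shows "exp (- (2 * x)) \<le> 1 - x"
proof -
  have "x * (2 * x) \<le> x * 1" using assms by (intro mult_left_mono) auto
  hence "1 \<le> (1 - x) * (1 + 2 * x)" by (simp add: algebra_simps)
  also have "\<dots> \<le> (1 - x) * exp (2 * x)"
    using assms exp_ge_add_one_self[of "2 * x"] by (intro mult_left_mono) auto
  finally have "1 * exp (- (2 * x)) \<le> (1 - x) * exp (2 * x) * exp (- (2 * x))"
    by (intro mult_right_mono) auto
  thus ?thesis by (simp add: mult.assoc flip: exp_add)
qed

text \<open>
  For small \<open>y\<close> the value is \<open>1 + O(y\<^sup>2)\<close>; for the other \<open>y\<close> the constant lower bound is a negative power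
  of \<open>e\<close>, and \<open>y\<^sup>2\<close> is bounded below.
\<close>

lemma ev_local_factor_ge_exp:
  assumes J: "finite J" "J \<noteq> {}"
  shows "\<exists>K>0. \<forall>L y d. L \<ge> 1 \<and> 0 \<le> y \<and> y \<le> 1 / 2 \<longrightarrow>
    exp (- K * y\<^sup>2) \<le> at_one (local_factor J L y d)"
proof -
  interpret weight "\<lambda>_::'a \<Rightarrow> nat. 1::real" by standard auto
  obtain K where K: "K > 0" and "norm_bound J K" using pnorm_local_factor[OF J(1)] by blast
  note le = this(2)[unfolded norm_bound_def, rule_format]
  define N where "N = 2 * card (odds J)"
  define K' where "K' = 2 * K * (1 + real N)"
  have "exp (- K' * y\<^sup>2) \<le> at_one (local_factor J L y d)"
    if L: "L \<ge> 1" and y: "0 \<le> y" "y \<le> 1 / 2" for L y d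
  proof (cases "K * y\<^sup>2 \<le> 1 / 2")
    case True
    have "\<bar>at_one (local_factor J L y d - 1)\<bar> \<le> K * y\<^sup>2"
      using le[of 1 L y d] L y abs_ev_le_pnorm order_trans by (fastforce simp: wt_one)
    moreover have "at_one (local_factor J L y d) = at_one (local_factor J L y d - 1) + 1"
      using ev_add[of _ "local_factor J L y d - 1" 1] by (simp add: ev_one)
    ultimately have "1 - K * y\<^sup>2 \<le> at_one (local_factor J L y d)" by linarith
    moreover have "exp (- K' * y\<^sup>2) \<le> 1 - K * y\<^sup>2"
    proof -
      define x where "x = K * y\<^sup>2"
      have x: "0 \<le> x" "x \<le> 1 / 2" using True K by (auto simp: x_def)
      have "exp (- K' * y\<^sup>2) \<le> exp (- (2 * x))" using x K by (simp add: K'_def x_def algebra_simps)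
      also have "\<dots> \<le> 1 - x" using x by (rule exp_le_one_minus)
      finally show ?thesis by (simp add: x_def)
    qed
    ultimately show ?thesis by linarith
  next
    case False
    have "exp (- K' * y\<^sup>2) \<le> exp (- real N)"
    proof -
      have "1 * real N \<le> (2 * (K * y\<^sup>2)) * (1 + real N)" using False by (intro mult_mono) auto
      thus ?thesis by (simp add: K'_def algebra_simps)
    qed
    also have "\<dots> = exp (-1) ^ N" by (simp flip: exp_of_nat_mult)
    also have "\<dots> \<le> (1 / 2) ^ N"
    proof (intro power_mono)
      have "(2::real) \<le> exp 1" using exp_ge_add_one_self[of 1] by simp
      thus "exp (-1) \<le> (1 / 2 :: real)" by (simp add: exp_minus field_simps)
    qed simp
    also have "\<dots> \<le> at_one (local_factor J L y d)"
      unfolding N_def by (rule ev_local_factor_ge_const[OF J y L])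
    finally show ?thesis .
  qed
  moreover have "K' > 0" using K by (simp add: K'_def)
  ultimately show ?thesis by blast
qed

section \<open>The moment as a coefficient of an Euler product\<close>

lemma sum_spread: "(\<Sum>p\<in>S. spread I (f p)) = spread I (\<Sum>p\<in>S. f p)"
  by (induction S rule: infinite_finite_induct) (auto simp: spread_add)

lemma spread_inj: "I \<noteq> {} \<Longrightarrow> spread I j = spread I l \<longleftrightarrow> j = l"
  by (auto simp: spread_def fun_eq_iff)

lemma prod_one_plus_mterm:
  assumes "finite A"
  shows "(\<Prod>p\<in>A. 1 + mterm (a p) (c p)) = (\<Sum>S\<in>Pow A. mterm (\<Sum>p\<in>S. a p) (\<Prod>p\<in>S. c p))"
proof -
  have "(\<Prod>p\<in>A. mterm (a p) (c p) + 1) = (\<Sum>S\<in>Pow A. (\<Prod>p\<in>S. mterm (a p) (c p)) * (\<Prod>p\<in>A - S. 1))"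
    by (rule prod_add[OF assms])
  thus ?thesis by (simp add: prod_single add.commute)
qed

lemma mcoeff_sum_spread:
  assumes "finite F" "I \<noteq> {}"
  shows "mcoeff (\<Sum>S\<in>F. mterm (spread I (f S)) (c S)) (spread I j) = (\<Sum>S | S \<in> F \<and> f S = j. c S)"
  using assms by (simp add: lookup_sum lookup_single when_def spread_inj sum.If_cases Int_def)

lemma mcoeff_sum_spread_other:
  assumes "\<And>j. a \<noteq> spread I j"
  shows "mcoeff (\<Sum>S\<in>F. mterm (spread I (f S)) (c S)) a = 0"
  using assms[symmetric] by (simp add: lookup_sum lookup_single when_def)

text \<open>
  The squarefree polynomials that are built from primes of degree at most \<open>m\<close>, seen as finite sets of
  primes with degrees \<open>dg\<close>. The last assumption says that the sum of \<open>\<mu>\<close> over the monic polynomials of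
  degree \<open>j\<close> is \<open>1\<close>, \<open>- q\<close>, \<open>0\<close>, \<open>0\<close>, \<dots>, which amounts to the Euler product of the zeta function up to
  degree \<open>m\<close>.
\<close>

locale prime_system =
  fixes primes :: "'p set" and dg :: "'p \<Rightarrow> nat" and q m :: nat
  assumes finite_primes: "finite primes"
    and dg_pos: "\<And>p. p \<in> primes \<Longrightarrow> dg p \<ge> 1"
    and dg_le: "\<And>p. p \<in> primes \<Longrightarrow> dg p \<le> m"
    and q_ge_2: "q \<ge> 2"
    and card_squarefree: "\<And>j. j \<le> m \<Longrightarrow> card {S. S \<subseteq> primes \<and> (\<Sum>p\<in>S. dg p) = j} \<le> q ^ j"
    and sum_moebius: "\<And>j. j \<le> m \<Longrightarrow>
      (\<Sum>S | S \<subseteq> primes \<and> (\<Sum>p\<in>S. dg p) = j. (-1) ^ card S) =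
      (if j = 0 then 1 else if j = 1 then - real q else 0)"
begin

definition size_of :: "'p set \<Rightarrow> nat" where
  "size_of S = (\<Sum>p\<in>S. dg p)"

definition recip :: "'p \<Rightarrow> real" where
  "recip p = 1 / real q ^ dg p"

lemma recip_pos: "recip p > 0" and recip_nonneg: "recip p \<ge> 0"
  using q_ge_2 by (auto simp: recip_def)

lemma recip_le_half: "p \<in> primes \<Longrightarrow> recip p \<le> 1 / 2"
proof -
  assume p: "p \<in> primes"
  have "2 \<le> real q ^ 1" using q_ge_2 by simp
  also have "\<dots> \<le> real q ^ dg p"
    using q_ge_2 dg_pos[OF p] by (intro power_increasing) auto
  finally have "2 \<le> real q ^ dg p" .
  thus ?thesis using frac_le[of 1 1 2 "real q ^ dg p"] by (simp add: recip_def)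
qed

lemma prod_recip: "(\<Prod>p\<in>S. recip p) = 1 / real q ^ size_of S"
  by (simp add: recip_def prod_dividef size_of_def power_sum)

lemma sum_moebius': "j \<le> m \<Longrightarrow>
    (\<Sum>S | S \<subseteq> primes \<and> size_of S = j. (-1) ^ card S) =
      (if j = 0 then 1 else if j = 1 then - real q else 0)"
  using sum_moebius by (simp add: size_of_def)

lemma card_squarefree': "j \<le> m \<Longrightarrow> card {S. S \<subseteq> primes \<and> size_of S = j} \<le> q ^ j"
  using card_squarefree by (simp add: size_of_def)

lemma finite_Pow_primes: "finite {S. S \<subseteq> primes \<and> Q S}"
  using finite_primes by (auto intro: finite_subset[of _ "Pow primes"])

lemma card_primes_of_degree: "card {p \<in> primes. dg p = d} \<le> q ^ d"
proof (cases "d \<le> m")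
  case True
  have "card {p \<in> primes. dg p = d} = card ((\<lambda>p. {p}) ` {p \<in> primes. dg p = d})"
    by (simp add: card_image)
  also have "\<dots> \<le> card {S. S \<subseteq> primes \<and> size_of S = d}"
    using finite_Pow_primes by (intro card_mono) (auto simp: size_of_def)
  finally show ?thesis using card_squarefree'[OF True] by simp
next
  case False
  hence none: "{p \<in> primes. dg p = d} = {}" using dg_le by auto
  show ?thesis unfolding none by simp
qed

text \<open>
  There are at most \<open>q ^ d\<close> primes of degree \<open>d\<close>, so the sum is bounded by a geometric series.
\<close>

lemma sum_primes_le:
  assumes t: "t \<ge> 0" "real q * t \<le> 3 / 4"
  shows "(\<Sum>p\<in>primes. t ^ dg p) \<le> 4 * (real q * t)"
proof -
  define s where "s = real q * t"
  have s: "0 \<le> s" "s \<le> 3 / 4" using t by (auto simp: s_def)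
  have "(\<Sum>p\<in>primes. t ^ dg p) = (\<Sum>d\<in>{1..m}. \<Sum>p | p \<in> primes \<and> dg p = d. t ^ dg p)"
    using finite_primes dg_pos dg_le by (intro sum.group[symmetric]) auto
  also have "\<dots> = (\<Sum>d\<in>{1..m}. real (card {p \<in> primes. dg p = d}) * t ^ d)"
    by (intro sum.cong) auto
  also have "\<dots> \<le> (\<Sum>d\<in>{1..m}. real (q ^ d) * t ^ d)"
    using t by (intro sum_mono mult_right_mono of_nat_mono card_primes_of_degree) auto
  also have "\<dots> = (\<Sum>d\<in>{1..m}. s ^ d)" by (simp add: s_def power_mult_distrib)
  also have "\<dots> \<le> 4 * s"
  proof -
    have "(1 - s) * (\<Sum>d\<in>{1..m}. s ^ d) \<le> s"
      using s by (cases "1 \<le> m") (simp_all add: sum_gp_multiplied)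
    moreover have "1 / 4 * (\<Sum>d\<in>{1..m}. s ^ d) \<le> (1 - s) * (\<Sum>d\<in>{1..m}. s ^ d)"
      using s by (intro mult_right_mono sum_nonneg) auto
    ultimately show ?thesis by simp
  qed
  finally show ?thesis by (simp add: s_def)
qed

lemma sum_recip_squared_le: "(\<Sum>p\<in>primes. (recip p)\<^sup>2) \<le> 2"
proof -
  have q: "real q \<ge> 2" using q_ge_2 by simp
  have "(\<Sum>p\<in>primes. (recip p)\<^sup>2) = (\<Sum>p\<in>primes. ((1 / real q)\<^sup>2) ^ dg p)"
    by (simp add: recip_def power_divide power2_eq_square power_mult_distrib)
  also have "\<dots> \<le> 4 * (real q * (1 / real q)\<^sup>2)"
    using q by (intro sum_primes_le) (auto simp: power2_eq_square field_simps)
  also have "\<dots> \<le> 2" using q by (simp add: power2_eq_square field_simps)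
  finally show ?thesis .
qed

subsection \<open>Euler product\<close>

text \<open>
  The product over primes \<open>P\<close> of \<open>1 - (s * u / q) ^ deg P\<close> is \<open>1 - s * u\<close> up to degree \<open>m\<close>, at \<open>u = x\<^sub>I\<close>:
  expanding it gives the sums of \<open>\<mu>\<close> over the squarefree polynomials of each degree. The sign \<open>s\<close> allows for replacing the
  variables by their negatives.
\<close>

lemma euler_product:
  assumes I: "I \<subseteq> J" "I \<noteq> {}"
  shows "cong_upto (spread J m) (\<Prod>p\<in>primes. 1 - mterm (spread I (dg p)) (s ^ dg p * recip p))
    (1 - mterm (spread I 1) s)"
  unfolding cong_upto_def
proof (intro allI impI)
  fix a assume a: "a \<le> spread J m"
  have "(\<Prod>p\<in>primes. 1 - mterm (spread I (dg p)) (s ^ dg p * recip p)) =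
      (\<Prod>p\<in>primes. 1 + mterm (spread I (dg p)) (- (s ^ dg p * recip p)))"
    by (simp add: single_uminus)
  also have "\<dots> = (\<Sum>S\<in>Pow primes. mterm (spread I (size_of S)) (\<Prod>p\<in>S. - (s ^ dg p * recip p)))"
    by (simp add: prod_one_plus_mterm finite_primes sum_spread size_of_def)
  also have "\<dots> = (\<Sum>S\<in>Pow primes. mterm (spread I (size_of S)) ((-1) ^ card S * (s ^ size_of S / real q ^ size_of S)))"
    by (simp only: prod_uminus prod.distrib prod_recip) (simp add: size_of_def power_sum)
  finally have eq: "(\<Prod>p\<in>primes. 1 - mterm (spread I (dg p)) (s ^ dg p * recip p)) =
      (\<Sum>S\<in>Pow primes. mterm (spread I (size_of S)) ((-1) ^ card S * (s ^ size_of S / real q ^ size_of S)))" .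
  show "mcoeff (\<Prod>p\<in>primes. 1 - mterm (spread I (dg p)) (s ^ dg p * recip p)) a =
      mcoeff (1 - mterm (spread I 1) s) a"
  proof (cases "\<exists>j. a = spread I j")
    case True
    then obtain j where j: "a = spread I j" by blast
    obtain i where i: "i \<in> I" "i \<in> J" using I by blast
    have jm: "j \<le> m" using le_funD[OF a, of i] i by (simp add: j spread_def)
    have "mcoeff (\<Prod>p\<in>primes. 1 - mterm (spread I (dg p)) (s ^ dg p * recip p)) a =
        (\<Sum>S | S \<in> Pow primes \<and> size_of S = j. (-1) ^ card S * (s ^ size_of S / real q ^ size_of S))"
      unfolding eq j using finite_primes I by (intro mcoeff_sum_spread) auto
    also have "\<dots> = (\<Sum>S | S \<subseteq> primes \<and> size_of S = j. (-1) ^ card S) * (s ^ j / real q ^ j)"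
      unfolding sum_distrib_right by (intro sum.cong) auto
    also have "\<dots> = (if j = 0 then 1 else if j = 1 then - s else 0)"
      using q_ge_2 by (simp add: sum_moebius'[OF jm])
    also have "\<dots> = mcoeff (1 - mterm (spread I 1) s) a"
      using I(2) spread_inj[OF I(2), of 1 j] spread_inj[OF I(2), of j 0]
      by (auto simp: j lookup_minus lookup_one lookup_single when_def)
    finally show ?thesis .
  next
    case False
    hence ne: "a \<noteq> spread I j" for j by blast
    hence "mcoeff (\<Prod>p\<in>primes. 1 - mterm (spread I (dg p)) (s ^ dg p * recip p)) a = 0"
      unfolding eq by (intro mcoeff_sum_spread_other)
    moreover have "mcoeff (1 - mterm (spread I 1) s) a = 0"
      using ne[of 0] ne[of 1] by (auto simp: lookup_minus lookup_one lookup_single when_def)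
    ultimately show ?thesis by simp
  qed
qed

lemma cong_upto_high:
  assumes "I \<subseteq> J" "I \<noteq> {}" "n > m"
  shows "cong_upto (spread J m) (1 - mterm (spread I n) c) 1"
  unfolding cong_upto_def
proof (intro allI impI)
  fix a assume a: "a \<le> spread J m"
  obtain i where i: "i \<in> I" "i \<in> J" using assms by blast
  have "a \<noteq> spread I n" using le_funD[OF a, of i] i assms(3) by (auto simp: spread_def)
  thus "mcoeff (1 - mterm (spread I n) c) a = mcoeff 1 a"
    by (auto simp: lookup_minus lookup_single when_def)
qed

lemma geometric_local:
  "(1 - mterm (spread I d) ((-1) ^ d * c)) * local_geo L c d I =
     1 - mterm (spread I (d * Suc L)) (((-1) ^ d * c) ^ Suc L)"
proof (induction L)
  case 0
  show ?case by (simp add: local_geo_def)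
next
  case (Suc L)
  have "local_geo (Suc L) c d I = local_geo L c d I + mterm (spread I (d * Suc L)) (((-1) ^ d * c) ^ Suc L)"
    by (simp add: local_geo_def)
  moreover have "mterm (spread I d) ((-1) ^ d * c) * mterm (spread I (d * Suc L)) (((-1) ^ d * c) ^ Suc L) =
      mterm (spread I (d * Suc (Suc L))) (((-1) ^ d * c) ^ Suc (Suc L))"
    by (simp add: mult_single spread_add)
  ultimately show ?case using Suc by (simp only: distrib_left left_diff_distrib mult_1) simp
qed

text \<open>
  These are the Euler product of the moments and the factor \<open>H\<close> by which it differs from the generating
  function \<open>G\<close> of the counts.
\<close>

definition numerator :: "'i set \<Rightarrow> (('i \<Rightarrow> nat) \<Rightarrow>\<^sub>0 real)" where
  "numerator J = (\<Prod>p\<in>primes. local_num J (recip p) (dg p))"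

definition corrector :: "'i set \<Rightarrow> nat \<Rightarrow> (('i \<Rightarrow> nat) \<Rightarrow>\<^sub>0 real)" where
  "corrector J L = (\<Prod>p\<in>primes. local_factor J L (recip p) (dg p))"

text \<open>
  For even \<open>I\<close> the Euler product is \<open>1 - x\<^sub>I\<close>, the inverse of the geometric series in \<open>G\<close>.
\<close>

lemma even_part:
  assumes "I \<in> evens J" "L \<ge> m"
  shows "cong_upto (spread J m)
    ((\<Prod>p\<in>primes. 1 - mterm (spread I (dg p)) (recip p)) * (\<Sum>j\<le>odd_cap L I. mterm (spread I j) 1)) 1"
proof -
  have I: "I \<subseteq> J" "I \<noteq> {}" and cap: "odd_cap L I = L" using assms by (auto simp: evens_def odd_cap_def)
  have "cong_upto (spread J m)
    ((\<Prod>p\<in>primes. 1 - mterm (spread I (dg p)) (1 ^ dg p * recip p)) * (\<Sum>j\<le>L. mterm (spread I j) 1))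
    ((1 - mterm (spread I 1) 1) * (\<Sum>j\<le>L. mterm (spread I j) 1))"
    by (intro cong_upto_mult euler_product I) simp
  also have "(1 - mterm (spread I 1) 1) * (\<Sum>j\<le>L. mterm (spread I j) 1) = 1 - mterm (spread I (Suc L)) (1::real)"
    by (rule geometric_spread)
  also have "cong_upto (spread J m) \<dots> 1" using assms by (intro cong_upto_high I) auto
  finally show ?thesis by (simp add: cap)
qed

text \<open>
  For odd \<open>I\<close> the factor \<open>1 + x\<^sub>I\<close> of \<open>G\<close> is itself an Euler product, with sign \<open>s = -1\<close>, and the truncated
  geometric series invert its factors up to monomials of degree above \<open>L\<close>.
\<close>

lemma odd_part:
  assumes "I \<in> odds J" "L \<ge> m"
  shows "cong_upto (spread J m)
    ((\<Prod>p\<in>primes. local_geo L (recip p) (dg p) I) * (\<Sum>j\<le>odd_cap L I. mterm (spread I j) 1)) 1"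
proof -
  have I: "I \<subseteq> J" "I \<noteq> {}" and cap: "odd_cap L I = 1" using assms by (auto simp: odds_def odd_cap_def)
  have "(\<Sum>j\<le>odd_cap L I. mterm (spread I j) 1) = 1 - mterm (spread I 1) (-1 :: real)"
    by (simp add: cap single_uminus)
  moreover have "cong_upto (spread J m)
    ((\<Prod>p\<in>primes. local_geo L (recip p) (dg p) I) * (1 - mterm (spread I 1) (-1)))
    ((\<Prod>p\<in>primes. local_geo L (recip p) (dg p) I) *
     (\<Prod>p\<in>primes. 1 - mterm (spread I (dg p)) ((-1) ^ dg p * recip p)))"
    by (intro cong_upto_mult cong_upto_sym[OF euler_product] I) simp
  moreover have "(\<Prod>p\<in>primes. local_geo L (recip p) (dg p) I) *
     (\<Prod>p\<in>primes. 1 - mterm (spread I (dg p)) ((-1) ^ dg p * recip p)) =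
     (\<Prod>p\<in>primes. 1 - mterm (spread I (dg p * Suc L)) (((-1) ^ dg p * recip p) ^ Suc L))"
    unfolding prod.distrib[symmetric] geometric_local[symmetric] by (simp only: mult.commute)
  moreover have "cong_upto (spread J m) \<dots> (\<Prod>p\<in>primes. 1)"
  proof (intro cong_upto_prod cong_upto_high I)
    fix p assume "p \<in> primes"
    hence "Suc L * 1 \<le> Suc L * dg p" using dg_pos by (intro mult_le_mono2) auto
    thus "m < dg p * Suc L" using assms(2) by (simp add: mult.commute)
  qed
  ultimately show ?thesis by (auto intro: cong_upto_trans)
qed

lemma numerator_factorization:
  assumes J: "finite J" and L: "L \<ge> m"
  shows "cong_upto (spread J m) (corrector J L * sol_series (index_sets J) (odd_cap L)) (numerator J)"
proof -
  let ?g = "\<lambda>I. \<Sum>j\<le>odd_cap L I. mterm (spread I j) (1::real)"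
  let ?e = "\<lambda>I. \<Prod>p\<in>primes. 1 - mterm (spread I (dg p)) (recip p)"
  let ?o = "\<lambda>I. \<Prod>p\<in>primes. local_geo L (recip p) (dg p) I"
  have "corrector J L = numerator J * ((\<Prod>I\<in>evens J. ?e I) * (\<Prod>I\<in>odds J. ?o I))"
    unfolding corrector_def local_factor_def numerator_def prod.distrib
    by (simp only: prod.swap[of _ primes])
  moreover have "sol_series (index_sets J) (odd_cap L) = (\<Prod>I\<in>odds J. ?g I) * (\<Prod>I\<in>evens J. ?g I)"
    unfolding sol_series_def using J odds_evens_disjoint by (intro prod.union_disjoint) auto
  ultimately have "corrector J L * sol_series (index_sets J) (odd_cap L) =
      numerator J * ((\<Prod>I\<in>evens J. ?e I * ?g I) * (\<Prod>I\<in>odds J. ?o I * ?g I))"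
    by (simp add: prod.distrib mult_ac)
  moreover have "cong_upto (spread J m) \<dots> (numerator J * ((\<Prod>I\<in>evens J. 1) * (\<Prod>I\<in>odds J. 1)))"
    by (intro cong_upto_mult cong_upto_prod cong_upto_refl even_part odd_part L)
  ultimately show ?thesis by simp
qed

subsection \<open>The moment\<close>

text \<open>
  A tuple \<open>S\<close> stands for the squarefree polynomials \<open>M\<^sub>i\<close> with sets of prime divisors \<open>S i\<close>; the second
  product is the reciprocal of \<open>q ^ deg (lcm (M\<^sub>i))\<close>.
\<close>

definition moment :: "'i set \<Rightarrow> real" where
  "moment J = (\<Sum>S\<in>(\<Pi>\<^sub>E i\<in>J. {S. S \<subseteq> primes \<and> size_of S = m}).
     (\<Prod>i\<in>J. (-1) ^ card (S i)) * (\<Prod>p\<in>(\<Union>i\<in>J. S i). recip p))"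

text \<open>
  A tuple \<open>(S i)\<close> of sets of primes is the same as a map that sends each prime \<open>p\<close> to the set of those
  \<open>i\<close> with \<open>p \<in> S i\<close>, that is, to a choice of one term in each factor of the numerator. The signs that come
  from the substitution of \<open>- x\<^sub>i\<close> multiply to \<open>(-1) ^ (m * card J) = 1\<close>.
\<close>

lemma mcoeff_numerator:
  fixes J :: "'i set"
  assumes J: "finite J" "even (card J)"
  shows "mcoeff (numerator J) (spread J m) = moment J"
proof -
  define w where "w p I = (if I = {} then 1 else recip p) * sgn_card I ^ (1 + dg p)" for p :: 'p and I :: "'i set"
  have num: "local_num J (recip p) (dg p) = (\<Sum>I\<in>Pow J. mterm (spread I (dg p)) (w p I))" for p
  proof -
    have "Pow J = insert {} (index_sets J)" by (auto simp: odds_def evens_def)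
    moreover have "{} \<notin> index_sets J" by (auto simp: odds_def evens_def)
    moreover have "spread ({} :: 'i set) n = 0" for n by (auto simp: spread_def)
    moreover have "(\<Sum>I\<in>index_sets J. mterm (spread I (dg p)) (recip p * sgn_card I ^ (1 + dg p))) =
        (\<Sum>I\<in>index_sets J. mterm (spread I (dg p)) (w p I))"
      by (intro sum.cong refl) (auto simp: w_def odds_def evens_def)
    ultimately show ?thesis using J by (simp add: local_num_def w_def sgn_card_def)
  qed
  define G where "G = {g \<in> (\<Pi>\<^sub>E p\<in>primes. Pow J). (\<Sum>p\<in>primes. spread (g p) (dg p)) = spread J m}"
  have finG: "finite (\<Pi>\<^sub>E p\<in>primes. Pow J)" using J finite_primes by (intro finite_PiE) auto
  have "numerator J = (\<Sum>g\<in>(\<Pi>\<^sub>E p\<in>primes. Pow J). mterm (\<Sum>p\<in>primes. spread (g p) (dg p)) (\<Prod>p\<in>primes. w p (g p)))"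
    unfolding numerator_def num using J finite_primes by (simp add: prod_sum_PiE prod_single)
  hence "mcoeff (numerator J) (spread J m) = (\<Sum>g\<in>G. \<Prod>p\<in>primes. w p (g p))"
    using finG by (simp add: lookup_sum lookup_single when_def G_def sum.If_cases Int_def)
  also have "\<dots> = moment J"
    unfolding moment_def
  proof (rule sum.reindex_bij_witness[of _ "\<lambda>S. \<lambda>p\<in>primes. {i \<in> J. p \<in> S i}" "\<lambda>g. \<lambda>i\<in>J. {p \<in> primes. i \<in> g p}"])
    fix g assume g: "g \<in> G"
    have gP: "g p \<subseteq> J" if "p \<in> primes" for p using g that by (auto simp: G_def)
    have "g \<in> extensional primes" using g by (simp add: G_def PiE_def)
    thus "(\<lambda>p\<in>primes. {i \<in> J. p \<in> (\<lambda>i\<in>J. {p \<in> primes. i \<in> g p}) i}) = g"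
      using gP by (auto simp: fun_eq_iff extensional_def)
    have size: "size_of {p \<in> primes. i \<in> g p} = m" if "i \<in> J" for i
    proof -
      have "size_of {p \<in> primes. i \<in> g p} = (\<Sum>p\<in>primes. spread (g p) (dg p)) i"
        using finite_primes by (simp add: sum_fun_apply spread_def size_of_def sum.If_cases Int_def)
      also have "(\<Sum>p\<in>primes. spread (g p) (dg p)) = spread J m" using g by (simp add: G_def)
      finally show ?thesis using that by (simp add: spread_def)
    qed
    thus "(\<lambda>i\<in>J. {p \<in> primes. i \<in> g p}) \<in> (\<Pi>\<^sub>E i\<in>J. {S. S \<subseteq> primes \<and> size_of S = m})" by auto
    have count: "(\<Sum>p\<in>primes. card (g p) * f p) = (\<Sum>i\<in>J. \<Sum>p | p \<in> primes \<and> i \<in> g p. f p)" for f :: "'p \<Rightarrow> nat"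
    proof -
      have "(\<Sum>p\<in>primes. card (g p) * f p) = (\<Sum>p\<in>primes. \<Sum>i\<in>J. if i \<in> g p then f p else 0)"
        using gP J by (intro sum.cong refl) (auto simp: sum.If_cases Int_absorb1)
      also have "\<dots> = (\<Sum>i\<in>J. \<Sum>p\<in>primes. if i \<in> g p then f p else 0)" by (rule sum.swap)
      finally show ?thesis using finite_primes by (simp add: sum.If_cases Int_def)
    qed
    have "(\<Prod>p\<in>primes. sgn_card (g p) ^ dg p) = (-1) ^ (\<Sum>p\<in>primes. card (g p) * dg p)"
      by (simp add: sgn_card_def power_sum power_mult)
    also have "(\<Sum>p\<in>primes. card (g p) * dg p) = (\<Sum>i\<in>J. m)"
      unfolding count using size by (simp add: size_of_def)
    finally have "(\<Prod>p\<in>primes. sgn_card (g p) ^ dg p) = 1" using J by simp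
    moreover have "(\<Prod>p\<in>primes. sgn_card (g p)) = (\<Prod>i\<in>J. (-1) ^ card {p \<in> primes. i \<in> g p})"
      using count[of "\<lambda>_. 1"] by (simp add: sgn_card_def flip: power_sum)
    moreover have "(\<Prod>p\<in>primes. if g p = {} then 1 else recip p) = (\<Prod>p\<in>(\<Union>i\<in>J. {p \<in> primes. i \<in> g p}). recip p)"
    proof -
      have "(\<Union>i\<in>J. {p \<in> primes. i \<in> g p}) = {p \<in> primes. g p \<noteq> {}}" using gP by blast
      thus ?thesis using finite_primes by (simp add: prod.If_cases Int_def)
    qed
    ultimately show "(\<Prod>i\<in>J. (-1) ^ card ((\<lambda>i\<in>J. {p \<in> primes. i \<in> g p}) i)) *
        (\<Prod>p\<in>(\<Union>i\<in>J. (\<lambda>i\<in>J. {p \<in> primes. i \<in> g p}) i). recip p) = (\<Prod>p\<in>primes. w p (g p))"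
      by (simp add: w_def prod.distrib)
  next
    fix S assume S: "S \<in> (\<Pi>\<^sub>E i\<in>J. {S. S \<subseteq> primes \<and> size_of S = m})"
    hence SP: "S i \<subseteq> primes" "size_of (S i) = m" if "i \<in> J" for i using that by auto
    have "S \<in> extensional J" using S by (simp add: PiE_def)
    thus "(\<lambda>i\<in>J. {p \<in> primes. i \<in> (\<lambda>p\<in>primes. {i \<in> J. p \<in> S i}) p}) = S"
      using SP(1) by (auto simp: fun_eq_iff extensional_def)
    have "(\<Sum>p\<in>primes. spread ((\<lambda>p\<in>primes. {i \<in> J. p \<in> S i}) p) (dg p)) i = spread J m i" for i
    proof (cases "i \<in> J")
      case True
      have "{p \<in> primes. p \<in> S i} = S i" using SP(1)[OF True] by auto
      thus ?thesis using True finite_primes SP(2)[OF True]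
        by (simp add: sum_fun_apply spread_def size_of_def sum.If_cases Int_def)
    qed (simp add: sum_fun_apply spread_def)
    thus "(\<lambda>p\<in>primes. {i \<in> J. p \<in> S i}) \<in> G" by (auto simp: G_def)
  qed
  finally show ?thesis .
qed

lemma moment_eq_mcoeff:
  assumes J: "finite J" "even (card J)" and L: "L \<ge> m"
  shows "moment J = mcoeff (corrector J L * sol_series (index_sets J) (odd_cap L)) (spread J m)"
  using numerator_factorization[OF J(1) L] mcoeff_numerator[OF J] by (simp add: cong_upto_def)

end

section \<open>Estimates for abstract moments\<close>

text \<open>
  Only the variables \<open>x\<^sub>i\<close> with \<open>i \<in> J\<close> occur. An exponent vector of such a polynomial that is not below
  \<open>spread J m\<close> therefore has total degree above \<open>m\<close>.
\<close>

definition supported :: "'i set \<Rightarrow> (('i \<Rightarrow> nat) \<Rightarrow>\<^sub>0 real) \<Rightarrow> bool" where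
  "supported J p \<longleftrightarrow> (\<forall>a\<in>mkeys p. \<forall>i. i \<notin> J \<longrightarrow> a i = 0)"

lemma supportedD: "supported J p \<Longrightarrow> a \<in> mkeys p \<Longrightarrow> i \<notin> J \<Longrightarrow> a i = 0"
  by (auto simp: supported_def)

lemma supported_add: "supported J p \<Longrightarrow> supported J r \<Longrightarrow> supported J (p + r)"
  using keys_add[of p r] by (auto simp: supported_def)

lemma supported_diff: "supported J p \<Longrightarrow> supported J r \<Longrightarrow> supported J (p - r)"
  using keys_diff[of p r] by (auto simp: supported_def)

lemma supported_mterm: "I \<subseteq> J \<Longrightarrow> supported J (mterm (spread I n) c)"
  by (auto simp: supported_def spread_def)

lemma supported_one: "supported J 1"
  by (auto simp: supported_def)

lemma supported_mult: "supported J p \<Longrightarrow> supported J r \<Longrightarrow> supported J (p * r)"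
  using keys_mult[of p r] by (fastforce simp: supported_def)

lemma supported_sum: "(\<And>x. x \<in> A \<Longrightarrow> supported J (f x)) \<Longrightarrow> supported J (\<Sum>x\<in>A. f x)"
proof (induction A rule: infinite_finite_induct)
  case (insert x A)
  thus ?case by (simp add: supported_add)
qed (auto simp: supported_def)

lemma supported_prod: "(\<And>x. x \<in> A \<Longrightarrow> supported J (f x)) \<Longrightarrow> supported J (\<Prod>x\<in>A. f x)"
  by (induction A rule: infinite_finite_induct) (auto intro: supported_mult supported_one)

lemma supported_local_factor: "supported J (local_factor J L c d)"
  unfolding local_factor_def local_num_def local_geo_def
  by (intro supported_mult supported_add supported_one supported_sum supported_prod supported_diff supported_mterm)
    (auto simp: odds_def evens_def)

lemma abs_mcoeff_mult_le:
  fixes D :: "'i \<Rightarrow> nat"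
  assumes "\<And>b. b \<le> D \<Longrightarrow> \<bar>mcoeff G b\<bar> \<le> M"
  shows "\<bar>mcoeff (p * G) D\<bar> \<le> pnorm (\<lambda>_. 1) p * M"
proof -
  have M: "M \<ge> 0" using assms[of D] by auto
  have "\<bar>mcoeff (p * G) D\<bar> \<le> (\<Sum>a\<in>mkeys p. \<bar>if a \<le> D then mcoeff p a * mcoeff G (D - a) else 0\<bar>)"
    unfolding lookup_mult_eq by (rule sum_abs)
  also have "\<dots> \<le> (\<Sum>a\<in>mkeys p. \<bar>mcoeff p a\<bar> * M)"
  proof (rule sum_mono)
    fix a
    have "\<bar>mcoeff G (D - a)\<bar> \<le> M" by (rule assms) (simp add: le_fun_def)
    thus "\<bar>if a \<le> D then mcoeff p a * mcoeff G (D - a) else 0\<bar> \<le> \<bar>mcoeff p a\<bar> * M"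
      using M by (auto simp: abs_mult intro: mult_left_mono)
  qed
  finally show ?thesis by (simp add: pnorm_def sum_distrib_right)
qed

lemma exp_minus_one_le:
  assumes "0 \<le> K" "q \<ge> (2::real)"
  shows "exp (6 * K / q) - 1 \<le> (6 * K * exp (3 * K)) / q"
proof -
  define x where "x = 6 * K / q"
  have x: "0 \<le> x" "x \<le> 3 * K"
    using assms frac_le[of "6 * K" "6 * K" 2 q] by (auto simp: x_def)
  have "1 - x \<le> exp (- x)" using exp_ge_add_one_self[of "- x"] by simp
  hence "(1 - x) * exp x \<le> exp (- x) * exp x" by (intro mult_right_mono) auto
  hence "exp x - 1 \<le> x * exp x" by (simp add: algebra_simps flip: exp_add)
  also have "\<dots> \<le> x * exp (3 * K)" using x by (intro mult_left_mono) auto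
  finally show ?thesis by (simp add: x_def)
qed

text \<open>
  The exponent \<open>E\<close> of the growth in \<open>m\<close>. For two indices the truncated difference is \<open>0\<close>, which is the
  correct exponent.
\<close>

definition excess :: "'i set \<Rightarrow> nat" where
  "excess J = card (evens J) - card J"

context prime_system
begin

abbreviation count :: "'i set \<Rightarrow> nat \<Rightarrow> ('i \<Rightarrow> nat) \<Rightarrow> real" where
  "count J L v \<equiv> real (card (sols (index_sets J) (odd_cap L) v))"

text \<open>
  The norm of the local factor at \<open>p\<close> minus \<open>1\<close> is at most \<open>K * t ^ (2 * dg p)\<close> with \<open>t = R ^ card J / q\<close>.
  The condition on \<open>R\<close> makes \<open>q * t\<^sup>2\<close> at most \<open>3 / 4\<close> for every \<open>q \<ge> 2\<close>, so the sum over all primes is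
  \<open>O(1 / q)\<close>.
\<close>

lemma pnorm_corrector:
  fixes J :: "'i set"
  assumes K: "norm_bound J K" "K > 0"
    and R: "R \<ge> 1" "(R ^ card J)\<^sup>2 \<le> 3 / 2" and L: "L \<ge> 1"
  shows "pnorm (wt J R) (corrector J L - 1) \<le> exp (6 * K / real q) - 1"
proof -
  interpret weight "wt J R" using R by (intro weight_wt) auto
  define \<rho> where "\<rho> = R ^ card J"
  have \<rho>: "\<rho> \<ge> 1" "\<rho>\<^sup>2 \<le> 3 / 2" using R by (auto simp: \<rho>_def)
  have q: "real q \<ge> 2" using q_ge_2 by simp
  define t where "t = \<rho> / real q"
  have t: "0 \<le> t" "t \<le> 3 / 4"
  proof -
    have "\<rho>\<^sup>2 \<le> (3 / 2)\<^sup>2" by (rule order_trans[OF \<rho>(2)]) (simp add: power2_eq_square)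
    hence "\<rho> \<le> 3 / 2" by (rule power2_le_imp_le) simp
    hence "\<rho> / real q \<le> (3 / 2) / 2" using q \<rho>(1) by (intro frac_le) auto
    thus "t \<le> 3 / 4" by (simp add: t_def)
  qed (use \<rho> in \<open>simp add: t_def\<close>)
  have qt: "real q * t\<^sup>2 \<le> 3 / 4" "4 * (real q * t\<^sup>2) \<le> 6 / real q"
  proof -
    have eq: "real q * t\<^sup>2 = \<rho>\<^sup>2 / real q" using q by (simp add: t_def power2_eq_square)
    have le: "\<rho>\<^sup>2 / real q \<le> (3 / 2) / real q" using \<rho> q by (intro divide_right_mono) auto
    also have "\<dots> \<le> (3 / 2) / 2" using q by (intro frac_le) auto
    finally show "real q * t\<^sup>2 \<le> 3 / 4" by (simp add: eq)
    show "4 * (real q * t\<^sup>2) \<le> 6 / real q" using mult_left_mono[OF le, of 4] by (simp add: eq)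
  qed
  have z: "recip p * (R ^ card J) ^ dg p = t ^ dg p" for p
    by (simp add: recip_def \<rho>_def t_def power_divide)
  have "pnorm (wt J R) (local_factor J L (recip p) (dg p) - 1) \<le> K * (t\<^sup>2) ^ dg p"
    if p: "p \<in> primes" for p
  proof -
    have "t ^ dg p \<le> t ^ 1" using t dg_pos[OF p] by (intro power_decreasing) auto
    also have "\<dots> \<le> 3 / 4" using t by simp
    finally have "pnorm (wt J R) (local_factor J L (recip p) (dg p) - 1) \<le> K * (t ^ dg p)\<^sup>2"
      using K(1)[unfolded norm_bound_def, rule_format, of R L "recip p" "dg p"] R(1) L recip_nonneg[of p] unfolding z by blast
    thus ?thesis by (simp add: mult.commute flip: power_mult)
  qed
  hence "(\<Sum>p\<in>primes. pnorm (wt J R) (local_factor J L (recip p) (dg p) - 1)) \<le>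
      (\<Sum>p\<in>primes. K * (t\<^sup>2) ^ dg p)" by (intro sum_mono)
  also have "\<dots> = K * (\<Sum>p\<in>primes. (t\<^sup>2) ^ dg p)" by (simp only: sum_distrib_left)
  also have "\<dots> \<le> K * (6 / real q)"
    using sum_primes_le[of "t\<^sup>2"] qt K(2) by (intro mult_left_mono) auto
  finally have "exp (\<Sum>p\<in>primes. pnorm (wt J R) (local_factor J L (recip p) (dg p) - 1)) \<le> exp (6 * K / real q)"
    by (simp add: mult.commute)
  thus ?thesis
    using pnorm_prod_minus_one[OF finite_primes, of "\<lambda>p. local_factor J L (recip p) (dg p)"]
    unfolding corrector_def by linarith
qed

lemma ev_corrector_ge:
  fixes J :: "'i set"
  assumes K: "\<And>L c d. L \<ge> 1 \<and> 0 \<le> c \<and> c \<le> 1 / 2 \<Longrightarrow>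
      exp (- K * c\<^sup>2) \<le> at_one (local_factor J L c d)" "K > 0" and L: "L \<ge> 1"
  shows "at_one (corrector J L) \<ge> exp (- 2 * K)"
proof -
  interpret weight "\<lambda>_::'i \<Rightarrow> nat. 1::real" by standard auto
  have "K * (\<Sum>p\<in>primes. (recip p)\<^sup>2) \<le> K * 2"
    using K(2) sum_recip_squared_le by (intro mult_left_mono) auto
  hence "exp (- 2 * K) \<le> exp (\<Sum>p\<in>primes. - K * (recip p)\<^sup>2)" by (simp add: sum_distrib_left sum_negf mult.commute)
  also have "\<dots> = (\<Prod>p\<in>primes. exp (- K * (recip p)\<^sup>2))" by (rule exp_sum[OF finite_primes])
  also have "\<dots> \<le> (\<Prod>p\<in>primes. at_one (local_factor J L (recip p) (dg p)))"
    using recip_nonneg recip_le_half L by (intro prod_mono conjI K(1)) auto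
  also have "\<dots> = at_one (corrector J L)" by (simp add: corrector_def ev_prod)
  finally show ?thesis .
qed

text \<open>
  The moment minus the count is the coefficient of \<open>\<Prod> x\<^sub>i ^ m\<close> in \<open>(H - 1) * G\<close>.
\<close>

lemma moment_close:
  fixes J :: "'i set"
  assumes J: "finite J" "even (card J)" and K: "norm_bound J K" "K > 0" and L: "L \<ge> m" "L \<ge> 1"
    and M: "\<And>b. b \<le> spread J m \<Longrightarrow> count J L b \<le> M"
  shows "\<bar>moment J - count J L (spread J m)\<bar> \<le> 6 * K * exp (3 * K) / real q * M"
proof -
  let ?G = "sol_series (index_sets J) (odd_cap L)"
  have co: "mcoeff ?G b = count J L b" for b using J by (intro mcoeff_sol_series) auto
  have "moment J - count J L (spread J m) = mcoeff ((corrector J L - 1) * ?G) (spread J m)"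
    by (simp add: moment_eq_mcoeff[OF J L(1)] left_diff_distrib lookup_minus co)
  also have "\<bar>\<dots>\<bar> \<le> pnorm (\<lambda>_. 1) (corrector J L - 1) * M"
    using M by (intro abs_mcoeff_mult_le) (simp add: co)
  also have "\<dots> \<le> 6 * K * exp (3 * K) / real q * M"
  proof (rule mult_right_mono)
    have "pnorm (wt J 1) (corrector J L - 1) \<le> exp (6 * K / real q) - 1"
      by (rule pnorm_corrector[OF K _ _ L(2)]) auto
    thus "pnorm (\<lambda>_. 1) (corrector J L - 1) \<le> 6 * K * exp (3 * K) / real q"
      using exp_minus_one_le[of K "real q"] K q_ge_2 by (simp add: wt_one)
    show "0 \<le> M" by (rule order_trans[OF _ M[OF order_refl]]) simp
  qed
  finally show ?thesis .
qed

text \<open>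
  The moment is the sum of \<open>h a * count (D - a)\<close> over \<open>a \<le> D = spread J m\<close>, where \<open>h a\<close> are the coefficients
  of \<open>H\<close>. Replacing \<open>count (D - a)\<close> by \<open>count D\<close> costs at most \<open>deg a * W\<close>, and so does adding the terms with
  \<open>a \<le> D\<close> false, since then \<open>deg a > m\<close>. Finally \<open>deg a \<le> R ^ deg a / (R - 1)\<close> by Bernoulli's inequality.
\<close>

lemma moment_asymptotic:
  fixes J :: "'i set"
  assumes J: "finite J" "even (card J)" and L: "L \<ge> m" and R: "R > 1"
    and W: "\<And>a. a \<le> spread J m \<Longrightarrow>
      \<bar>count J L (spread J m) - count J L (spread J m - a)\<bar> \<le> real (\<Sum>i\<in>J. a i) * W"
    and W': "count J L (spread J m) \<le> real (m + 1) * W"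
  shows "\<bar>moment J - at_one (corrector J L) * count J L (spread J m)\<bar> \<le>
    pnorm (wt J R) (corrector J L) * (W / (R - 1))"
proof -
  let ?G = "sol_series (index_sets J) (odd_cap L)" and ?D = "spread J m" and ?H = "corrector J L"
  have co: "mcoeff ?G b = count J L b" for b using J by (intro mcoeff_sol_series) auto
  have W0: "W \<ge> 0"
  proof -
    have "0 \<le> real (m + 1) * W" using W' by (rule order_trans[rotated]) simp
    thus ?thesis by (simp add: zero_le_mult_iff)
  qed
  let ?S = "\<Sum>a\<in>mkeys ?H. mcoeff ?H a * ((if a \<le> ?D then count J L (?D - a) else 0) - count J L ?D)"
  have eq: "moment J - at_one ?H * count J L ?D = ?S"
    unfolding moment_eq_mcoeff[OF J L] lookup_mult_eq ev_def sum_distrib_right sum_subtractf[symmetric]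
    by (intro sum.cong refl) (simp add: co right_diff_distrib)
  have "\<bar>?S\<bar> \<le> (\<Sum>a\<in>mkeys ?H. \<bar>mcoeff ?H a\<bar> * wt J R a * (W / (R - 1)))"
  proof (rule order_trans[OF sum_abs], rule sum_mono)
    fix a assume a: "a \<in> mkeys ?H"
    define s where "s = (\<Sum>i\<in>J. a i)"
    have "\<bar>(if a \<le> ?D then count J L (?D - a) else 0) - count J L ?D\<bar> \<le> real s * W"
    proof (cases "a \<le> ?D")
      case True
      thus ?thesis using W[OF True] by (simp add: s_def abs_minus_commute)
    next
      case False
      then obtain i where i: "\<not> a i \<le> ?D i" by (auto simp: le_fun_def)
      have "supported J ?H"
        unfolding corrector_def by (intro supported_prod supported_local_factor)
      from supportedD[OF this a, of i] have iJ: "i \<in> J" using i by (cases "i \<in> J") simp_all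
      hence "m + 1 \<le> a i" using i by (simp add: spread_def)
      also have "a i \<le> s" unfolding s_def using iJ J by (intro member_le_sum) auto
      finally have "real (m + 1) * W \<le> real s * W" using W0 by (intro mult_right_mono) auto
      thus ?thesis using False W' by simp
    qed
    also have "real s * W \<le> wt J R a * (W / (R - 1))"
    proof -
      have "1 + real s * (R - 1) \<le> (1 + (R - 1)) ^ s" using R by (intro Bernoulli_inequality) auto
      hence "real s * (R - 1) \<le> wt J R a" by (simp add: wt_def s_def)
      hence "(real s * (R - 1)) * (W / (R - 1)) \<le> wt J R a * (W / (R - 1))"
        using W0 R by (intro mult_right_mono) auto
      thus ?thesis using R by simp
    qed
    finally have le: "\<bar>(if a \<le> ?D then count J L (?D - a) else 0) - count J L ?D\<bar> \<le>
        wt J R a * (W / (R - 1))" .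
    show "\<bar>mcoeff ?H a * ((if a \<le> ?D then count J L (?D - a) else 0) - count J L ?D)\<bar> \<le>
        \<bar>mcoeff ?H a\<bar> * wt J R a * (W / (R - 1))"
      unfolding abs_mult mult.assoc by (rule mult_left_mono[OF le abs_ge_zero])
  qed
  also have "\<dots> = pnorm (wt J R) ?H * (W / (R - 1))" by (simp only: pnorm_def sum_distrib_right)
  finally show ?thesis unfolding eq .
qed

text \<open>
  The cap \<open>m + 2\<close> leaves room for the right-hand sides \<open>m + 1\<close> that occur in \<open>card_sols_diff_step\<close>.
\<close>

definition diagonal :: "'i set \<Rightarrow> real" where
  "diagonal J = count J (m + 2) (spread J m)"

text \<open>
  What the generating function yields for one system of primes; \<open>C\<close>, \<open>C\<^sub>0\<close>, \<open>C\<^sub>1\<close>, \<open>C\<^sub>2\<close>, \<open>m\<^sub>0\<close> are going to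
  depend on \<open>J\<close> only. The last clause comes from the slow variation of the counts, which fails for two
  indices, where \<open>excess J = 0\<close>.
\<close>

definition well_estimated :: "'i set \<Rightarrow> real \<Rightarrow> real \<Rightarrow> real \<Rightarrow> real \<Rightarrow> nat \<Rightarrow> bool" where
  "well_estimated J C C\<^sub>0 C\<^sub>1 C\<^sub>2 m\<^sub>0 \<longleftrightarrow>
     C\<^sub>1 * real (m + 1) ^ excess J \<le> diagonal J \<and> diagonal J \<le> C\<^sub>2 * real (m + 1) ^ excess J \<and>
     \<bar>moment J - diagonal J\<bar> \<le> C / real q * diagonal J \<and>
     (m \<ge> m\<^sub>0 \<and> excess J > 0 \<longrightarrow> C\<^sub>0 * real (m + 1) ^ excess J \<le> moment J)"

end

text \<open>
  All counts are between \<open>0\<close> and \<open>4\<close>, and the one on the diagonal is positive.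
\<close>

lemma moment_estimate_two:
  fixes J :: "'i set"
  assumes J: "card J = 2"
  shows "\<exists>C>0. \<exists>C\<^sub>0>0. \<exists>C\<^sub>1>0. \<exists>C\<^sub>2>0. \<exists>m\<^sub>0. \<forall>(primes :: 'p set) dg q m.
    prime_system primes dg q m \<longrightarrow> prime_system.well_estimated primes dg q m J C C\<^sub>0 C\<^sub>1 C\<^sub>2 m\<^sub>0"
proof -
  have finJ: "finite J" and J0: "J \<noteq> {}" using J card.infinite by fastforce+
  have E0: "excess J = 0" using card_evens[OF finJ J0] J by (simp add: excess_def)
  obtain K where K: "K > 0" and KL: "norm_bound J K"
    using pnorm_local_factor[OF finJ] by blast
  define C where "C = 6 * K * exp (3 * K) * 4"
  have C: "C > 0" using K by (simp add: C_def)
  have "prime_system.well_estimated primes dg q m J C 1 1 4 0"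
    if ps: "prime_system primes dg q m" for primes :: "'p set" and dg q m
  proof -
    interpret prime_system primes dg q m by (rule ps)
    have q: "real q \<ge> 2" using q_ge_2 by simp
    have up: "count J (m + 2) b \<le> 4" if "b \<le> spread J m" for b
    proof -
      have "b i \<le> m" if "i \<in> J" for i using le_funD[OF \<open>b \<le> spread J m\<close>, of i] that by (simp add: spread_def)
      from card_sols_le_two[where v = b and M = m and L = "m + 2", OF J this] show ?thesis by linarith
    qed
    have "card (sols (index_sets J) (odd_cap (m + 2)) (spread J m)) \<noteq> 0"
    proof
      assume "card (sols (index_sets J) (odd_cap (m + 2)) (spread J m)) = 0"
      thus False using card_sols_ge[of J m "m + 2"] finJ J0 J by simp
    qed
    hence c1: "1 \<le> diagonal J" by (simp add: diagonal_def)
    have "\<bar>moment J - diagonal J\<bar> \<le> 6 * K * exp (3 * K) / real q * 4"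
      unfolding diagonal_def by (rule moment_close[OF finJ _ KL K]) (use J up in auto)
    also have "\<dots> = C / real q * 1" by (simp add: C_def)
    also have "\<dots> \<le> C / real q * diagonal J" using c1 C q by (intro mult_left_mono) auto
    finally show ?thesis using c1 up[of "spread J m"] unfolding well_estimated_def diagonal_def E0 by simp
  qed
  note main = this
  show ?thesis
    by (rule exI[of _ C], rule conjI[OF C], rule exI[of _ 1], rule conjI[OF zero_less_one],
        rule exI[of _ 1], rule conjI[OF zero_less_one], rule exI[of _ 4], rule conjI, simp, rule exI,
        intro allI impI, rule main)
qed

lemma evens_large:
  assumes "card J \<ge> 4" "finite J"
  shows "card (evens J) \<ge> card J + 1"
proof -
  have ge: "2 ^ (n + 3) \<ge> n + 4 + 2" for n :: nat
  proof (induction n)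
    case (Suc n)
    have "(2::nat) ^ (Suc n + 3) = 2 * 2 ^ (n + 3)" by (simp only: add_Suc power_Suc)
    thus ?case using Suc by linarith
  qed simp
  obtain n where n: "card J = n + 4" using assms(1) by (metis add.commute le_Suc_ex)
  have "J \<noteq> {}" "card J - 1 = n + 3" using assms n by auto
  hence "card (evens J) = 2 ^ (n + 3) - 1" using card_evens[OF assms(2)] by simp
  thus ?thesis using ge[of n] n by linarith
qed

text \<open>
  The radius \<open>R > 1\<close> with \<open>R ^ (2 * card J) = 3 / 2\<close> is the largest one to which \<open>pnorm_corrector\<close>
  applies; it is independent of \<open>q\<close>, and so are all constants. For the lower bound, the main term is at
  least \<open>\<delta> * (m + 1) ^ E\<close> and the error at most \<open>A * (m + 1) ^ (E - 1)\<close>, whence the threshold \<open>2 * A / \<delta>\<close>.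
\<close>

lemma moment_estimate:
  fixes J :: "'i set"
  assumes J: "finite J" "even (card J)" "card J \<ge> 4"
  shows "\<exists>C>0. \<exists>C\<^sub>0>0. \<exists>C\<^sub>1>0. \<exists>C\<^sub>2>0. \<exists>m\<^sub>0. \<forall>(primes :: 'p set) dg q m.
    prime_system primes dg q m \<longrightarrow> prime_system.well_estimated primes dg q m J C C\<^sub>0 C\<^sub>1 C\<^sub>2 m\<^sub>0"
proof -
  have J0: "J \<noteq> {}" using J by auto
  define e where "e = card (evens J)"
  define E where "E = excess J"
  have e: "e \<ge> card J + 1" using evens_large[OF J(3,1)] by (simp add: e_def)
  hence E: "e = E + card J" "E \<ge> 1" "e - 1 - card J = E - 1" by (simp_all add: E_def excess_def e_def)
  obtain K where K: "K > 0" and KL: "norm_bound J K"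
    using pnorm_local_factor[OF J(1)] by blast
  obtain K' where K': "K' > 0" and KE: "\<And>L c d. L \<ge> 1 \<and> 0 \<le> c \<and> c \<le> 1 / 2 \<Longrightarrow>
      exp (- K' * c\<^sup>2) \<le> at_one (local_factor J L c d)"
    using ev_local_factor_ge_exp[OF J(1) J0] by blast
  define R where "R = root (2 * card J) (3 / 2)"
  have "card J > 0" using J by simp
  hence R: "R > 1" "R ^ (2 * card J) = 3 / 2"
    by (auto simp: R_def real_root_pow_pos2)
  have R2: "(R ^ card J)\<^sup>2 \<le> 3 / 2" using R(2) by (simp add: mult.commute flip: power_mult)
  define U where "U = (2::real) ^ card (odds J)"
  define \<kappa> where "\<kappa> = 1 / real e ^ e"
  define C where "C = 6 * K * exp (3 * K) * U / \<kappa>"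
  define A where "A = 2 * U * exp (3 * K) / (R - 1) * 2 ^ (E - 1)"
  define \<delta> where "\<delta> = exp (- 2 * K') * \<kappa>"
  have e0: "real e > 0" using e by simp
  have pos: "U > 0" "\<kappa> > 0" "C > 0" "A > 0" "\<delta> > 0"
    using K R e0 by (simp_all add: U_def \<kappa>_def C_def A_def \<delta>_def)
  have "prime_system.well_estimated primes dg q m J C (\<delta> / 2) \<kappa> U (nat \<lceil>2 * A / \<delta>\<rceil>)"
    if ps: "prime_system primes dg q m" for primes :: "'p set" and dg q m
  proof -
    interpret prime_system primes dg q m by (rule ps)
    define c where "c = diagonal J"
    have c: "c = count J (m + 2) (spread J m)" by (simp add: c_def diagonal_def)
    have q: "real q \<ge> 2" using q_ge_2 by simp
    define n where "n = real (m + 1)"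
    have n: "n \<ge> 1" by (simp add: n_def)
    have up: "count J (m + 2) b \<le> U * n ^ E" if b: "b \<le> spread J m" for b
    proof -
      obtain a where a: "a \<in> J" using J0 by auto
      have "card (J - {a}) \<ge> 2" using J a by simp
      then obtain x z where xz: "x \<in> J - {a}" "z \<in> J - {a}" "x \<noteq> z" by (rule two_elements)
      have "b i \<le> m" if "i \<in> J" for i using le_funD[OF b, of i] that by (simp add: spread_def)
      moreover have "pivots a x z J \<subseteq> evens J"
        using a xz by (auto simp: pivots_def evens_def)
      ultimately show ?thesis
        using card_sols_le_power[OF J(1) a, of x z "odds J" "evens J" b m "m + 2"] xz
        unfolding U_def n_def E_def excess_def by blast
    qed
    have low: "\<kappa> * n ^ E \<le> c"
    proof -
      have "real ((m + 1) ^ e) \<le> real (e ^ e * ((m + 1) ^ card J *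
          card (sols (index_sets J) (odd_cap (m + 2)) (spread J m))))"
        using card_sols_ge[OF J(1) J0 J(2), of m "m + 2"] unfolding e_def by (intro of_nat_mono) simp
      hence "n ^ card J * n ^ E \<le> n ^ card J * (real e ^ e * c)"
        by (simp add: c n_def E(1) power_add mult_ac)
      hence "n ^ E \<le> real e ^ e * c" using n by (simp add: mult_le_cancel_left_pos)
      thus ?thesis using e0 by (simp add: \<kappa>_def field_simps)
    qed
    have close: "\<bar>moment J - c\<bar> \<le> C / real q * c"
    proof -
      have "\<bar>moment J - c\<bar> \<le> 6 * K * exp (3 * K) / real q * (U * n ^ E)"
        unfolding c by (rule moment_close[OF J(1,2) KL K]) (use up in auto)
      also have "n ^ E \<le> c / \<kappa>" using low pos by (simp add: field_simps)
      hence "(6 * K * exp (3 * K)) / real q * (U * n ^ E) \<le> (6 * K * exp (3 * K)) / real q * (U * (c / \<kappa>))"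
        using K pos q by (intro mult_left_mono) auto
      finally show ?thesis by (simp add: C_def mult_ac)
    qed
    have "\<delta> / 2 * n ^ E \<le> moment J" if m: "m \<ge> nat \<lceil>2 * A / \<delta>\<rceil>"
    proof -
      interpret w: weight "wt J R" using R by (intro weight_wt) auto
      define W where "W = 2 * (U * real (m + 2) ^ (E - 1))"
      have asym: "\<bar>moment J - at_one (corrector J (m + 2)) * count J (m + 2) (spread J m)\<bar> \<le>
          pnorm (wt J R) (corrector J (m + 2)) * (W / (R - 1))"
      proof (rule moment_asymptotic[OF J(1,2) _ R(1)])
        fix a :: "'i \<Rightarrow> nat" assume "a \<le> spread J m"
        thus "\<bar>count J (m + 2) (spread J m) - count J (m + 2) (spread J m - a)\<bar> \<le> real (\<Sum>i\<in>J. a i) * W"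
          using card_sols_diff[OF J(1,3), of a m "m + 2"] E(3) unfolding W_def U_def e_def by simp
      next
        have "U * n ^ E = n * (U * n ^ (E - 1))" using E(2) by (cases E) auto
        also have "\<dots> \<le> n * W"
        proof (intro mult_left_mono)
          have "U * n ^ (E - 1) \<le> U * real (m + 2) ^ (E - 1)"
            using pos by (intro mult_left_mono power_mono) (auto simp: n_def)
          moreover have "0 \<le> U * real (m + 2) ^ (E - 1)" using pos by simp
          ultimately show "U * n ^ (E - 1) \<le> W" unfolding W_def by linarith
        qed (use n in simp)
        finally show "count J (m + 2) (spread J m) \<le> real (m + 1) * W"
          using up[of "spread J m"] by (simp add: n_def)
      qed simp
      have "pnorm (wt J R) (corrector J (m + 2)) \<le> exp (3 * K)"
      proof -
        have "pnorm (wt J R) (corrector J (m + 2)) \<le> 1 + pnorm (wt J R) (corrector J (m + 2) - 1)"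
          using w.pnorm_triangle[of 1 "corrector J (m + 2) - 1"] by (simp add: w.pnorm_one)
        also have "\<dots> \<le> exp (6 * K / real q)" using pnorm_corrector[OF KL K _ R2, of "m + 2"] R(1) by simp
        also have "\<dots> \<le> exp (3 * K)" using q K frac_le[of "6 * K" "6 * K" 2 "real q"] by simp
        finally show ?thesis .
      qed
      hence "pnorm (wt J R) (corrector J (m + 2)) * (W / (R - 1)) \<le> exp (3 * K) * (W / (R - 1))"
        using R pos by (intro mult_right_mono) (auto simp: W_def)
      also have "\<dots> \<le> A * n ^ (E - 1)"
      proof -
        have "real (m + 2) ^ (E - 1) \<le> (2 * n) ^ (E - 1)" by (intro power_mono) (auto simp: n_def)
        hence "2 * U * exp (3 * K) / (R - 1) * real (m + 2) ^ (E - 1) \<le>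
            2 * U * exp (3 * K) / (R - 1) * (2 * n) ^ (E - 1)"
          using R pos by (intro mult_left_mono) auto
        thus ?thesis by (simp add: A_def W_def power_mult_distrib mult_ac)
      qed
      also have "\<dots> \<le> \<delta> / 2 * n ^ E"
      proof -
        have "2 * A / \<delta> \<le> n" using m by (simp add: n_def)
        hence "A \<le> \<delta> / 2 * n" using pos by (simp add: field_simps)
        hence "A * n ^ (E - 1) \<le> \<delta> / 2 * n * n ^ (E - 1)" using n by (intro mult_right_mono) auto
        moreover have "n * n ^ (E - 1) = n ^ E" using E(2) by (cases E) auto
        ultimately show ?thesis by (simp add: mult.assoc)
      qed
      finally have "at_one (corrector J (m + 2)) * c - \<delta> / 2 * n ^ E \<le> moment J"
        using asym unfolding c by linarith
      moreover have "\<delta> * n ^ E \<le> at_one (corrector J (m + 2)) * c"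
      proof -
        have "exp (- 2 * K') \<le> at_one (corrector J (m + 2))"
          by (rule ev_corrector_ge[OF KE K']) auto
        moreover from this have "0 \<le> at_one (corrector J (m + 2))"
          by (rule order_trans[rotated]) simp
        ultimately have "exp (- 2 * K') * (\<kappa> * n ^ E) \<le> at_one (corrector J (m + 2)) * c"
          using low pos n by (intro mult_mono) auto
        thus ?thesis by (simp add: \<delta>_def mult.assoc)
      qed
      ultimately show ?thesis by (simp add: field_simps)
    qed
    thus ?thesis
      using low up[of "spread J m"] close
      unfolding well_estimated_def E_def[symmetric] c_def[symmetric] n_def[symmetric] c[symmetric] by simp
  qed
  note main = this
  have \<delta>2: "\<delta> / 2 > 0" using pos by simp
  show ?thesis
    by (rule exI[of _ C], rule conjI[OF pos(3)], rule exI[of _ "\<delta> / 2"], rule conjI[OF \<delta>2],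
        rule exI[of _ \<kappa>], rule conjI[OF pos(2)], rule exI[of _ U], rule conjI[OF pos(1)], rule exI,
        intro allI impI, rule main)
qed

section \<open>A lower bound for the second moment\<close>

context prime_system
begin

text \<open>
  The number of squarefree monic polynomials of degree \<open>j\<close>, divided by \<open>q ^ j\<close>.
\<close>

definition density :: "nat \<Rightarrow> real" where
  "density j = (\<Sum>S | S \<subseteq> primes \<and> size_of S = j. \<Prod>p\<in>S. recip p)"

text \<open>
  With the Euler products \<open>\<Prod>(1 + u ^ dg p / q ^ dg p)\<close>, the generating function of the densities, and
  \<open>\<Prod>(1 - u ^ dg p / q ^ dg p) = 1 - u\<close>, one has \<open>(1 - u) * (\<Sum>j. density j * u ^ j) = 1 - u\<^sup>2 / q\<close>, up to
  degree \<open>m\<close>. The single variable is modelled by the index type \<open>unit\<close>.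
\<close>

lemma density_step:
  assumes "j \<le> m"
  shows "density j - (if j \<ge> 1 then density (j - 1) else 0) =
    (if j = 0 then 1 else if j = 2 then - 1 / real q else 0)"
proof -
  define I where "I = {()}"
  have I: "I \<subseteq> I" "I \<noteq> {}" by (auto simp: I_def)
  define E where "E = (\<Prod>p\<in>primes. 1 - mterm (spread I (dg p)) (recip p))"
  define Q where "Q = (\<Prod>p\<in>primes. 1 + mterm (spread I (dg p)) (recip p))"
  have Q: "mcoeff Q (spread I i) = density i" for i
  proof -
    have "Q = (\<Sum>S\<in>Pow primes. mterm (spread I (size_of S)) (\<Prod>p\<in>S. recip p))"
      by (simp add: Q_def prod_one_plus_mterm finite_primes sum_spread size_of_def)
    thus ?thesis
      using mcoeff_sum_spread[of "Pow primes" I size_of] finite_primes I by (simp add: density_def)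
  qed
  have "E * Q = (\<Prod>p\<in>primes. 1 + mterm (spread I (2 * dg p)) (- (recip p)\<^sup>2))"
    unfolding E_def Q_def prod.distrib[symmetric]
  proof (intro prod.cong refl)
    fix p
    define t where "t = mterm (spread I (dg p)) (recip p)"
    have "(1 - t) * (1 + t) = 1 - t * t" by (simp add: algebra_simps)
    moreover have "t * t = mterm (spread I (2 * dg p)) ((recip p)\<^sup>2)"
      by (simp add: t_def mult_single spread_add mult_2 power2_eq_square)
    ultimately show "(1 - mterm (spread I (dg p)) (recip p)) * (1 + mterm (spread I (dg p)) (recip p)) =
        1 + mterm (spread I (2 * dg p)) (- (recip p)\<^sup>2)"
      by (simp add: t_def single_uminus)
  qed
  also have "\<dots> = (\<Sum>S\<in>Pow primes. mterm (spread I (2 * size_of S)) (\<Prod>p\<in>S. - (recip p)\<^sup>2))"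
    by (simp add: prod_one_plus_mterm finite_primes sum_spread size_of_def sum_distrib_left)
  also have "\<dots> = (\<Sum>S\<in>Pow primes. mterm (spread I (2 * size_of S)) ((-1) ^ card S * (1 / real q ^ size_of S)\<^sup>2))"
    by (simp only: prod_uminus prod_power_distrib[symmetric] prod_recip)
  finally have EQ: "mcoeff (E * Q) (spread I i) =
      (\<Sum>S | S \<subseteq> primes \<and> 2 * size_of S = i. (-1) ^ card S * (1 / real q ^ size_of S)\<^sup>2)" for i
    using mcoeff_sum_spread[of "Pow primes" I "\<lambda>S. 2 * size_of S"] finite_primes I by simp
  have "cong_upto (spread I m) (E * Q) ((1 - mterm (spread I 1) 1) * Q)"
    using cong_upto_mult[OF euler_product[OF I, of 1] cong_upto_refl[of _ Q]] by (simp add: E_def)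
  moreover have "spread I j \<le> spread I m" using assms by (simp add: spread_def le_fun_def)
  ultimately have "mcoeff ((1 - mterm (spread I 1) 1) * Q) (spread I j) = mcoeff (E * Q) (spread I j)"
    by (simp add: cong_upto_def)
  moreover have "mcoeff ((1 - mterm (spread I 1) 1) * Q) (spread I j) =
      density j - (if j \<ge> 1 then density (j - 1) else 0)"
  proof -
    have "spread I 1 \<le> spread I j \<longleftrightarrow> j \<ge> 1" by (auto simp: I_def spread_def le_fun_def)
    moreover have "spread I j - spread I 1 = spread I (j - 1)" by (auto simp: spread_def fun_eq_iff)
    ultimately show ?thesis by (simp add: left_diff_distrib lookup_minus lookup_single_mult Q)
  qed
  moreover have "mcoeff (E * Q) (spread I j) = (if j = 0 then 1 else if j = 2 then - 1 / real q else 0)"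
  proof (cases "even j")
    case True
    then obtain i where i: "j = 2 * i" by blast
    have "mcoeff (E * Q) (spread I j) =
        (\<Sum>S | S \<subseteq> primes \<and> size_of S = i. (-1) ^ card S) * (1 / real q ^ i)\<^sup>2"
      unfolding EQ sum_distrib_right i by (intro sum.cong) auto
    also have "\<dots> = (if i = 0 then 1 else if i = 1 then - 1 / real q else 0)"
      using assms q_ge_2 i by (subst sum_moebius') (auto simp: power2_eq_square)
    finally show ?thesis by (simp add: i)
  next
    case False
    hence none: "{S. S \<subseteq> primes \<and> 2 * size_of S = j} = {}" by auto
    show ?thesis unfolding EQ none using False by (auto intro: odd_pos)
  qed
  ultimately show ?thesis by simp
qed

lemma density_eq: "j \<le> m \<Longrightarrow> density j = (if j \<le> 1 then 1 else 1 - 1 / real q)"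
proof (induction j)
  case 0
  thus ?case using density_step[of 0] by simp
next
  case (Suc j)
  thus ?case using density_step[of "Suc j"] by (cases "j = 0"; cases "j = 1") auto
qed

lemma density_ge_half: "j \<le> m \<Longrightarrow> density j \<ge> 1 / 2"
  using q_ge_2 by (auto simp: density_eq field_simps)

lemma density_le_one: "j \<le> m \<Longrightarrow> density j \<le> 1"
  using q_ge_2 by (auto simp: density_eq)

text \<open>
  As \<open>1 / q ^ dg p \<le> 1 / 2\<close>, the product of the \<open>1 - 1 / q ^ dg p\<close> is at least \<open>exp (- 2 * s)\<close>, where \<open>s\<close> is
  the sum of the \<open>1 / q ^ dg p\<close>. By convexity \<open>exp (- 2 * s)\<close> lies above its tangent
  \<open>exp (- 8) * (1 + 8 - 2 * s)\<close> at \<open>s = 4\<close>. On average over the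
  squarefree polynomials the tangent can be evaluated: each prime contributes at most \<open>1 / q ^ (2 * dg p)\<close>
  to the sum of \<open>s\<close>, which is therefore at most \<open>2\<close>, while the total weight is at least \<open>1 / 2\<close>. The
  point of tangency is chosen such that \<open>9 / 2 - 2 * 2 > 0\<close>.
\<close>

lemma density_shrunk_ge:
  "(\<Sum>S | S \<subseteq> primes \<and> size_of S = m. (\<Prod>p\<in>S. recip p) * (\<Prod>p\<in>S. 1 - recip p)) \<ge> exp (- 8) / 2"
proof -
  let ?A = "{S. S \<subseteq> primes \<and> size_of S = m}"
  have finA: "finite ?A" by (rule finite_Pow_primes)
  have finS: "finite S" if "S \<in> ?A" for S using that finite_primes finite_subset by auto
  define s where "s S = (\<Sum>p\<in>S. recip p)" for S
  have low: "exp (- 8) * (1 + 8 - 2 * s S) \<le> (\<Prod>p\<in>S. 1 - recip p)" if S: "S \<in> ?A" for S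
  proof -
    have "1 + (8 - 2 * s S) \<le> exp (8 - 2 * s S)" by (rule exp_ge_add_one_self)
    hence "exp (- 8) * (1 + 8 - 2 * s S) \<le> exp (- 8) * exp (8 - 2 * s S)" by (intro mult_left_mono) auto
    also have "\<dots> = exp (\<Sum>p\<in>S. - (2 * recip p))" by (simp add: s_def sum_negf sum_distrib_left flip: exp_add)
    also have "\<dots> = (\<Prod>p\<in>S. exp (- (2 * recip p)))" by (rule exp_sum[OF finS[OF S]])
    also have "\<dots> \<le> (\<Prod>p\<in>S. 1 - recip p)"
      using S recip_nonneg recip_le_half by (intro prod_mono conjI exp_le_one_minus) auto
    finally show ?thesis .
  qed
  have "(\<Sum>S\<in>?A. (\<Prod>p\<in>S. recip p) * s S) = (\<Sum>S\<in>?A. \<Sum>p\<in>primes. if p \<in> S then (\<Prod>r\<in>S. recip r) * recip p else 0)"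
    using finite_primes
    by (intro sum.cong refl) (auto simp: s_def sum_distrib_left sum.If_cases Int_absorb1)
  also have "\<dots> = (\<Sum>p\<in>primes. \<Sum>S\<in>?A. if p \<in> S then (\<Prod>r\<in>S. recip r) * recip p else 0)" by (rule sum.swap)
  also have "\<dots> \<le> (\<Sum>p\<in>primes. (recip p)\<^sup>2)"
  proof (rule sum_mono)
    fix p assume p: "p \<in> primes"
    have "(\<Sum>S\<in>?A. if p \<in> S then (\<Prod>r\<in>S. recip r) * recip p else 0) = (\<Sum>S | S \<in> ?A \<and> p \<in> S. (\<Prod>r\<in>S. recip r) * recip p)"
      using finA by (simp add: sum.If_cases Int_def)
    also have "\<dots> = (\<Sum>S | S \<in> ?A \<and> p \<in> S. (recip p)\<^sup>2 * (\<Prod>r\<in>S - {p}. recip r))"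
      using finS by (intro sum.cong refl) (auto simp: power2_eq_square prod.remove mult_ac)
    also have "\<dots> = (\<Sum>T\<in>(\<lambda>S. S - {p}) ` {S. S \<in> ?A \<and> p \<in> S}. (recip p)\<^sup>2 * (\<Prod>r\<in>T. recip r))"
      by (subst sum.reindex) (auto simp: inj_on_def)
    also have "\<dots> \<le> (\<Sum>T | T \<subseteq> primes \<and> size_of T = m - dg p. (recip p)\<^sup>2 * (\<Prod>r\<in>T. recip r))"
    proof (rule sum_mono2)
      show "(\<lambda>S. S - {p}) ` {S. S \<in> ?A \<and> p \<in> S} \<subseteq> {T. T \<subseteq> primes \<and> size_of T = m - dg p}"
      proof (rule image_subsetI)
        fix S assume S: "S \<in> {S. S \<in> ?A \<and> p \<in> S}"
        hence "finite S" "p \<in> S" and Sm: "size_of S = m" using finS[of S] by simp_all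
        hence "size_of S = dg p + size_of (S - {p})" unfolding size_of_def by (intro sum.remove)
        hence "size_of (S - {p}) = m - dg p" using Sm by linarith
        thus "S - {p} \<in> {T. T \<subseteq> primes \<and> size_of T = m - dg p}" using S by auto
      qed
    qed (use finite_Pow_primes recip_nonneg in \<open>auto intro!: mult_nonneg_nonneg prod_nonneg\<close>)
    also have "\<dots> = (recip p)\<^sup>2 * density (m - dg p)" by (simp add: density_def sum_distrib_left)
    also have "\<dots> \<le> (recip p)\<^sup>2 * 1" by (intro mult_left_mono density_le_one) auto
    finally show "(\<Sum>S\<in>?A. if p \<in> S then (\<Prod>r\<in>S. recip r) * recip p else 0) \<le> (recip p)\<^sup>2" by simp
  qed
  also have "\<dots> \<le> 2" by (rule sum_recip_squared_le)
  finally have V: "(\<Sum>S\<in>?A. (\<Prod>p\<in>S. recip p) * s S) \<le> 2" .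
  have "exp (- 8) * (1 / 2) \<le> exp (- 8) * (9 * density m - 2 * (\<Sum>S\<in>?A. (\<Prod>p\<in>S. recip p) * s S))"
    using V density_ge_half[of m] by (intro mult_left_mono) auto
  also have "\<dots> = (\<Sum>S\<in>?A. (\<Prod>p\<in>S. recip p) * (exp (- 8) * (1 + 8 - 2 * s S)))"
    by (simp add: density_def sum_distrib_left sum_subtractf[symmetric] algebra_simps)
  also have "\<dots> \<le> (\<Sum>S\<in>?A. (\<Prod>p\<in>S. recip p) * (\<Prod>p\<in>S. 1 - recip p))"
    using low recip_nonneg by (intro sum_mono mult_left_mono prod_nonneg) auto
  finally show ?thesis by simp
qed

text \<open>
  Selberg's diagonalization. With \<open>f U = (\<Prod>p\<in>U. q ^ dg p - 1)\<close>, the analogue of Euler's function, the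
  density of the least common multiple is the product of both densities times \<open>(\<Sum>U\<subseteq>S \<inter> T. f U)\<close>. So the
  quadratic form is a sum of squares with nonnegative weights \<open>f U\<close>, and keeping only the sets \<open>U\<close> of full
  size \<open>m\<close>, for which the square has a single term, leaves the sum of \<open>density_shrunk_ge\<close>.
\<close>

lemma second_moment_ge:
  "(\<Sum>S | S \<subseteq> primes \<and> size_of S = m. \<Sum>T | T \<subseteq> primes \<and> size_of T = m.
      (-1) ^ card S * (-1) ^ card T * (\<Prod>p\<in>S \<union> T. recip p)) \<ge> exp (- 8) / 2"
proof -
  let ?A = "{S. S \<subseteq> primes \<and> size_of S = m}"
  have finA: "finite ?A" by (rule finite_Pow_primes)
  have finS: "finite S" if "S \<subseteq> primes" for S using that finite_primes finite_subset by auto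
  define f where "f U = (\<Prod>p\<in>U. 1 / recip p - 1)" for U
  define c where "c S = (-1) ^ card S * (\<Prod>p\<in>S. recip p)" for S
  have f_nonneg: "f U \<ge> 0" if "U \<subseteq> primes" for U
  proof -
    have "0 \<le> 1 / recip p - 1" if "p \<in> U" for p
      using recip_pos[of p] recip_le_half[of p] that \<open>U \<subseteq> primes\<close> by (auto simp: field_simps)
    thus ?thesis by (auto simp: f_def intro: prod_nonneg)
  qed
  have term_eq: "(-1) ^ card S * (-1) ^ card T * (\<Prod>p\<in>S \<union> T. recip p) =
      (\<Sum>U\<in>Pow primes. f U * ((if U \<subseteq> S then c S else 0) * (if U \<subseteq> T then c T else 0)))"
    if ST: "S \<subseteq> primes" "T \<subseteq> primes" for S T
  proof -
    have "(\<Prod>p\<in>S \<union> T. recip p) * (\<Prod>p\<in>S \<inter> T. recip p) = (\<Prod>p\<in>S. recip p) * (\<Prod>p\<in>T. recip p)"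
      using prod.union_inter[OF finS[OF ST(1)] finS[OF ST(2)]] .
    moreover have "(\<Prod>p\<in>S \<inter> T. recip p) \<noteq> 0" by (simp add: prod_recip q_ge_2) (use q_ge_2 in simp)
    ultimately have "(\<Prod>p\<in>S \<union> T. recip p) = (\<Prod>p\<in>S. recip p) * (\<Prod>p\<in>T. recip p) * (\<Prod>p\<in>S \<inter> T. 1 / recip p)"
      by (simp add: prod_dividef field_simps)
    also have "(\<Prod>p\<in>S \<inter> T. 1 / recip p) = (\<Prod>p\<in>S \<inter> T. (1 / recip p - 1) + 1)" by simp
    also have "\<dots> = (\<Sum>U\<in>Pow (S \<inter> T). f U)"
      using finS[OF ST(1)] by (subst prod_add) (auto simp: f_def)
    also have "\<dots> = (\<Sum>U\<in>Pow primes. if U \<subseteq> S \<and> U \<subseteq> T then f U else 0)"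
      using ST finite_primes by (intro sum.mono_neutral_cong_left) auto
    finally have "(-1) ^ card S * (-1) ^ card T * (\<Prod>p\<in>S \<union> T. recip p) =
        (c S * c T) * (\<Sum>U\<in>Pow primes. if U \<subseteq> S \<and> U \<subseteq> T then f U else 0)"
      by (simp add: c_def mult_ac)
    also have "\<dots> = (\<Sum>U\<in>Pow primes. f U * ((if U \<subseteq> S then c S else 0) * (if U \<subseteq> T then c T else 0)))"
      unfolding sum_distrib_left by (intro sum.cong refl) auto
    finally show ?thesis .
  qed
  have "(\<Sum>S\<in>?A. \<Sum>T\<in>?A. (-1) ^ card S * (-1) ^ card T * (\<Prod>p\<in>S \<union> T. recip p)) =
      (\<Sum>S\<in>?A. \<Sum>T\<in>?A. \<Sum>U\<in>Pow primes. f U * ((if U \<subseteq> S then c S else 0) * (if U \<subseteq> T then c T else 0)))"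
    by (intro sum.cong refl term_eq) auto
  also have "\<dots> = (\<Sum>S\<in>?A. \<Sum>U\<in>Pow primes. \<Sum>T\<in>?A. f U * ((if U \<subseteq> S then c S else 0) * (if U \<subseteq> T then c T else 0)))"
    by (intro sum.cong refl sum.swap)
  also have "\<dots> = (\<Sum>U\<in>Pow primes. \<Sum>S\<in>?A. \<Sum>T\<in>?A. f U * ((if U \<subseteq> S then c S else 0) * (if U \<subseteq> T then c T else 0)))"
    by (rule sum.swap)
  also have "\<dots> = (\<Sum>U\<in>Pow primes. f U * (\<Sum>S\<in>?A. if U \<subseteq> S then c S else 0)\<^sup>2)"
    unfolding power2_eq_square sum_product by (simp only: sum_distrib_left)
  finally have eq: "(\<Sum>S\<in>?A. \<Sum>T\<in>?A. (-1) ^ card S * (-1) ^ card T * (\<Prod>p\<in>S \<union> T. recip p)) =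
      (\<Sum>U\<in>Pow primes. f U * (\<Sum>S\<in>?A. if U \<subseteq> S then c S else 0)\<^sup>2)" .
  have single: "(\<Sum>S\<in>?A. if U \<subseteq> S then c S else 0) = c U" if U: "U \<in> ?A" for U
  proof -
    have "S = U" if S: "S \<in> ?A" "U \<subseteq> S" for S
    proof (rule ccontr)
      assume "S \<noteq> U"
      then obtain p where p: "p \<in> S - U" using S by blast
      have "size_of U < size_of S"
        unfolding size_of_def using p S finS[of S] dg_pos[of p] by (intro sum_strict_mono2[of _ _ p]) auto
      thus False using S U by simp
    qed
    hence "(\<Sum>S\<in>?A. if U \<subseteq> S then c S else 0) = (\<Sum>S\<in>{U}. c S)"
      using finA U by (intro sum.mono_neutral_cong_right) auto
    thus ?thesis by simp
  qed
  have "exp (- 8) / 2 \<le> (\<Sum>U\<in>?A. (\<Prod>p\<in>U. recip p) * (\<Prod>p\<in>U. 1 - recip p))" by (rule density_shrunk_ge)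
  also have "\<dots> = (\<Sum>U\<in>?A. f U * (c U)\<^sup>2)"
  proof (rule sum.cong[OF refl])
    fix U
    have "recip p * (1 - recip p) = (1 / recip p - 1) * (recip p)\<^sup>2" for p
      using recip_pos[of p] by (simp add: field_simps power2_eq_square)
    hence "(\<Prod>p\<in>U. recip p) * (\<Prod>p\<in>U. 1 - recip p) = (\<Prod>p\<in>U. (1 / recip p - 1) * (recip p)\<^sup>2)"
      unfolding prod.distrib[symmetric] by simp
    also have "\<dots> = f U * (\<Prod>p\<in>U. recip p)\<^sup>2" by (simp add: f_def prod.distrib prod_power_distrib)
    finally show "(\<Prod>p\<in>U. recip p) * (\<Prod>p\<in>U. 1 - recip p) = f U * (c U)\<^sup>2"
      by (simp add: c_def power_mult_distrib flip: power_mult)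
  qed
  also have "\<dots> = (\<Sum>U\<in>?A. f U * (\<Sum>S\<in>?A. if U \<subseteq> S then c S else 0)\<^sup>2)"
    by (intro sum.cong refl) (simp only: single)
  also have "\<dots> \<le> (\<Sum>U\<in>Pow primes. f U * (\<Sum>S\<in>?A. if U \<subseteq> S then c S else 0)\<^sup>2)"
    using finite_primes f_nonneg by (intro sum_mono2) auto
  finally show ?thesis unfolding eq .
qed

end

section \<open>Monic polynomials over a finite field\<close>

lemma sum_minus_one_power_subsets:
  assumes "finite A"
  shows "(\<Sum>S\<in>Pow A. (-1) ^ card S) = (if A = {} then 1 else (0::real))"
proof -
  have "(\<Sum>S\<in>Pow A. (-1) ^ card S) = (\<Prod>p\<in>A. -1 + (1::real))"
    using prod_add[OF assms, of "\<lambda>_. -1 :: real" "\<lambda>_. 1"] by simp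
  thus ?thesis using assms by (simp add: card_gt_0_iff)
qed

lemma sum_UN_le_nat:
  fixes f :: "'b \<Rightarrow> nat"
  assumes "finite I" "\<And>i. i \<in> I \<Longrightarrow> finite (S i)"
  shows "(\<Sum>x\<in>(\<Union>i\<in>I. S i). f x) \<le> (\<Sum>i\<in>I. \<Sum>x\<in>S i. f x)"
  using assms
proof (induction I rule: finite_induct)
  case (insert i I)
  have "(\<Sum>x\<in>(\<Union>i\<in>insert i I. S i). f x) \<le> (\<Sum>x\<in>S i. f x) + (\<Sum>x\<in>(\<Union>i\<in>I. S i). f x)"
  proof -
    have "finite (S i)" "finite (\<Union>i\<in>I. S i)" using insert by auto
    from sum.union_inter[OF this, of f] show ?thesis unfolding UN_insert by linarith
  qed
  moreover have "(\<Sum>x\<in>(\<Union>i\<in>I. S i). f x) \<le> (\<Sum>i\<in>I. \<Sum>x\<in>S i. f x)" using insert by auto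
  ultimately have "(\<Sum>x\<in>(\<Union>i\<in>insert i I. S i). f x) \<le> (\<Sum>x\<in>S i. f x) + (\<Sum>i\<in>I. \<Sum>x\<in>S i. f x)"
    by linarith
  thus ?case by (simp only: sum.insert[OF insert.hyps])
qed simp

locale finite_field = field +
  assumes finite_carrier: "finite (carrier R)"
begin

interpretation UP: principal_domain "poly_ring R" by (rule poly_principal)

abbreviation monics :: "nat \<Rightarrow> 'a list set" where
  "monics n \<equiv> {N \<in> monic_polys R. degree N = n}"

abbreviation pmult :: "'a list \<Rightarrow> 'a list \<Rightarrow> 'a list" (infixl "\<otimes>\<^sub>p" 70) where
  "A \<otimes>\<^sub>p B \<equiv> A \<otimes>\<^bsub>poly_ring R\<^esub> B"

text \<open>
  A constant for the degree, so that the function \<open>pdeg\<close> itself can serve as the parameter \<open>dg\<close> of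
  \<open>prime_system\<close>.
\<close>

definition pdeg :: "'a list \<Rightarrow> nat" where
  "pdeg P = degree P"

definition primeprod :: "'a list set \<Rightarrow> 'a list" where
  "primeprod S = finprod (poly_ring R) (\<lambda>P. P) S"

lemma primeprod_empty [simp]: "primeprod {} = \<one>\<^bsub>poly_ring R\<^esub>"
proof -
  show ?thesis by (simp add: primeprod_def)
qed

lemma primeprod_insert:
  assumes "finite S" "P \<notin> S" "insert P S \<subseteq> mirr"
  shows "primeprod (insert P S) = P \<otimes>\<^sub>p primeprod S"
proof -
  show ?thesis using assms mirr_closed unfolding primeprod_def
    by (subst UP.finprod_insert) auto
qed

lemma primeprod_monic: "finite S \<Longrightarrow> S \<subseteq> mirr \<Longrightarrow> primeprod S \<in> monic_polys R"
proof (induction S rule: finite_induct)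
  case (insert P S)
  thus ?case by (simp add: primeprod_insert monic_mult mirr_monic)
qed (simp add: monic_one)

lemma primeprod_closed: "finite S \<Longrightarrow> S \<subseteq> mirr \<Longrightarrow> primeprod S \<in> carrier (poly_ring R)"
  by (rule monic_closed[OF primeprod_monic])

lemma pdeg_mult_monic:
  "A \<in> monic_polys R \<Longrightarrow> B \<in> monic_polys R \<Longrightarrow> pdeg (A \<otimes>\<^sub>p B) = pdeg A + pdeg B"
  using poly_mult_props(3)[of A B] monic_closed monic_nonzero unfolding pdeg_def by blast

lemma pdeg_primeprod: "finite S \<Longrightarrow> S \<subseteq> mirr \<Longrightarrow> pdeg (primeprod S) = sum pdeg S"
proof (induction S rule: finite_induct)
  case empty
  thus ?case by (simp add: univ_poly_one pdeg_def)
next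
  case (insert P S)
  have "pdeg (primeprod (insert P S)) = pdeg (P \<otimes>\<^sub>p primeprod S)"
    using insert by (simp add: primeprod_insert)
  also have "\<dots> = pdeg P + pdeg (primeprod S)"
    using insert by (intro pdeg_mult_monic primeprod_monic mirr_monic) auto
  finally show ?case using insert by simp
qed

lemma mirr_not_dvd_one: "P \<in> mirr \<Longrightarrow> \<not> P pdivides \<one>\<^bsub>poly_ring R\<^esub>"
proof -
  assume P: "P \<in> mirr"
  show ?thesis
    using UP.divides_unit[OF _ mirr_closed[OF P] UP.Units_one_closed] mirr_not_unit[OF P]
    unfolding pdivides_def by blast
qed

lemma mirr_dvd_self: "P \<in> mirr \<Longrightarrow> P pdivides P"
proof -
  assume P: "P \<in> mirr"
  show ?thesis using UP.divides_refl[OF mirr_closed[OF P]] by (simp add: pdivides_def)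
qed

lemma mirr_dvd_primeprod:
  assumes "P \<in> mirr"
  shows "finite S \<Longrightarrow> S \<subseteq> mirr \<Longrightarrow> P pdivides primeprod S \<longleftrightarrow> P \<in> S"
proof (induction S rule: finite_induct)
  case empty
  thus ?case using mirr_not_dvd_one[OF assms] by simp
next
  case (insert Q S)
  have "P pdivides primeprod (insert Q S) \<longleftrightarrow> P pdivides Q \<or> P pdivides primeprod S"
    using insert primeprod_closed mirr_closed by (simp add: primeprod_insert mirr_dvd_mult[OF assms])
  moreover have "P pdivides Q \<longleftrightarrow> P = Q"
    using mirr_dvd_mirr[OF assms] mirr_dvd_self[OF assms] insert.prems by blast
  ultimately show ?case using insert by simp
qed

lemma primeprod_dvd_iff:
  assumes "N \<in> carrier (poly_ring R)" "finite S" "S \<subseteq> mirr"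
  shows "primeprod S pdivides N \<longleftrightarrow> (\<forall>P\<in>S. P pdivides N)"
  using assms(2,3,1)
proof (induction S arbitrary: N rule: finite_induct)
  case empty
  thus ?case using UP.one_divides by (simp add: pdivides_def)
next
  case (insert Q S)
  have Q: "Q \<in> mirr" and S: "S \<subseteq> mirr" using insert.prems by auto
  note Qc = mirr_closed[OF Q] and Sc = primeprod_closed[OF insert.hyps(1) S]
  have eq: "primeprod (insert Q S) = Q \<otimes>\<^sub>p primeprod S"
    using insert by (simp add: primeprod_insert)
  show ?case
  proof
    assume d: "primeprod (insert Q S) pdivides N"
    have "P pdivides N" if "P \<in> insert Q S" for P
    proof -
      have P: "P \<in> mirr" using that insert.prems by auto
      have "P pdivides primeprod (insert Q S)"
        using mirr_dvd_primeprod[OF P, of "insert Q S"] insert that by auto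
      thus ?thesis using d UP.divides_trans mirr_closed[OF P] unfolding pdivides_def by blast
    qed
    thus "\<forall>P\<in>insert Q S. P pdivides N" by blast
  next
    assume all: "\<forall>P\<in>insert Q S. P pdivides N"
    then obtain B where B: "B \<in> carrier (poly_ring R)" "N = Q \<otimes>\<^sub>p B"
      unfolding pdivides_def factor_def by blast
    have "P pdivides B" if P: "P \<in> S" for P
    proof -
      have "P pdivides (Q \<otimes>\<^sub>p B)" using all P B by auto
      moreover have "\<not> P pdivides Q"
        using mirr_dvd_mirr[of P Q] P S Q insert.hyps(2) by blast
      ultimately show ?thesis using mirr_dvd_mult[of P Q B] P S Qc B by blast
    qed
    hence "primeprod S pdivides B" using insert.IH[OF S B(1)] by blast
    thus "primeprod (insert Q S) pdivides N"
      unfolding eq B(2) pdivides_def using Qc Sc B(1) by (simp add: UP.divides_mult_lI)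
  qed
qed

lemma moebius_mult_coprime:
  assumes "A \<in> monic_polys R" "B \<in> monic_polys R" "coprime_polys R A B"
  shows "moebius R (A \<otimes>\<^sub>p B) = moebius R A * moebius R B"
  using is_moebius_moebius[OF finite_carrier] assms unfolding is_moebius_def by blast

lemma moebius_mirr:
  assumes "P \<in> mirr"
  shows "moebius R P = -1" "j \<ge> 2 \<Longrightarrow> moebius R (P [^]\<^bsub>poly_ring R\<^esub> (j::nat)) = 0"
  using is_moebius_moebius[OF finite_carrier] mirr_monic[OF assms] mirr_irr[OF assms]
  unfolding is_moebius_def by blast+

lemma moebius_one: "moebius R \<one>\<^bsub>poly_ring R\<^esub> = 1"
  using is_moebius_moebius[OF finite_carrier] unfolding is_moebius_def by blast

lemma moebius_primeprod:
  shows "finite S \<Longrightarrow> S \<subseteq> mirr \<Longrightarrow> moebius R (primeprod S) = (-1) ^ card S"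
proof (induction S rule: finite_induct)
  case empty
  thus ?case by (simp add: moebius_one)
next
  case (insert P S)
  have P: "P \<in> mirr" and S: "S \<subseteq> mirr" using insert.prems by auto
  have cop: "coprime_polys R P (primeprod S)"
  proof -
    have "\<not> (Q pdivides P \<and> Q pdivides primeprod S)" if Q: "Q \<in> mirr" for Q
      using mirr_dvd_mirr[OF Q P] mirr_dvd_primeprod[OF Q insert.hyps(1) S] insert.hyps(2) by blast
    thus ?thesis
      using coprime_polys_iff[OF mirr_monic[OF P] primeprod_monic[OF insert.hyps(1) S]] by blast
  qed
  have "moebius R (primeprod (insert P S)) = moebius R P * moebius R (primeprod S)"
    using moebius_mult_coprime[OF mirr_monic[OF P] primeprod_monic[OF insert.hyps(1) S] cop]
      insert by (simp add: primeprod_insert)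
  thus ?case using insert moebius_mirr(1)[OF P] by simp
qed

text \<open>
  Split off the full power of one prime; its exponent must be \<open>1\<close>.
\<close>

lemma moebius_nonzero_imp_primeprod:
  shows "M \<in> monic_polys R \<Longrightarrow> moebius R M \<noteq> 0 \<Longrightarrow> \<exists>S. finite S \<and> S \<subseteq> mirr \<and> M = primeprod S"
proof (induction "degree M" arbitrary: M rule: less_induct)
  case less
  show ?case
  proof (cases "M = \<one>\<^bsub>poly_ring R\<^esub>")
    case True
    thus ?thesis by (intro exI[of _ "{}"]) simp
  next
    case False
    obtain P j B where PB: "P \<in> mirr" "(j::nat) \<ge> 1" "B \<in> monic_polys R"
        "M = P [^]\<^bsub>poly_ring R\<^esub> j \<otimes>\<^sub>p B" "degree B < degree M"
        "coprime_polys R (P [^]\<^bsub>poly_ring R\<^esub> j) B"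
      by (rule mirr_decomp[OF less.prems(1) False])
    have Pj: "P [^]\<^bsub>poly_ring R\<^esub> j \<in> monic_polys R" using monic_pow mirr_monic PB by blast
    have mu: "moebius R M = moebius R (P [^]\<^bsub>poly_ring R\<^esub> j) * moebius R B"
      unfolding PB(4) by (rule moebius_mult_coprime[OF Pj PB(3,6)])
    hence "moebius R (P [^]\<^bsub>poly_ring R\<^esub> j) \<noteq> 0" "moebius R B \<noteq> 0" using less.prems(2) by auto
    moreover from this(1) have j: "j = 1" using moebius_mirr(2)[OF PB(1), of j] PB(2) by force
    ultimately obtain S where S: "finite S" "S \<subseteq> mirr" "B = primeprod S"
      using less.hyps[OF PB(5,3)] by blast
    have pow: "P [^]\<^bsub>poly_ring R\<^esub> j = P" using j mirr_closed[OF PB(1)] by simp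
    have "P \<notin> S"
    proof
      assume "P \<in> S"
      hence "P pdivides B" using S mirr_dvd_primeprod[OF PB(1)] by blast
      thus False
        using PB(6) coprime_polys_iff[OF Pj PB(3)] PB(1) mirr_dvd_self[OF PB(1)] unfolding pow by blast
    qed
    hence "M = primeprod (insert P S)" using S PB(1,4) by (simp add: primeprod_insert pow)
    thus ?thesis using S PB(1) by (intro exI[of _ "insert P S"]) auto
  qed
qed

lemma monic_degree_eq:
  "monics n = (#) \<one> ` {l. set l \<subseteq> carrier R \<and> length l = n}"
proof (intro equalityI subsetI)
  fix N assume N: "N \<in> monics n"
  then obtain l where l: "N = \<one> # l" by (cases N) (auto simp: monic_polys_def)
  have "set l \<subseteq> carrier R"
    using N l by (auto simp: monic_polys_def univ_poly_carrier[symmetric] polynomial_def)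
  thus "N \<in> (#) \<one> ` {l. set l \<subseteq> carrier R \<and> length l = n}" using N l by auto
next
  fix N assume "N \<in> (#) \<one> ` {l. set l \<subseteq> carrier R \<and> length l = n}"
  thus "N \<in> monics n"
    by (auto simp: monic_polys_def univ_poly_carrier[symmetric] polynomial_def)
qed

lemma card_monic_degree:
  shows "card (monics n) = card (carrier R) ^ n"
    and "finite (monics n)"
  unfolding monic_degree_eq using finite_carrier
  by (simp_all add: card_image card_lists_length_eq finite_lists_length_eq)

lemma card_monic_multiples:
  assumes M: "M \<in> monic_polys R" "degree M \<le> n"
  shows "card {N \<in> monic_polys R. degree N = n \<and> M pdivides N} = card (carrier R) ^ (n - degree M)"
proof -
  note Mc = monic_closed[OF M(1)]
  have "{N \<in> monic_polys R. degree N = n \<and> M pdivides N} =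
      (\<lambda>B. M \<otimes>\<^sub>p B) ` monics (n - degree M)"
  proof (intro equalityI subsetI)
    fix N assume N: "N \<in> {N \<in> monic_polys R. degree N = n \<and> M pdivides N}"
    then obtain B where B: "B \<in> carrier (poly_ring R)" "N = M \<otimes>\<^sub>p B"
      unfolding pdivides_def factor_def by blast
    have Bm: "B \<in> monic_polys R" using monic_cofactor[OF M(1) _ B] N by blast
    have "degree N = degree M + degree B" 
      unfolding B(2) using pdeg_mult_monic[OF M(1) Bm] by (simp only: pdeg_def)
    moreover have "degree N = n" using N by blast
    ultimately have "degree B = n - degree M" by linarith
    thus "N \<in> (\<lambda>B. M \<otimes>\<^sub>p B) ` monics (n - degree M)"
      using B(2) Bm by blast
  next
    fix N assume "N \<in> (\<lambda>B. M \<otimes>\<^sub>p B) ` monics (n - degree M)"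
    then obtain B where B: "B \<in> monic_polys R" "degree B = n - degree M" "N = M \<otimes>\<^sub>p B" by blast
    have "M pdivides N" unfolding B(3) pdivides_def
      using UP.divides_prod_r[OF UP.divides_refl[OF Mc] Mc monic_closed[OF B(1)]] .
    thus "N \<in> {N \<in> monic_polys R. degree N = n \<and> M pdivides N}"
      using B M monic_mult[OF M(1) B(1)] pdeg_mult_monic[OF M(1) B(1)] by (simp add: pdeg_def)
  qed
  moreover have "inj_on (\<lambda>B. M \<otimes>\<^sub>p B) (monics (n - degree M))"
  proof (rule inj_onI)
    fix A B assume A: "A \<in> monics (n - degree M)"
      and B: "B \<in> monics (n - degree M)"
      and eq: "M \<otimes>\<^sub>p A = M \<otimes>\<^sub>p B"
    have "M \<noteq> \<zero>\<^bsub>poly_ring R\<^esub>" using monic_nonzero[OF M(1)] by (simp add: univ_poly_zero)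
    thus "A = B"
      using UP.m_lcancel[OF _ Mc, of A B] eq A B monic_closed by blast
  qed
  ultimately show ?thesis using card_monic_degree(1) by (simp add: card_image)
qed

subsection \<open>The primes of bounded degree\<close>

definition small_primes :: "nat \<Rightarrow> 'a list set" where
  "small_primes m = {P \<in> mirr. degree P \<le> m}"

lemma finite_small_primes: "finite (small_primes m)"
proof (rule finite_subset)
  show "small_primes m \<subseteq> (\<Union>d\<le>m. monics d)"
    using mirr_monic by (auto simp: small_primes_def)
  show "finite (\<Union>d\<le>m. monics d)"
    using card_monic_degree(2) by auto
qed

lemma primeprod_inj:
  assumes "finite S" "S \<subseteq> mirr" "finite T" "T \<subseteq> mirr" "primeprod S = primeprod T"
  shows "S = T"
proof -
  have iff: "P \<in> U \<longleftrightarrow> P \<in> mirr \<and> P pdivides primeprod U" if "finite U" "U \<subseteq> mirr" for P U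
    using mirr_dvd_primeprod[of P U] that by auto
  show ?thesis using iff[OF assms(1,2)] iff[OF assms(3,4)] assms(5) by auto
qed

lemma small_primes_subset:
  assumes "S \<subseteq> small_primes m"
  shows "finite S" "S \<subseteq> mirr"
  using finite_subset[OF assms finite_small_primes] assms by (auto simp: small_primes_def)

lemma inj_on_primeprod:
  assumes "\<And>S. S \<in> A \<Longrightarrow> S \<subseteq> small_primes m"
  shows "inj_on primeprod A"
proof (rule inj_onI)
  fix S T assume S: "S \<in> A" and T: "T \<in> A" and eq: "primeprod S = primeprod T"
  note S' = small_primes_subset[OF assms[OF S]]
  note T' = small_primes_subset[OF assms[OF T]]
  show "S = T" by (rule primeprod_inj[OF S' T' eq])
qed

lemma card_divisible:
  assumes S: "S \<subseteq> small_primes m" and n: "sum pdeg S \<le> n"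
  shows "card {N \<in> monic_polys R. degree N = n \<and> (\<forall>P\<in>S. P pdivides N)} =
    card (carrier R) ^ (n - sum pdeg S)"
proof -
  have S': "finite S" "S \<subseteq> mirr"
    by (rule small_primes_subset[OF S])+
  have "{N \<in> monic_polys R. degree N = n \<and> (\<forall>P\<in>S. P pdivides N)} =
      {N \<in> monic_polys R. degree N = n \<and> primeprod S pdivides N}"
    using primeprod_dvd_iff[OF monic_closed S'] by blast
  thus ?thesis
    using card_monic_multiples[OF primeprod_monic[OF S'], of n] pdeg_primeprod[OF S'] n
    by (simp add: pdeg_def)
qed

lemma card_divisible_zero:
  assumes S: "S \<subseteq> small_primes m" and n: "sum pdeg S > n"
  shows "card {N \<in> monic_polys R. degree N = n \<and> (\<forall>P\<in>S. P pdivides N)} = 0"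
proof -
  have S': "finite S" "S \<subseteq> mirr"
    by (rule small_primes_subset[OF S])+
  have "\<not> (\<forall>P\<in>S. P pdivides N)" if N: "N \<in> monic_polys R" "degree N = n" for N
  proof
    assume "\<forall>P\<in>S. P pdivides N"
    hence "primeprod S pdivides N" using primeprod_dvd_iff[OF monic_closed[OF N(1)] S'] by blast
    hence "degree (primeprod S) \<le> degree N"
      using pdivides_imp_degree_le[OF carrier_is_subring primeprod_closed[OF S'] monic_closed[OF N(1)]
          monic_nonzero[OF N(1)]] by blast
    thus False using pdeg_primeprod[OF S'] n N(2) by (simp add: pdeg_def)
  qed
  hence none: "{N \<in> monic_polys R. degree N = n \<and> (\<forall>P\<in>S. P pdivides N)} = {}" by blast
  show ?thesis unfolding none by simp
qed

text \<open>
  Sum \<open>(\<Sum>M | M dvd N. \<mu> M) = [N = 1]\<close> over all monic \<open>N\<close> of degree \<open>i\<close>. With \<open>s d\<close> the sum of \<open>\<mu>\<close> over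
  degree \<open>d\<close> this gives \<open>(\<Sum>d\<le>i. s d * q ^ (i - d)) = [i = 0]\<close>, from which \<open>s\<close> is read off recursively.
\<close>

lemma sum_moebius_degree:
  assumes j: "j \<le> m"
  defines "q \<equiv> card (carrier R)"
  shows "(\<Sum>S | S \<subseteq> small_primes m \<and> sum pdeg S = j. (-1) ^ card S) =
    (if j = 0 then 1 else if j = 1 then - real q else (0::real))"
proof -
  define s where "s i = (\<Sum>S | S \<subseteq> small_primes m \<and> sum pdeg S = i. (-1) ^ card S :: real)" for i
  define T where "T i = (\<Sum>d\<le>i. s d * real q ^ (i - d))" for i
  have finP: "finite (small_primes m)" by (rule finite_small_primes)
  have finS: "finite {S. S \<subseteq> small_primes m \<and> Q S}" for Q
    using finP by (auto intro: finite_subset[of _ "Pow (small_primes m)"])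
  have T: "T i = (if i = 0 then 1 else 0)" if i: "i \<le> m" for i
  proof -
    let ?M = "monics i"
    have finM: "finite ?M" by (rule card_monic_degree(2))
    have "(\<Sum>N\<in>?M. \<Sum>S\<in>Pow (small_primes m). if \<forall>P\<in>S. P pdivides N then (-1) ^ card S else (0::real)) =
        (\<Sum>N\<in>?M. if i = 0 then 1 else 0)"
    proof (rule sum.cong[OF refl])
      fix N assume N: "N \<in> ?M"
      let ?D = "{P \<in> small_primes m. P pdivides N}"
      have "(\<Sum>S\<in>Pow (small_primes m). if \<forall>P\<in>S. P pdivides N then (-1) ^ card S else (0::real)) =
          (\<Sum>S\<in>Pow ?D. (-1) ^ card S)"
        using finP by (intro sum.mono_neutral_cong_right) auto
      also have "\<dots> = (if ?D = {} then 1 else 0)"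
        using finP by (intro sum_minus_one_power_subsets) auto
      also have "?D = {} \<longleftrightarrow> i = 0"
      proof
        assume none: "?D = {}"
        show "i = 0"
        proof (rule ccontr)
          assume i0: "i \<noteq> 0"
          have "N \<notin> Units (poly_ring R)"
          proof
            assume "N \<in> Units (poly_ring R)"
            hence "N = \<one>\<^bsub>poly_ring R\<^esub>" using monic_unit_eq N by blast
            thus False using N i0 by (simp add: univ_poly_one)
          qed
          then obtain P where P: "P \<in> mirr" "P pdivides N"
            using ex_mirr_dvd[of N] N monic_closed monic_nonzero by blast
          have "degree P \<le> degree N"
            using pdivides_imp_degree_le[OF carrier_is_subring mirr_closed[OF P(1)] _ _ P(2)]
              N monic_closed monic_nonzero by blast
          hence "P \<in> ?D" using P N i by (simp add: small_primes_def)
          thus False using none by blast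
        qed
      next
        assume i0: "i = 0"
        show "?D = {}"
        proof (rule ccontr)
          assume "?D \<noteq> {}"
          then obtain P where P: "P \<in> mirr" "P pdivides N" by (auto simp: small_primes_def)
          have "degree P \<le> degree N"
            using pdivides_imp_degree_le[OF carrier_is_subring mirr_closed[OF P(1)] _ _ P(2)]
              N monic_closed monic_nonzero by blast
          thus False using mirr_degree[OF P(1)] N i0 by simp
        qed
      qed
      finally show "(\<Sum>S\<in>Pow (small_primes m). if \<forall>P\<in>S. P pdivides N then (-1) ^ card S else (0::real)) =
          (if i = 0 then 1 else 0)" by simp
    qed
    also have "\<dots> = (if i = 0 then 1 else 0)"
      using card_monic_degree(1)[of 0] by simp
    finally have "(if i = 0 then 1 else 0) =
        (\<Sum>S\<in>Pow (small_primes m). \<Sum>N\<in>?M. if \<forall>P\<in>S. P pdivides N then (-1) ^ card S else (0::real))"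
      by (subst sum.swap) simp
    also have "\<dots> = (\<Sum>S\<in>Pow (small_primes m). (-1) ^ card S *
        real (card {N \<in> monic_polys R. degree N = i \<and> (\<forall>P\<in>S. P pdivides N)}))"
    proof (intro sum.cong refl)
      fix S
      have "{N \<in> ?M. \<forall>P\<in>S. P pdivides N} = {N \<in> monic_polys R. degree N = i \<and> (\<forall>P\<in>S. P pdivides N)}" by blast
      thus "(\<Sum>N\<in>?M. if \<forall>P\<in>S. P pdivides N then (-1) ^ card S else (0::real)) =
          (-1) ^ card S * real (card {N \<in> monic_polys R. degree N = i \<and> (\<forall>P\<in>S. P pdivides N)})"
        using finM by (simp add: sum.If_cases Int_def)
    qed
    also have "\<dots> = (\<Sum>S | S \<subseteq> small_primes m \<and> sum pdeg S \<le> i. (-1) ^ card S * real q ^ (i - sum pdeg S))"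
      using finP card_divisible[of _ m i] card_divisible_zero[of _ m i]
      by (intro sum.mono_neutral_cong_right) (auto simp: q_def not_le)
    also have "\<dots> = (\<Sum>d\<le>i. \<Sum>S | S \<in> {S. S \<subseteq> small_primes m \<and> sum pdeg S \<le> i} \<and> sum pdeg S = d.
        (-1) ^ card S * real q ^ (i - sum pdeg S))"
      by (intro sum.group[symmetric] finS) auto
    also have "\<dots> = T i"
      unfolding T_def s_def sum_distrib_right by (intro sum.cong) auto
    finally show ?thesis by simp
  qed
  have "s j = (if j = 0 then 1 else if j = 1 then - real q else 0)"
  proof (cases j)
    case 0
    thus ?thesis using T[of 0] by (simp add: T_def)
  next
    case (Suc i)
    have "T (Suc i) = s (Suc i) + real q * T i"
    proof -
      have "(\<Sum>d\<le>i. s d * real q ^ (Suc i - d)) = real q * T i"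
        unfolding T_def sum_distrib_left by (intro sum.cong refl) (simp add: Suc_diff_le)
      thus ?thesis by (simp add: T_def[of "Suc i"])
    qed
    thus ?thesis using T[of i] T[of "Suc i"] Suc j by (cases i) auto
  qed
  thus ?thesis by (simp add: s_def)
qed

lemma two_le_card_carrier: "card (carrier R) \<ge> 2"
proof -
  have "card {\<zero>, \<one>} \<le> card (carrier R)" using finite_carrier by (intro card_mono) auto
  thus ?thesis using one_not_zero by simp
qed

lemma prime_system_small_primes: "prime_system (small_primes m) pdeg (card (carrier R)) m"
proof
  show "finite (small_primes m)" by (rule finite_small_primes)
  show "1 \<le> pdeg P" if "P \<in> small_primes m" for P
    using that mirr_degree by (auto simp: small_primes_def pdeg_def)
  show "pdeg P \<le> m" if "P \<in> small_primes m" for P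
    using that by (auto simp: small_primes_def pdeg_def)
  show "2 \<le> card (carrier R)" by (rule two_le_card_carrier)
  show "card {S. S \<subseteq> small_primes m \<and> sum pdeg S = j} \<le> card (carrier R) ^ j" for j
  proof -
    let ?A = "{S. S \<subseteq> small_primes m \<and> sum pdeg S = j}"
    have inj: "inj_on primeprod ?A" by (rule inj_on_primeprod) blast
    have "primeprod ` ?A \<subseteq> monics j"
    proof (rule image_subsetI)
      fix S assume S: "S \<in> ?A"
      hence S': "finite S" "S \<subseteq> mirr" using small_primes_subset[of S m] by auto
      show "primeprod S \<in> monics j"
        using S primeprod_monic[OF S'] pdeg_primeprod[OF S'] by (simp add: pdeg_def)
    qed
    from card_inj_on_le[OF inj this card_monic_degree(2)]
    show ?thesis by (simp only: card_monic_degree(1))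
  qed
  show "(\<Sum>S | S \<subseteq> small_primes m \<and> sum pdeg S = j. (-1) ^ card S) =
      (if j = 0 then 1 else if j = 1 then - real (card (carrier R)) else 0)" if "j \<le> m" for j
    by (rule sum_moebius_degree[OF that])
qed

text \<open>
  Only squarefree \<open>M\<close> contribute, and these correspond to sets of primes.
\<close>

lemma divisor_sum_eq:
  assumes N: "N \<in> monic_polys R"
  shows "(\<Sum>M | M \<in> monic_polys R \<and> degree M = m \<and> M pdivides N. real_of_int (moebius R M)) =
    (\<Sum>S | S \<subseteq> small_primes m \<and> sum pdeg S = m. if \<forall>P\<in>S. P pdivides N then (-1) ^ card S else 0)"
proof -
  let ?A = "{S. S \<subseteq> small_primes m \<and> sum pdeg S = m}"
  let ?B = "{S \<in> ?A. \<forall>P\<in>S. P pdivides N}"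
  let ?M = "{M. M \<in> monic_polys R \<and> degree M = m \<and> M pdivides N}"
  have S: "finite S" "S \<subseteq> mirr" if "S \<subseteq> small_primes m" for S
    by (rule small_primes_subset[OF that])+
  have finA: "finite ?A" using finite_small_primes
    by (auto intro: finite_subset[of _ "Pow (small_primes m)"])
  have inj: "inj_on primeprod ?B" by (rule inj_on_primeprod[of _ m]) blast
  have "(\<Sum>S\<in>?A. if \<forall>P\<in>S. P pdivides N then (-1) ^ card S else 0) = (\<Sum>S\<in>?B. (-1) ^ card S)"
    using finA by (simp add: sum.If_cases Int_def)
  also have "\<dots> = (\<Sum>S\<in>?B. real_of_int (moebius R (primeprod S)))"
    using S by (intro sum.cong refl) (simp add: moebius_primeprod)
  also have "\<dots> = (\<Sum>M\<in>primeprod ` ?B. real_of_int (moebius R M))"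
    by (subst sum.reindex[OF inj]) (simp only: o_def)
  also have "\<dots> = (\<Sum>M\<in>?M. real_of_int (moebius R M))"
  proof (rule sum.mono_neutral_left)
    show "finite ?M"
      using card_monic_degree(2)[of m] by (rule finite_subset[rotated]) blast
    show "primeprod ` ?B \<subseteq> ?M"
    proof (rule image_subsetI)
      fix T assume T: "T \<in> ?B"
      thus "primeprod T \<in> ?M"
        using S[of T] primeprod_monic[of T] pdeg_primeprod[of T] primeprod_dvd_iff[OF monic_closed[OF N], of T]
        by (simp add: pdeg_def)
    qed
    show "\<forall>M\<in>?M - primeprod ` ?B. real_of_int (moebius R M) = 0"
    proof (intro ballI, rule ccontr)
      fix M assume M: "M \<in> ?M - primeprod ` ?B" and "real_of_int (moebius R M) \<noteq> 0"
      then obtain T where T: "finite T" "T \<subseteq> mirr" "M = primeprod T"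
        using moebius_nonzero_imp_primeprod[of M] by auto
      have deg: "sum pdeg T = m" using pdeg_primeprod[OF T(1,2)] T(3) M by (simp add: pdeg_def)
      have "pdeg P \<le> m" if "P \<in> T" for P
        using member_le_sum[of P T pdeg] that T(1) deg by simp
      hence "T \<subseteq> small_primes m" using T(2) by (auto simp: small_primes_def pdeg_def)
      moreover have "\<forall>P\<in>T. P pdivides N"
        using primeprod_dvd_iff[OF monic_closed[OF N] T(1,2)] T(3) M by blast
      ultimately have "T \<in> ?B" using deg by blast
      thus False using M T(3) by blast
    qed
  qed
  finally show ?thesis by simp
qed

lemma average_divisible:
  assumes U: "U \<subseteq> small_primes m" and n: "sum pdeg U \<le> n"
  shows "1 / real (card (carrier R)) ^ n *
      (\<Sum>N | N \<in> monic_polys R \<and> degree N = n. if \<forall>P\<in>U. P pdivides N then c else 0) =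
    c * (\<Prod>P\<in>U. prime_system.recip pdeg (card (carrier R)) P)"
proof -
  interpret ps: prime_system "small_primes m" pdeg "card (carrier R)" m
    by (rule prime_system_small_primes)
  let ?q = "real (card (carrier R))"
  have q: "?q > 0" using two_le_card_carrier by simp
  have "{N \<in> monics n. \<forall>P\<in>U. P pdivides N} =
      {N \<in> monic_polys R. degree N = n \<and> (\<forall>P\<in>U. P pdivides N)}" by blast
  hence "(\<Sum>N | N \<in> monic_polys R \<and> degree N = n. if \<forall>P\<in>U. P pdivides N then c else 0) =
      c * ?q ^ (n - sum pdeg U)"
    using card_monic_degree(2)[of n] card_divisible[OF U n]
    by (simp add: sum.If_cases Int_def)
  moreover have "?q ^ n = ?q ^ (n - sum pdeg U) * ?q ^ sum pdeg U"
    using n by (simp flip: power_add)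
  ultimately show ?thesis using q by (simp add: ps.prod_recip ps.size_of_def)
qed

text \<open>
  The union of the sets of a tuple has total degree at most \<open>2 * k * m \<le> n\<close>, so \<open>average_divisible\<close> gives the
  exact proportion of the \<open>N\<close> that are divisible by all its primes.
\<close>

lemma Poly_moment_eq_moment:
  assumes n: "n \<ge> 2 * m * k"
  shows "Poly_moment R n m k = prime_system.moment (small_primes m) pdeg (card (carrier R)) m {1..2 * k}"
proof -
  interpret ps: prime_system "small_primes m" pdeg "card (carrier R)" m
    by (rule prime_system_small_primes)
  let ?A = "{S. S \<subseteq> small_primes m \<and> sum pdeg S = m}"
  let ?J = "{1..2 * k}"
  let ?M = "{N. N \<in> monic_polys R \<and> degree N = n}"
  have finA: "finite ?A" using finite_small_primes
    by (auto intro: finite_subset[of _ "Pow (small_primes m)"])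
  have pow: "\<bar>\<Sum>M | M \<in> monic_polys R \<and> degree M = m \<and> M pdivides N. real_of_int (moebius R M)\<bar> ^ (2 * k) =
      (\<Sum>S\<in>(\<Pi>\<^sub>E i\<in>?J. ?A). if \<forall>P\<in>(\<Union>i\<in>?J. S i). P pdivides N then (\<Prod>i\<in>?J. (-1) ^ card (S i)) else 0)"
    if N: "N \<in> ?M" for N
  proof -
    have "\<bar>\<Sum>M | M \<in> monic_polys R \<and> degree M = m \<and> M pdivides N. real_of_int (moebius R M)\<bar> ^ (2 * k) =
        (\<Prod>i\<in>?J. \<Sum>S\<in>?A. if \<forall>P\<in>S. P pdivides N then (-1) ^ card S else 0)"
    proof -
      have N': "N \<in> monic_polys R" using N by blast
      show ?thesis unfolding divisor_sum_eq[OF N'] by (simp add: power_even_abs)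
    qed
    also have "\<dots> = (\<Sum>S\<in>(\<Pi>\<^sub>E i\<in>?J. ?A). \<Prod>i\<in>?J. if \<forall>P\<in>S i. P pdivides N then (-1) ^ card (S i) else 0)"
      using finA by (intro prod_sum_PiE) auto
    also have "\<dots> = (\<Sum>S\<in>(\<Pi>\<^sub>E i\<in>?J. ?A). if \<forall>P\<in>(\<Union>i\<in>?J. S i). P pdivides N then (\<Prod>i\<in>?J. (-1) ^ card (S i)) else 0)"
    proof (intro sum.cong refl)
      fix S :: "nat \<Rightarrow> 'a list set"
      show "(\<Prod>i\<in>?J. if \<forall>P\<in>S i. P pdivides N then (-1) ^ card (S i) else 0) =
          (if \<forall>P\<in>(\<Union>i\<in>?J. S i). P pdivides N then (\<Prod>i\<in>?J. (-1) ^ card (S i)) else (0::real))"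
      proof (cases "\<forall>P\<in>(\<Union>i\<in>?J. S i). P pdivides N")
        case True
        hence "(\<Prod>i\<in>?J. if \<forall>P\<in>S i. P pdivides N then (-1) ^ card (S i) else 0) = (\<Prod>i\<in>?J. (-1 :: real) ^ card (S i))"
          by (intro prod.cong refl) (meson UN_I)
        thus ?thesis using True by simp
      next
        case False
        then obtain i where "i \<in> ?J" "\<not> (\<forall>P\<in>S i. P pdivides N)" by blast
        hence "(\<Prod>i\<in>?J. if \<forall>P\<in>S i. P pdivides N then (-1) ^ card (S i) else (0::real)) = 0"
          by (intro prod_zero) auto
        thus ?thesis using False by simp
      qed
    qed
    finally show ?thesis .
  qed
  have "Poly_moment R n m k = 1 / real (card (carrier R)) ^ n * (\<Sum>N\<in>?M. \<Sum>S\<in>(\<Pi>\<^sub>E i\<in>?J. ?A).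
      if \<forall>P\<in>(\<Union>i\<in>?J. S i). P pdivides N then (\<Prod>i\<in>?J. (-1) ^ card (S i)) else 0)"
    unfolding Poly_moment_def by (intro arg_cong2[where f = "(*)"] refl sum.cong pow)
  also have "\<dots> = (\<Sum>S\<in>(\<Pi>\<^sub>E i\<in>?J. ?A). 1 / real (card (carrier R)) ^ n * (\<Sum>N\<in>?M.
      if \<forall>P\<in>(\<Union>i\<in>?J. S i). P pdivides N then (\<Prod>i\<in>?J. (-1) ^ card (S i)) else 0))"
    by (subst sum.swap) (simp only: sum_distrib_left)
  also have "\<dots> = (\<Sum>S\<in>(\<Pi>\<^sub>E i\<in>?J. ?A). (\<Prod>i\<in>?J. (-1) ^ card (S i)) * (\<Prod>P\<in>(\<Union>i\<in>?J. S i). ps.recip P))"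
  proof (intro sum.cong refl average_divisible)
    fix S assume S: "S \<in> (\<Pi>\<^sub>E i\<in>?J. ?A)"
    show "(\<Union>i\<in>?J. S i) \<subseteq> small_primes m" using S by (auto simp: PiE_def Pi_def)
    have finS: "finite (S i)" if "i \<in> ?J" for i
      using S that finite_subset[OF _ finite_small_primes] by (auto simp: PiE_def Pi_def)
    have "(\<Sum>P\<in>(\<Union>i\<in>?J. S i). pdeg P) \<le> (\<Sum>i\<in>?J. \<Sum>P\<in>S i. pdeg P)"
      using finS by (intro sum_UN_le_nat) auto
    also have "\<dots> = (\<Sum>i\<in>?J. m)" using S by (intro sum.cong refl) (auto simp: PiE_def Pi_def)
    finally show "(\<Sum>P\<in>(\<Union>i\<in>?J. S i). pdeg P) \<le> n" using n by (simp add: mult_ac)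
  qed
  also have "\<dots> = ps.moment ?J" by (simp add: ps.moment_def ps.size_of_def)
  finally show ?thesis .
qed

text \<open>
  The divisor sum \<open>D N\<close> is an integer, whence \<open>D N ^ (2 * k) \<ge> D N ^ 2\<close>.
\<close>

lemma Poly_moment_ge:
  assumes n: "n \<ge> 2 * m * k" and k: "k \<ge> 1"
  shows "Poly_moment R n m k \<ge> exp (- 8) / 2"
proof -
  interpret ps: prime_system "small_primes m" pdeg "card (carrier R)" m
    by (rule prime_system_small_primes)
  let ?A = "{S. S \<subseteq> small_primes m \<and> sum pdeg S = m}"
  let ?M = "{N. N \<in> monic_polys R \<and> degree N = n}"
  let ?w = "1 / real (card (carrier R)) ^ n"
  let ?t = "\<lambda>N S. if \<forall>P\<in>S. P pdivides N then (-1) ^ card S else (0::real)"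
  define D where "D N = (\<Sum>M | M \<in> monic_polys R \<and> degree M = m \<and> M pdivides N. moebius R M)" for N
  have n2: "2 * m \<le> n"
  proof -
    have "2 * m * 1 \<le> 2 * m * k" using k by (intro mult_le_mono2)
    thus ?thesis using n by linarith
  qed
  have avg: "?w * (\<Sum>N\<in>?M. ?t N S * ?t N T) = (-1) ^ card S * (-1) ^ card T * (\<Prod>P\<in>S \<union> T. ps.recip P)"
    if S: "S \<in> ?A" and T: "T \<in> ?A" for S T
  proof -
    have finST: "finite S" "finite T"
      using S T finite_subset[OF _ finite_small_primes] by auto
    have "(\<Sum>P\<in>S \<union> T. pdeg P) \<le> sum pdeg S + sum pdeg T"
      using sum.union_inter[OF finST, of pdeg] by linarith
    hence le: "(\<Sum>P\<in>S \<union> T. pdeg P) \<le> n" using S T n2 by simp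
    have "(\<Sum>N\<in>?M. ?t N S * ?t N T) = (\<Sum>N\<in>?M. if \<forall>P\<in>S \<union> T. P pdivides N then (-1) ^ card S * (-1) ^ card T else 0)"
      by (intro sum.cong refl) auto
    thus ?thesis using average_divisible[OF _ le] S T by auto
  qed
  have "exp (- 8) / 2 \<le> (\<Sum>S\<in>?A. \<Sum>T\<in>?A. (-1) ^ card S * (-1) ^ card T * (\<Prod>P\<in>S \<union> T. ps.recip P))"
    using ps.second_moment_ge by (simp add: ps.size_of_def)
  also have "\<dots> = (\<Sum>S\<in>?A. \<Sum>T\<in>?A. ?w * (\<Sum>N\<in>?M. ?t N S * ?t N T))"
    by (intro sum.cong refl avg[symmetric])
  also have "\<dots> = ?w * (\<Sum>S\<in>?A. \<Sum>T\<in>?A. \<Sum>N\<in>?M. ?t N S * ?t N T)"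
    by (simp only: sum_distrib_left)
  also have "(\<Sum>S\<in>?A. \<Sum>T\<in>?A. \<Sum>N\<in>?M. ?t N S * ?t N T) = (\<Sum>S\<in>?A. \<Sum>N\<in>?M. \<Sum>T\<in>?A. ?t N S * ?t N T)"
    by (intro sum.cong refl sum.swap)
  also have "\<dots> = (\<Sum>N\<in>?M. \<Sum>S\<in>?A. \<Sum>T\<in>?A. ?t N S * ?t N T)" by (rule sum.swap)
  also have "\<dots> = (\<Sum>N\<in>?M. (\<Sum>S\<in>?A. ?t N S)\<^sup>2)" unfolding power2_eq_square sum_product ..
  also have "\<dots> = (\<Sum>N\<in>?M. (real_of_int (D N))\<^sup>2)"
  proof (intro sum.cong refl)
    fix N assume "N \<in> ?M"
    hence N: "N \<in> monic_polys R" by blast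
    show "(\<Sum>S\<in>?A. ?t N S)\<^sup>2 = (real_of_int (D N))\<^sup>2"
      unfolding D_def of_int_sum divisor_sum_eq[OF N] ..
  qed
  also have "\<dots> \<le> (\<Sum>N\<in>?M. \<bar>real_of_int (D N)\<bar> ^ (2 * k))"
  proof (rule sum_mono)
    fix N
    show "(real_of_int (D N))\<^sup>2 \<le> \<bar>real_of_int (D N)\<bar> ^ (2 * k)"
    proof (cases "D N = 0")
      case False
      hence "1 \<le> \<bar>real_of_int (D N)\<bar>" by linarith
      hence "\<bar>real_of_int (D N)\<bar> ^ 2 \<le> \<bar>real_of_int (D N)\<bar> ^ (2 * k)" using k by (intro power_increasing) auto
      thus ?thesis by simp
    qed (use k in simp)
  qed
  also have "?w * (\<Sum>N\<in>?M. \<bar>real_of_int (D N)\<bar> ^ (2 * k)) = Poly_moment R n m k"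
    by (simp add: Poly_moment_def D_def)
  finally show ?thesis by (simp add: divide_right_mono)
qed

end

section \<open>Estimates for the moments of divisor sums\<close>

text \<open>
  Every \<open>r\<^sub>I\<close> is at most \<open>m\<close> because \<open>I\<close> is nonempty, so the cap \<open>L\<close> excludes nothing.
\<close>

lemma tuple_count_eq:
  fixes k m L :: nat
  assumes "L \<ge> m"
  defines "J \<equiv> {1..2 * k}"
  shows "tuple_count m k = card (sols (index_sets J) (odd_cap L) (spread J m))"
proof -
  let ?F = "index_sets J"
  have F: "?F = Pow J - {{}}" by (auto simp: odds_def evens_def)
  have fin: "finite ?F" by (simp add: J_def)
  have idx: "{I. I \<subseteq> J \<and> i \<in> I} = {I. I \<in> ?F \<and> i \<in> I}" for i unfolding F by auto
  have sum_out: "(\<Sum>I | I \<in> ?F \<and> i \<in> I. r I) = 0" if "i \<notin> J" for i and r :: "nat set \<Rightarrow> nat"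
  proof -
    have none: "{I. I \<in> ?F \<and> i \<in> I} = {}" using that unfolding F by auto
    show ?thesis unfolding none by simp
  qed
  have "c_tuples m k = sols ?F (odd_cap L) (spread J m)"
  proof (intro equalityI subsetI)
    fix r assume "r \<in> c_tuples m k"
    hence r: "r \<in> ?F \<rightarrow>\<^sub>E UNIV" "\<And>I. I \<in> ?F \<Longrightarrow> odd (card I) \<Longrightarrow> r I \<in> {0, 1}"
        "\<And>i. i \<in> J \<Longrightarrow> (\<Sum>I | I \<in> ?F \<and> i \<in> I. r I) = m"
      unfolding c_tuples_def J_def[symmetric] F[symmetric] idx by blast+
    show "r \<in> sols ?F (odd_cap L) (spread J m)"
    proof (rule solsI[OF _ fin])
      show "(\<Sum>I | I \<in> ?F \<and> i \<in> I. r I) = spread J m i" for i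
        using r(3)[of i] sum_out[of i r] by (cases "i \<in> J") (simp_all add: spread_def)
      show "r \<in> (\<Pi>\<^sub>E I\<in>?F. {..odd_cap L I})"
      proof (rule PiE_I)
        fix I assume I: "I \<in> ?F"
        show "r I \<in> {..odd_cap L I}"
        proof (cases "odd (card I)")
          case True
          thus ?thesis using r(2)[OF I] by (auto simp: odd_cap_def)
        next
          case False
          obtain i where i: "i \<in> I" "i \<in> J" using I unfolding F by blast
          have "r I \<le> (\<Sum>I | I \<in> ?F \<and> i \<in> I. r I)"
            using I i fin by (intro member_le_sum) auto
          thus ?thesis using False r(3)[OF i(2)] assms(1) by (simp add: odd_cap_def)
        qed
      qed (use r(1) in \<open>auto simp: PiE_def extensional_def\<close>)
    qed
  next
    fix r assume r: "r \<in> sols ?F (odd_cap L) (spread J m)"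
    have "r \<in> ?F \<rightarrow>\<^sub>E UNIV" using r by (auto simp: sols_def PiE_def)
    moreover have "r I \<in> {0, 1}" if "I \<in> ?F" "odd (card I)" for I
    proof -
      have "r I \<le> odd_cap L I" using r that(1) by (auto simp: sols_def)
      thus ?thesis using that(2) by (auto simp: odd_cap_def)
    qed
    moreover have "(\<Sum>I | I \<in> ?F \<and> i \<in> I. r I) = m" if "i \<in> J" for i
      using sols_apply[OF fin r, of i] that by (simp add: spread_def)
    ultimately show "r \<in> c_tuples m k"
      unfolding c_tuples_def J_def[symmetric] F[symmetric] idx by blast
  qed
  thus ?thesis by (simp add: tuple_count_def)
qed

lemma relative_error:
  assumes "c > 0" "\<bar>x - c\<bar> \<le> e * (c::real)"
  shows "\<exists>\<theta>. \<bar>\<theta>\<bar> \<le> e \<and> x = c * (1 + \<theta>)"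
proof (intro exI conjI)
  have "\<bar>x - c\<bar> / c \<le> e" using assms by (simp add: divide_le_eq)
  thus "\<bar>(x - c) / c\<bar> \<le> e" using assms(1) by (simp add: abs_divide)
  show "x = c * (1 + (x - c) / c)" using assms(1) by (simp add: field_simps)
qed

text \<open>
  In natural-number arithmetic the exponent is \<open>0\<close> for \<open>k = 1\<close>, which is the correct order there. The
  threshold \<open>m\<^sub>0\<close> of \<open>moment_estimate\<close> depends only on \<open>k\<close>; below it, \<open>(m + 1) ^ E\<close> is bounded and
  \<open>Poly_moment_ge\<close> suffices.
\<close>

lemma Poly_moment_estimates:
  assumes k: "k \<ge> 1"
  shows "\<exists>C>0. \<exists>C\<^sub>1>0. \<exists>C\<^sub>2>0. \<forall>(F :: nat ring) q m n.
    field F \<and> finite (carrier F) \<and> card (carrier F) = q \<and> m \<ge> 1 \<and> n \<ge> 2 * m * k \<longrightarrow>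
      0 < tuple_count m k \<and>
      \<bar>Poly_moment F n m k - real (tuple_count m k)\<bar> \<le> C / real q * real (tuple_count m k) \<and>
      C\<^sub>1 * real (m + 1) ^ (2 ^ (2 * k - 1) - 1 - 2 * k) \<le> Poly_moment F n m k \<and>
      Poly_moment F n m k \<le> C\<^sub>2 * real (m + 1) ^ (2 ^ (2 * k - 1) - 1 - 2 * k)"
proof -
  define J where "J = {1..2 * k}"
  define E where "E = 2 ^ (2 * k - 1) - 1 - 2 * k"
  have J: "finite J" "card J = 2 * k" "J \<noteq> {}" using k by (auto simp: J_def)
  have E: "excess J = E" using card_evens[OF J(1,3)] J(2) by (simp add: E_def excess_def)
  have "\<exists>C>0. \<exists>C\<^sub>0>0. \<exists>C\<^sub>1>0. \<exists>C\<^sub>2>0. \<exists>m\<^sub>0. \<forall>(primes :: nat list set) dg q m.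
    prime_system primes dg q m \<longrightarrow> prime_system.well_estimated primes dg q m J C C\<^sub>0 C\<^sub>1 C\<^sub>2 m\<^sub>0"
  proof (cases "k = 1")
    case True
    show ?thesis by (rule moment_estimate_two) (use True J in simp)
  next
    case False
    show ?thesis by (rule moment_estimate) (use False J k in auto)
  qed
  then obtain C C0 C' C2 m0 where C: "C > 0" "C0 > 0" "C' > 0" "C2 > 0"
    and est: "\<forall>(primes :: nat list set) dg q m.
      prime_system primes dg q m \<longrightarrow> prime_system.well_estimated primes dg q m J C C0 C' C2 m0"
    by (elim exE conjE)
  define \<delta> where "\<delta> = exp (- 8) / 2 / real (m0 + 1) ^ E"
  define C1 where "C1 = min C0 \<delta>"
  have \<delta>: "\<delta> > 0" by (simp add: \<delta>_def)
  have "0 < tuple_count m k \<and>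
      \<bar>Poly_moment F n m k - real (tuple_count m k)\<bar> \<le> C / real q * real (tuple_count m k) \<and>
      C1 * real (m + 1) ^ E \<le> Poly_moment F n m k \<and>
      Poly_moment F n m k \<le> (1 + C) * C2 * real (m + 1) ^ E"
    if "field F" and fin: "finite (carrier F)" and q: "card (carrier F) = q"
      and m: "m \<ge> 1" and n: "n \<ge> 2 * m * k" for F :: "nat ring" and q m n
  proof -
    interpret finite_field F using that by (simp add: finite_field_def finite_field_axioms_def)
    define c where "c = real (tuple_count m k)"
    have ps: "prime_system (small_primes m) pdeg q m"
      using prime_system_small_primes[of m] q by simp
    have mom: "prime_system.moment (small_primes m) pdeg q m J = Poly_moment F n m k"
      using Poly_moment_eq_moment[OF n] q by (simp add: J_def)
    have diag: "prime_system.diagonal m J = c"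
      unfolding c_def J_def prime_system.diagonal_def[OF ps] by (subst tuple_count_eq[of m "m + 2"]) simp_all
    from est[rule_format, OF ps, unfolded prime_system.well_estimated_def[OF ps] mom diag E]
    have c1: "C' * real (m + 1) ^ E \<le> c" and up: "c \<le> C2 * real (m + 1) ^ E"
      and close: "\<bar>Poly_moment F n m k - c\<bar> \<le> C / real q * c"
      and large: "m0 \<le> m \<Longrightarrow> E \<noteq> 0 \<Longrightarrow> C0 * real (m + 1) ^ E \<le> Poly_moment F n m k"
      by simp_all
    have "0 < C' * real (m + 1) ^ E" using C by simp
    hence c0: "0 < c" using c1 by linarith
    have low: "exp (- 8) / 2 \<le> Poly_moment F n m k" by (rule Poly_moment_ge[OF n k])
    have q2: "real q \<ge> 2" using two_le_card_carrier q by simp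
    have "Poly_moment F n m k \<le> (1 + C) * C2 * real (m + 1) ^ E"
    proof -
      have "C / real q \<le> C" using q2 C(1) by (simp add: divide_le_eq)
      hence "C / real q * c \<le> C * c" using c0 by (intro mult_right_mono) auto
      hence "Poly_moment F n m k \<le> c + C * c" using close by linarith
      also have "\<dots> = (1 + C) * c" by (simp add: algebra_simps)
      also have "\<dots> \<le> (1 + C) * (C2 * real (m + 1) ^ E)" using up C by (intro mult_left_mono) auto
      finally show ?thesis by simp
    qed
    moreover have "C1 * real (m + 1) ^ E \<le> Poly_moment F n m k"
    proof (cases "m \<ge> m0 \<and> E \<noteq> 0")
      case True
      have "C1 * real (m + 1) ^ E \<le> C0 * real (m + 1) ^ E"
        by (intro mult_right_mono) (auto simp: C1_def)
      also have "\<dots> \<le> Poly_moment F n m k" using large True by simp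
      finally show ?thesis .
    next
      case False
      hence "real (m + 1) ^ E \<le> real (m0 + 1) ^ E" by (cases "E = 0") (auto intro!: power_mono)
      hence "C1 * real (m + 1) ^ E \<le> \<delta> * real (m0 + 1) ^ E"
        using \<delta> by (intro mult_mono) (auto simp: C1_def)
      also have "\<dots> = exp (- 8) / 2" by (simp add: \<delta>_def)
      finally show ?thesis using low by linarith
    qed
    ultimately show ?thesis using c0 close by (simp add: c_def)
  qed
  note main = this
  have pos: "C1 > 0" "(1 + C) * C2 > 0" using C \<delta> by (simp_all add: C1_def)
  show ?thesis
    unfolding E_def[symmetric]
    by (rule exI[of _ C], rule conjI[OF C(1)], rule exI[of _ C1], rule conjI[OF pos(1)],
        rule exI[of _ "(1 + C) * C2"], rule conjI[OF pos(2)], intro allI impI, elim conjE, rule main)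
qed

text \<open>
  For \<open>k = 1\<close> the integer exponent is \<open>- 1\<close>, and both sides have the order of a constant.
\<close>

lemma growth_compare:
  assumes k: "k \<ge> 1" and m: "m \<ge> 1"
  defines "E \<equiv> 2 ^ (2 * k - 1) - 1 - 2 * k"
  defines "g \<equiv> 1 + real m powi (2 ^ (2 * k - 1) - 2 * int k - 1)"
  shows "g \<le> 2 * real (m + 1) ^ E" "real (m + 1) ^ E \<le> 2 ^ E * g" "g > 0"
proof -
  have "g \<le> 2 * real (m + 1) ^ E \<and> real (m + 1) ^ E \<le> 2 ^ E * g \<and> g > 0"
  proof (cases "k = 1")
    case True
    have "g = 1 + 1 / real m" using True by (simp add: g_def power_int_minus divide_inverse)
    moreover have "1 / real m \<le> 1" "1 / real m \<ge> 0" using m by auto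
    moreover have "E = 0" using True by (simp add: E_def)
    ultimately show ?thesis by (auto intro: add_pos_nonneg)
  next
    case False
    have ge: "2 ^ (j + 3) \<ge> 2 * (j + 2) + (1::nat)" for j
    proof (induction j)
      case (Suc j)
      have eq: "(2::nat) ^ (Suc j + 3) = 2 * 2 ^ (j + 3)" by (simp only: add_Suc power_Suc)
      show ?case unfolding eq using Suc by simp
    qed simp
    have "2 * k + 1 \<le> 2 ^ (2 * k - 1)"
    proof -
      obtain j where j: "k = j + 2" using False k by (metis One_nat_def Suc_1 add.commute le_Suc_ex le_neq_implies_less Suc_leI)
      have "2 * (j + 2) + (1::nat) \<le> 2 ^ (j + 3)" by (rule ge)
      also have "\<dots> \<le> 2 ^ (2 * k - 1)" using j by (intro power_increasing) auto
      finally show ?thesis using j by simp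
    qed
    hence "int E = 2 ^ (2 * k - 1) - 2 * int k - 1"
      unfolding E_def by (simp add: of_nat_diff)
    hence g: "g = 1 + real m ^ E" by (simp add: g_def flip: power_int_of_nat)
    have "1 \<le> real (m + 1) ^ E" by (intro one_le_power) auto
    moreover have "real m ^ E \<le> real (m + 1) ^ E" by (intro power_mono) auto
    moreover have "real (m + 1) ^ E \<le> (2 * real m) ^ E" using m by (intro power_mono) auto
    moreover have "(2 * real m) ^ E \<le> 2 ^ E * g" by (simp add: g power_mult_distrib)
    moreover have "g > 0" unfolding g by (intro add_pos_nonneg) auto
    ultimately show ?thesis unfolding g by linarith
  qed
  thus "g \<le> 2 * real (m + 1) ^ E" "real (m + 1) ^ E \<le> 2 ^ E * g" "g > 0" by auto
qed

theorem theorem1p2: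
  fixes k :: nat
  assumes "k \<ge> 1"
  shows "\<exists>C > 0. \<exists>C\<^sub>1 > 0. \<exists>C\<^sub>2 > 0. \<forall>(F :: nat ring) (q :: nat) (m :: nat) (n :: nat).
    field F \<and> finite (carrier F) \<and> card (carrier F) = q \<and> m \<ge> 1 \<and> n \<ge> 2 * m * k \<longrightarrow>
      (\<exists>\<theta> :: real. \<bar>\<theta>\<bar> \<le> C / real q \<and> Poly_moment F n m k = real (tuple_count m k) * (1 + \<theta>)) \<and>
      C\<^sub>1 * (1 + real m powi (2 ^ (2 * k - 1) - 2 * int k - 1)) \<le> Poly_moment F n m k \<and>
      Poly_moment F n m k \<le> C\<^sub>2 * (1 + real m powi (2 ^ (2 * k - 1) - 2 * int k - 1))"
proof -
  define E where "E = 2 ^ (2 * k - 1) - 1 - 2 * k"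
  obtain C C1 C2 where C: "C > 0" "C1 > 0" "C2 > 0"
    and est: "\<And>(F :: nat ring) q m n.
    field F \<and> finite (carrier F) \<and> card (carrier F) = q \<and> m \<ge> 1 \<and> n \<ge> 2 * m * k \<Longrightarrow>
      0 < tuple_count m k \<and>
      \<bar>Poly_moment F n m k - real (tuple_count m k)\<bar> \<le> C / real q * real (tuple_count m k) \<and>
      C1 * real (m + 1) ^ E \<le> Poly_moment F n m k \<and> Poly_moment F n m k \<le> C2 * real (m + 1) ^ E"
    using Poly_moment_estimates[OF assms] unfolding E_def[symmetric] by metis
  have pos: "C1 / 2 > 0" "C2 * 2 ^ E > 0" using C by auto
  show ?thesis
  proof (rule exI[of _ C], rule conjI[OF C(1)], rule exI[of _ "C1 / 2"], rule conjI[OF pos(1)],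
      rule exI[of _ "C2 * 2 ^ E"], rule conjI[OF pos(2)], intro allI impI conjI)
    fix F :: "nat ring" and q m n
    assume F: "field F \<and> finite (carrier F) \<and> card (carrier F) = q \<and> m \<ge> 1 \<and> n \<ge> 2 * m * k"
    note est = est[OF F]
    have m: "m \<ge> 1" using F by blast
    note g = growth_compare[OF assms m, folded E_def]
    let ?g = "1 + real m powi (2 ^ (2 * k - 1) - 2 * int k - 1)"
    show "\<exists>\<theta>. \<bar>\<theta>\<bar> \<le> C / real q \<and> Poly_moment F n m k = real (tuple_count m k) * (1 + \<theta>)"
      using est by (intro relative_error) auto
    have "C1 / 2 * ?g \<le> C1 / 2 * (2 * real (m + 1) ^ E)"
      using C g(1) by (intro mult_left_mono) auto
    thus "C1 / 2 * ?g \<le> Poly_moment F n m k" using est by simp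
    have "C2 * real (m + 1) ^ E \<le> C2 * (2 ^ E * ?g)"
      using C g(2) by (intro mult_left_mono) auto
    thus "Poly_moment F n m k \<le> C2 * 2 ^ E * ?g" using est by (simp add: mult.assoc)
  qed
qed

end
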